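(* Let $\theta$ be any first-order sentence in the language of unital rings $\{+,-,\cdot,0,1\}$. Then for all but finitely many prime numbers $p$, $$\mathbb{Z}_p\models\theta \iff \mathbb{F}_p[[t]]\models\theta.$$ Equivalently, for any sentence $\theta$ in the three-sorted language $\mathscr{L}_{\mathrm{3s}}$ of valued fields, for all but finitely many prime numbers $p$, $$(\mathbb{Q}_p,\mathbb{F}_p,\mathbb{Z})\models\theta\iff(\mathbb{F}_p((t)),\mathbb{F}_p,\mathbb{Z})\models\theta.$$
   Context: $\mathbb{Z}_p$ is the ring of $p$-adic integers, $\mathbb{Q}_p$ its fraction field with the $p$-adic valuation $v_p$ (value group $\mathbb{Z}$, residue field $\mathbb{F}_p$). $\mathbb{F}_p[[t]]$ is the ring of formal power series, and $\mathbb{F}_p((t))$ its fraction field (formal Laurent series) with the $t$-adic valuation (value group $\mathbb{Z}$, residue field $\mathbb{F}_p$). A valued field is a field $K$ with a group homomorphism $v:K^\times\to\Gamma$ to an ordered abelian group $\Gamma$ with $v(a+b)\ge\min\{v(a),v(b)\}$, extended by $v(0)=\infty$, where $\infty>\gamma$ for all $\gamma\in\Gamma$. Its valuation ring is $\mathcal{O}=\{a: v(a)\ge 0\}$, its maximal ideal is $\mathfrak{m}=\{a: v(a)>0\}$, its residue field is $k=\mathcal{O}/\mathfrak{m}$. The language $\mathscr{L}_{\mathrm{3s}}$ has three sorts: a valued field sort $K$ with symbols $+,-,\cdot,0,1$; a residue field sort $k$ with its own copy of $+,-,\cdot,0,1$; a value group sort $\Gamma\cup\{\infty\}$ with symbols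 $+,-,<,0,\infty$; together with function symbols $v:K\to\Gamma\cup\{\infty\}$ and $\mathrm{res}:K\to k$. A valued field with surjective valuation is viewed as an $\mathscr{L}_{\mathrm{3s}}$-structure $(K,k,\Gamma)$ by interpreting $v$ as the valuation and $\mathrm{res}$ as the residue map $\mathcal{O}\to k$ extended by $0$ on $K\setminus\mathcal{O}$; on the value group sort, $\gamma+\infty=\infty$ and $-\infty=\infty$. *)

theory Defs
  imports
    "HOL-Algebra.QuotRing"
    "HOL-Algebra.Divisibility"
    "HOL-Number_Theory.Residues"
begin

section \<open>First-order logic of unital rings\<close>

datatype ring_term =
    RVar nat
  | RZero
  | ROne
  | RAdd ring_term ring_term
  | RNeg ring_term
  | RMult ring_term ring_term

datatype ring_formula =
    REq ring_term ring_term
  | RNot ring_formula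
  | RAnd ring_formula ring_formula
  | REx nat ring_formula

primrec ring_term_vars :: "ring_term \<Rightarrow> nat set" where
  "ring_term_vars (RVar n) = {n}"
| "ring_term_vars RZero = {}"
| "ring_term_vars ROne = {}"
| "ring_term_vars (RAdd s t) = ring_term_vars s \<union> ring_term_vars t"
| "ring_term_vars (RNeg t) = ring_term_vars t"
| "ring_term_vars (RMult s t) = ring_term_vars s \<union> ring_term_vars t"

primrec ring_free_vars :: "ring_formula \<Rightarrow> nat set" where
  "ring_free_vars (REq s t) = ring_term_vars s \<union> ring_term_vars t"
| "ring_free_vars (RNot \<phi>) = ring_free_vars \<phi>"
| "ring_free_vars (RAnd \<phi> \<psi>) = ring_free_vars \<phi> \<union> ring_free_vars \<psi>"
| "ring_free_vars (REx n \<phi>) = ring_free_vars \<phi> - {n}"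

definition ring_sentence :: "ring_formula \<Rightarrow> bool" where
  "ring_sentence \<theta> \<longleftrightarrow> ring_free_vars \<theta> = {}"

primrec ring_eval :: "('a, 'm) ring_scheme \<Rightarrow> (nat \<Rightarrow> 'a) \<Rightarrow> ring_term \<Rightarrow> 'a" where
  "ring_eval R e (RVar n) = e n"
| "ring_eval R e RZero = \<zero>\<^bsub>R\<^esub>"
| "ring_eval R e ROne = \<one>\<^bsub>R\<^esub>"
| "ring_eval R e (RAdd s t) = ring_eval R e s \<oplus>\<^bsub>R\<^esub> ring_eval R e t"
| "ring_eval R e (RNeg t) = \<ominus>\<^bsub>R\<^esub> ring_eval R e t"
| "ring_eval R e (RMult s t) = ring_eval R e s \<otimes>\<^bsub>R\<^esub> ring_eval R e t"

primrec ring_sat :: "('a, 'm) ring_scheme \<Rightarrow> (nat \<Rightarrow> 'a) \<Rightarrow> ring_formula \<Rightarrow> bool" where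
  "ring_sat R e (REq s t) \<longleftrightarrow> ring_eval R e s = ring_eval R e t"
| "ring_sat R e (RNot \<phi>) \<longleftrightarrow> \<not> ring_sat R e \<phi>"
| "ring_sat R e (RAnd \<phi> \<psi>) \<longleftrightarrow> ring_sat R e \<phi> \<and> ring_sat R e \<psi>"
| "ring_sat R e (REx n \<phi>) \<longleftrightarrow> (\<exists>a\<in>carrier R. ring_sat R (e(n := a)) \<phi>)"

definition ring_models :: "('a, 'm) ring_scheme \<Rightarrow> ring_formula \<Rightarrow> bool" (infix \<open>\<Turnstile>\<^sub>r\<close> 50) where
  "R \<Turnstile>\<^sub>r \<theta> \<longleftrightarrow> (\<forall>e. range e \<subseteq> carrier R \<longrightarrow> ring_sat R e \<theta>)"


section \<open>The three-sorted language of valued fields\<close>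

text \<open>Each sort has its own supply of variables, indexed by natural numbers. The terms of the
  valued field sort are exactly the ring terms.\<close>

datatype res_term =
    KVar nat
  | KZero
  | KOne
  | KAdd res_term res_term
  | KNeg res_term
  | KMult res_term res_term
  | Res ring_term

datatype grp_term =
    GVar nat
  | GZero
  | GInfty
  | GAdd grp_term grp_term
  | GNeg grp_term
  | Valuation ring_term

datatype vf_formula =
    EqF ring_term ring_term
  | EqK res_term res_term
  | EqG grp_term grp_term
  | LessG grp_term grp_term
  | NotV vf_formula
  | AndV vf_formula vf_formula
  | ExF nat vf_formula
  | ExK nat vf_formula
  | ExG nat vf_formula

datatype vf_sort = Field_Sort | Residue_Sort | Group_Sort

primrec res_term_vars :: "res_term \<Rightarrow> (vf_sort \<times> nat) set" where
  "res_term_vars (KVar n) = {(Residue_Sort, n)}"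
| "res_term_vars KZero = {}"
| "res_term_vars KOne = {}"
| "res_term_vars (KAdd s t) = res_term_vars s \<union> res_term_vars t"
| "res_term_vars (KNeg t) = res_term_vars t"
| "res_term_vars (KMult s t) = res_term_vars s \<union> res_term_vars t"
| "res_term_vars (Res t) = Pair Field_Sort ` ring_term_vars t"

primrec grp_term_vars :: "grp_term \<Rightarrow> (vf_sort \<times> nat) set" where
  "grp_term_vars (GVar n) = {(Group_Sort, n)}"
| "grp_term_vars GZero = {}"
| "grp_term_vars GInfty = {}"
| "grp_term_vars (GAdd s t) = grp_term_vars s \<union> grp_term_vars t"
| "grp_term_vars (GNeg t) = grp_term_vars t"
| "grp_term_vars (Valuation t) = Pair Field_Sort ` ring_term_vars t"

primrec vf_free_vars :: "vf_formula \<Rightarrow> (vf_sort \<times> nat) set" where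
  "vf_free_vars (EqF s t) = Pair Field_Sort ` (ring_term_vars s \<union> ring_term_vars t)"
| "vf_free_vars (EqK s t) = res_term_vars s \<union> res_term_vars t"
| "vf_free_vars (EqG s t) = grp_term_vars s \<union> grp_term_vars t"
| "vf_free_vars (LessG s t) = grp_term_vars s \<union> grp_term_vars t"
| "vf_free_vars (NotV \<phi>) = vf_free_vars \<phi>"
| "vf_free_vars (AndV \<phi> \<psi>) = vf_free_vars \<phi> \<union> vf_free_vars \<psi>"
| "vf_free_vars (ExF n \<phi>) = vf_free_vars \<phi> - {(Field_Sort, n)}"
| "vf_free_vars (ExK n \<phi>) = vf_free_vars \<phi> - {(Residue_Sort, n)}"
| "vf_free_vars (ExG n \<phi>) = vf_free_vars \<phi> - {(Group_Sort, n)}"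

definition vf_sentence :: "vf_formula \<Rightarrow> bool" where
  "vf_sentence \<theta> \<longleftrightarrow> vf_free_vars \<theta> = {}"

record ('a, 'k, 'g) vf_structure =
  field_sort :: "'a ring"
  residue_sort :: "'k ring"
  group_sort :: "'g set"
  group_add :: "'g \<Rightarrow> 'g \<Rightarrow> 'g"
  group_neg :: "'g \<Rightarrow> 'g"
  group_less :: "'g \<Rightarrow> 'g \<Rightarrow> bool"
  group_zero :: "'g"
  group_infty :: "'g"
  val_map :: "'a \<Rightarrow> 'g"
  res_map :: "'a \<Rightarrow> 'k"

primrec res_eval ::
    "('a, 'k, 'g) vf_structure \<Rightarrow> (nat \<Rightarrow> 'a) \<Rightarrow> (nat \<Rightarrow> 'k) \<Rightarrow> res_term \<Rightarrow> 'k" where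
  "res_eval M e f (KVar n) = f n"
| "res_eval M e f KZero = \<zero>\<^bsub>residue_sort M\<^esub>"
| "res_eval M e f KOne = \<one>\<^bsub>residue_sort M\<^esub>"
| "res_eval M e f (KAdd s t) = res_eval M e f s \<oplus>\<^bsub>residue_sort M\<^esub> res_eval M e f t"
| "res_eval M e f (KNeg t) = \<ominus>\<^bsub>residue_sort M\<^esub> res_eval M e f t"
| "res_eval M e f (KMult s t) = res_eval M e f s \<otimes>\<^bsub>residue_sort M\<^esub> res_eval M e f t"
| "res_eval M e f (Res t) = res_map M (ring_eval (field_sort M) e t)"

primrec grp_eval ::
    "('a, 'k, 'g) vf_structure \<Rightarrow> (nat \<Rightarrow> 'a) \<Rightarrow> (nat \<Rightarrow> 'g) \<Rightarrow> grp_term \<Rightarrow> 'g" where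
  "grp_eval M e g (GVar n) = g n"
| "grp_eval M e g GZero = group_zero M"
| "grp_eval M e g GInfty = group_infty M"
| "grp_eval M e g (GAdd s t) = group_add M (grp_eval M e g s) (grp_eval M e g t)"
| "grp_eval M e g (GNeg t) = group_neg M (grp_eval M e g t)"
| "grp_eval M e g (Valuation t) = val_map M (ring_eval (field_sort M) e t)"

primrec vf_sat ::
    "('a, 'k, 'g) vf_structure \<Rightarrow> (nat \<Rightarrow> 'a) \<Rightarrow> (nat \<Rightarrow> 'k) \<Rightarrow> (nat \<Rightarrow> 'g) \<Rightarrow> vf_formula \<Rightarrow> bool" where
  "vf_sat M e f g (EqF s t) \<longleftrightarrow> ring_eval (field_sort M) e s = ring_eval (field_sort M) e t"
| "vf_sat M e f g (EqK s t) \<longleftrightarrow> res_eval M e f s = res_eval M e f t"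
| "vf_sat M e f g (EqG s t) \<longleftrightarrow> grp_eval M e g s = grp_eval M e g t"
| "vf_sat M e f g (LessG s t) \<longleftrightarrow> group_less M (grp_eval M e g s) (grp_eval M e g t)"
| "vf_sat M e f g (NotV \<phi>) \<longleftrightarrow> \<not> vf_sat M e f g \<phi>"
| "vf_sat M e f g (AndV \<phi> \<psi>) \<longleftrightarrow> vf_sat M e f g \<phi> \<and> vf_sat M e f g \<psi>"
| "vf_sat M e f g (ExF n \<phi>) \<longleftrightarrow> (\<exists>a\<in>carrier (field_sort M). vf_sat M (e(n := a)) f g \<phi>)"
| "vf_sat M e f g (ExK n \<phi>) \<longleftrightarrow> (\<exists>a\<in>carrier (residue_sort M). vf_sat M e (f(n := a)) g \<phi>)"
| "vf_sat M e f g (ExG n \<phi>) \<longleftrightarrow> (\<exists>a\<in>group_sort M. vf_sat M e f (g(n := a)) \<phi>)"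

definition vf_models :: "('a, 'k, 'g) vf_structure \<Rightarrow> vf_formula \<Rightarrow> bool" (infix \<open>\<Turnstile>\<^sub>v\<close> 50) where
  "M \<Turnstile>\<^sub>v \<theta> \<longleftrightarrow>
    (\<forall>e f g. range e \<subseteq> carrier (field_sort M) \<longrightarrow> range f \<subseteq> carrier (residue_sort M) \<longrightarrow>
       range g \<subseteq> group_sort M \<longrightarrow> vf_sat M e f g \<theta>)"


section \<open>Valued fields as three-sorted structures\<close>

datatype 'g with_infty = Fin 'g | Infty

instantiation with_infty :: (linordered_ab_group_add) "{zero, plus, uminus, linorder}"
begin

definition "0 = Fin 0"

fun plus_with_infty :: "'a with_infty \<Rightarrow> 'a with_infty \<Rightarrow> 'a with_infty" where
  "Fin a + Fin b = Fin (a + b)"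
| "Infty + x = Infty"
| "x + Infty = Infty"

fun uminus_with_infty :: "'a with_infty \<Rightarrow> 'a with_infty" where
  "- Fin a = Fin (- a)"
| "- Infty = Infty"

fun less_with_infty :: "'a with_infty \<Rightarrow> 'a with_infty \<Rightarrow> bool" where
  "Fin a < Fin b \<longleftrightarrow> a < b"
| "Fin a < Infty \<longleftrightarrow> True"
| "Infty < x \<longleftrightarrow> False"

definition less_eq_with_infty :: "'a with_infty \<Rightarrow> 'a with_infty \<Rightarrow> bool" where
  "x \<le> y \<longleftrightarrow> x = y \<or> x < (y :: 'a with_infty)"

instance
proof
  fix x y z :: "'a with_infty"
  show "x < y \<longleftrightarrow> x \<le> y \<and> \<not> y \<le> x"
    by (cases x; cases y) (auto simp: less_eq_with_infty_def)
  show "x \<le> x" by (simp add: less_eq_with_infty_def)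
  show "x \<le> z" if "x \<le> y" "y \<le> z"
    using that by (cases x; cases y; cases z) (auto simp: less_eq_with_infty_def)
  show "x = y" if "x \<le> y" "y \<le> x"
    using that by (cases x; cases y) (auto simp: less_eq_with_infty_def)
  show "x \<le> y \<or> y \<le> x"
    by (cases x; cases y) (auto simp: less_eq_with_infty_def)
qed

end

definition valuation_ring :: "'a ring \<Rightarrow> ('a \<Rightarrow> 'g::linordered_ab_group_add with_infty) \<Rightarrow> 'a ring" where
  "valuation_ring K v = K\<lparr>carrier := {a \<in> carrier K. v a \<ge> 0}\<rparr>"

definition valuation_ideal :: "'a ring \<Rightarrow> ('a \<Rightarrow> 'g::linordered_ab_group_add with_infty) \<Rightarrow> 'a set" where
  "valuation_ideal K v = {a \<in> carrier K. v a > 0}"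

definition residue_field :: "'a ring \<Rightarrow> ('a \<Rightarrow> 'g::linordered_ab_group_add with_infty) \<Rightarrow> 'a set ring" where
  "residue_field K v = valuation_ring K v Quot valuation_ideal K v"

definition residue_map :: "'a ring \<Rightarrow> ('a \<Rightarrow> 'g::linordered_ab_group_add with_infty) \<Rightarrow> 'a \<Rightarrow> 'a set" where
  "residue_map K v a =
    (if a \<in> carrier (valuation_ring K v) then valuation_ideal K v +>\<^bsub>valuation_ring K v\<^esub> a
     else \<zero>\<^bsub>residue_field K v\<^esub>)"

text \<open>The value group is the whole type \<^term>\<open>UNIV :: 'g set\<close>, in line with the requirement that
  the valuation be surjective.\<close>

definition vf_structure_of ::
    "'a ring \<Rightarrow> ('a \<Rightarrow> 'g::linordered_ab_group_add with_infty) \<Rightarrow> ('a, 'a set, 'g with_infty) vf_structure" where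
  "vf_structure_of K v =
    \<lparr>field_sort = K, residue_sort = residue_field K v, group_sort = UNIV,
     group_add = (+), group_neg = uminus, group_less = (<), group_zero = 0, group_infty = Infty,
     val_map = v, res_map = residue_map K v\<rparr>"


section \<open>Fraction fields\<close>

definition frac_rel :: "('a, 'm) ring_scheme \<Rightarrow> (('a \<times> 'a) \<times> ('a \<times> 'a)) set" where
  "frac_rel R = {((a, b), (c, d)).
     a \<in> carrier R \<and> b \<in> carrier R - {\<zero>\<^bsub>R\<^esub>} \<and> c \<in> carrier R \<and> d \<in> carrier R - {\<zero>\<^bsub>R\<^esub>} \<and>
     a \<otimes>\<^bsub>R\<^esub> d = c \<otimes>\<^bsub>R\<^esub> b}"

definition fraction_field :: "('a, 'm) ring_scheme \<Rightarrow> ('a \<times> 'a) set ring" where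
  "fraction_field R =
    \<lparr>carrier = (carrier R \<times> (carrier R - {\<zero>\<^bsub>R\<^esub>})) // frac_rel R,
     monoid.mult = (\<lambda>X Y. \<Union>(a, b)\<in>X. \<Union>(c, d)\<in>Y. frac_rel R `` {(a \<otimes>\<^bsub>R\<^esub> c, b \<otimes>\<^bsub>R\<^esub> d)}),
     one = frac_rel R `` {(\<one>\<^bsub>R\<^esub>, \<one>\<^bsub>R\<^esub>)},
     zero = frac_rel R `` {(\<zero>\<^bsub>R\<^esub>, \<one>\<^bsub>R\<^esub>)},
     add = (\<lambda>X Y. \<Union>(a, b)\<in>X. \<Union>(c, d)\<in>Y.
              frac_rel R `` {((a \<otimes>\<^bsub>R\<^esub> d) \<oplus>\<^bsub>R\<^esub> (c \<otimes>\<^bsub>R\<^esub> b), b \<otimes>\<^bsub>R\<^esub> d)})\<rparr>"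

text \<open>The \<open>\<pi>\<close>-adic valuation on a domain in which every nonzero element is divisible by only
  finitely many powers of the prime element \<open>\<pi>\<close>, and its extension to the fraction field by
  \<open>v (a / b) = v a - v b\<close>.\<close>

definition adic_order :: "('a, 'm) ring_scheme \<Rightarrow> 'a \<Rightarrow> 'a \<Rightarrow> nat" where
  "adic_order R \<pi> a = (GREATEST n. (\<pi> [^]\<^bsub>R\<^esub> n) divides\<^bsub>R\<^esub> a)"

definition adic_valuation :: "('a, 'm) ring_scheme \<Rightarrow> 'a \<Rightarrow> ('a \<times> 'a) set \<Rightarrow> int with_infty" where
  "adic_valuation R \<pi> X =
    (if X = \<zero>\<^bsub>fraction_field R\<^esub> then Infty
     else Fin (the_elem ((\<lambda>(a, b). int (adic_order R \<pi> a) - int (adic_order R \<pi> b)) ` X)))"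


section \<open>The \<open>p\<close>-adic integers and formal power series\<close>

text \<open>Inverse limit of the rings \<open>\<int>/p\<^sup>n\<int>\<close>, with residue classes represented in \<open>{0..<p\<^sup>n}\<close>.\<close>

definition padic_integers :: "nat \<Rightarrow> (nat \<Rightarrow> int) ring" where
  "padic_integers p =
    \<lparr>carrier = {x. \<forall>n. x n \<in> {0..<int p ^ n} \<and> x (Suc n) mod int p ^ n = x n},
     monoid.mult = (\<lambda>x y n. (x n * y n) mod int p ^ n),
     one = (\<lambda>n. 1 mod int p ^ n),
     zero = (\<lambda>n. 0),
     add = (\<lambda>x y n. (x n + y n) mod int p ^ n)\<rparr>"

text \<open>Carrier-based rather than the library type of formal power series, because the coefficient
  field \<open>\<int>/p\<int>\<close> has to vary with \<open>p\<close> inside a single formula.\<close>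

definition power_series_ring :: "('a, 'm) ring_scheme \<Rightarrow> (nat \<Rightarrow> 'a) ring" where
  "power_series_ring R =
    \<lparr>carrier = {f. \<forall>n. f n \<in> carrier R},
     monoid.mult = (\<lambda>f g n. \<Oplus>\<^bsub>R\<^esub>i\<in>{..n}. f i \<otimes>\<^bsub>R\<^esub> g (n - i)),
     one = (\<lambda>n. if n = 0 then \<one>\<^bsub>R\<^esub> else \<zero>\<^bsub>R\<^esub>),
     zero = (\<lambda>n. \<zero>\<^bsub>R\<^esub>),
     add = (\<lambda>f g n. f n \<oplus>\<^bsub>R\<^esub> g n)\<rparr>"

definition power_series_var :: "('a, 'm) ring_scheme \<Rightarrow> nat \<Rightarrow> 'a" where
  "power_series_var R = (\<lambda>n. if n = 1 then \<one>\<^bsub>R\<^esub> else \<zero>\<^bsub>R\<^esub>)"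

definition Fp_power_series :: "nat \<Rightarrow> (nat \<Rightarrow> int) ring" where
  "Fp_power_series p = power_series_ring (residue_ring (int p))"

definition Qp_structure ::
    "nat \<Rightarrow> (((nat \<Rightarrow> int) \<times> (nat \<Rightarrow> int)) set, ((nat \<Rightarrow> int) \<times> (nat \<Rightarrow> int)) set set, int with_infty) vf_structure" where
  "Qp_structure p =
    vf_structure_of (fraction_field (padic_integers p))
      (adic_valuation (padic_integers p) (add_pow (padic_integers p) p \<one>\<^bsub>padic_integers p\<^esub>))"

definition Fp_Laurent_structure ::
    "nat \<Rightarrow> (((nat \<Rightarrow> int) \<times> (nat \<Rightarrow> int)) set, ((nat \<Rightarrow> int) \<times> (nat \<Rightarrow> int)) set set, int with_infty) vf_structure" where
  "Fp_Laurent_structure p =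
    vf_structure_of (fraction_field (Fp_power_series p))
      (adic_valuation (Fp_power_series p) (power_series_var (residue_ring (int p))))"

end

(*
  The field quantifier is eliminated relative to leading terms.  In the p-adic numbers and in the
  Laurent series over the field with p elements, a nonzero x has a leading term rv x consisting of
  its valuation and its leading digit, an element of the SAME set in both fields.  The key step
  says: for finitely many integer polynomials P(x,y) there are finitely many integer polynomials
  Q(x) such that, for large p, if tuples a and b in the two fields have equal leading terms
  rv Q(a) = rv Q(b), then every c in the first field has a partner c' in the second one with
  rv P(a,c) = rv P(b,c').  Since value groups and residue fields are literally equal, induction on
  formulas finishes the proof.

  For the key step, consider the roots c0 of all derivatives of the P(a,y), and choose one closest
  to c.  Expanded around c0, no cancellation of leading terms takes place at c: a cancellation
  would give, by Hensel's lemma applied to a suitable derivative, a root closer to c.  So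
  rv P(a,c) is determined by rv (c - c0) and the leading terms of the Taylor coefficients at c0,
  and it remains to find a partner of c0, which is done by induction on the degree.

  Both fields are quotients of the ring of Laurent series over the integers (X is mapped to p or
  to the variable), so that polynomials over a single type serve all p simultaneously.
*)
theory Submission
  imports Defs "HOL-Computational_Algebra.Formal_Laurent_Series"
begin

text \<open>The delicate point is the partner of a root c of F. Roots of F itself cannot serve as
  centers there, since their partners are what is sought; only proper derivatives of F and
  remainders modulo F, with their derivatives, are of smaller degree. Seen from the closest such
  center, the leading digits of F do cancel at c, but those of its first derivative do not, as this
  would give a closer root of a proper derivative. So after rescaling c reduces to a simple root,
  and Hensel's lemma lifts it in the second field too. Polynomials of large degree are replaced by
  their remainders modulo F, after multiplication by a power of the leading coefficient. All
  polynomials are fixed before p, so their coefficients lie in a ring of term functions that is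
  specialised to each field; whether a leading coefficient vanishes there is not known in advance,
  and both cases are prepared. The bound on p has two sources. It exceeds the degrees, so that the
  integers relating successive divided derivatives are units. It also exceeds the integers that the
  terms denote when all variables are 0, so that their leading terms agree at the start.\<close>

section \<open>Leading terms\<close>

text \<open>The leading term \<open>Some (g, a)\<close> consists of the valuation \<open>g\<close> and the leading digit
  \<open>0 < a < p\<close>; zero has leading term \<^term>\<open>None\<close>.  The ring \<open>'k\<close> below is not a field: it stands
  for the valued field obtained by factoring out the ideal of all elements with leading term
  \<^term>\<open>None\<close>.\<close>

type_synonym lead = "(int \<times> int) option"

fun lead_mult :: "nat \<Rightarrow> lead \<Rightarrow> lead \<Rightarrow> lead" where
  "lead_mult p (Some (g, a)) (Some (h, b)) = Some (g + h, a * b mod int p)"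
| "lead_mult p _ _ = None"

definition val_ge :: "('k \<Rightarrow> lead) \<Rightarrow> int \<Rightarrow> 'k \<Rightarrow> bool" where
  "val_ge rv \<gamma> x \<longleftrightarrow> (case rv x of None \<Rightarrow> True | Some (g, a) \<Rightarrow> \<gamma> \<le> g)"

text \<open>For x of valuation at least \<gamma> this is the residue of x divided by an element with
  leading term \<open>Some (\<gamma>, 1)\<close>. Unlike \<open>rv\<close> it is additive there, so
  computations with sums pass through it. For smaller valuations 0 is a default.\<close>

definition digit :: "('k \<Rightarrow> lead) \<Rightarrow> int \<Rightarrow> 'k \<Rightarrow> int" where
  "digit rv \<gamma> x = (case rv x of None \<Rightarrow> 0 | Some (g, a) \<Rightarrow> if g = \<gamma> then a else 0)"

text \<open>Modulo the elements with leading term \<open>None\<close> this axiomatizes a complete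
  valued field with the integers as value group and a residue field of p elements. The sequences in
  \<open>complete\<close> start in the valuation ring and have n-th step of valuation at least n,
  which is what the iteration in \<open>hensel\<close> produces.\<close>

locale lead_ring =
  fixes p :: nat and rv :: "'k::comm_ring_1 \<Rightarrow> lead"
  assumes prime_p: "prime p"
    and rv_range: "rv x = Some (g, a) \<Longrightarrow> 0 < a \<and> a < int p"
    and rv_0 [simp]: "rv 0 = None"
    and rv_1: "rv 1 = Some (0, 1)"
    and rv_mult: "rv (x * y) = lead_mult p (rv x) (rv y)"
    and val_ge_add: "val_ge rv \<gamma> x \<Longrightarrow> val_ge rv \<gamma> y \<Longrightarrow> val_ge rv \<gamma> (x + y)"
    and digit_add: "val_ge rv \<gamma> x \<Longrightarrow> val_ge rv \<gamma> y \<Longrightarrow>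
      digit rv \<gamma> (x + y) = (digit rv \<gamma> x + digit rv \<gamma> y) mod int p"
    and rv_surj: "0 < a \<Longrightarrow> a < int p \<Longrightarrow> \<exists>x. rv x = Some (g, a)"
    and complete: "(\<And>n. val_ge rv (int n) (X (Suc n) - X n)) \<Longrightarrow> val_ge rv 0 (X 0) \<Longrightarrow>
      \<exists>s. \<forall>n. val_ge rv (int n) (s - X n)"
begin

abbreviation V where "V \<equiv> val_ge rv"
abbreviation dg where "dg \<equiv> digit rv"

lemma p_gt_1: "1 < int p"
  using prime_gt_1_nat[OF prime_p] by simp

lemma digit_ge_0: "0 \<le> dg \<gamma> x" and digit_less: "dg \<gamma> x < int p"
  using rv_range[of x] p_gt_1 by (auto simp: digit_def split: option.splits)

lemma digit_mod [simp]: "dg \<gamma> x mod int p = dg \<gamma> x"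
  using digit_ge_0 digit_less by simp

lemma val_ge_mono: "V \<gamma> x \<Longrightarrow> \<delta> \<le> \<gamma> \<Longrightarrow> V \<delta> x"
  by (auto simp: val_ge_def split: option.splits)

lemma val_ge_0 [simp]: "V \<gamma> 0" and digit_0 [simp]: "dg \<gamma> 0 = 0"
  by (auto simp: val_ge_def digit_def)

lemma digit_eq_0_iff: "V \<gamma> x \<Longrightarrow> dg \<gamma> x = 0 \<longleftrightarrow> V (\<gamma> + 1) x"
  using rv_range[of x] by (fastforce simp: val_ge_def digit_def split: option.splits)

lemma rv_eq_Some_iff: "rv x = Some (\<gamma>, a) \<longleftrightarrow> V \<gamma> x \<and> dg \<gamma> x = a \<and> a \<noteq> 0"
  using rv_range[of x \<gamma> a] by (auto simp: val_ge_def digit_def split: option.splits if_splits)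

lemma rv_eq_None_iff: "rv x = None \<longleftrightarrow> (\<forall>n. V (int n) x)"
proof
  assume *: "\<forall>n. V (int n) x"
  show "rv x = None"
  proof (rule ccontr)
    assume "rv x \<noteq> None"
    then obtain g a where "rv x = Some (g, a)" by auto
    moreover have "V (int (nat (g + 1))) x" using * by blast
    ultimately show False by (simp add: val_ge_def split: if_splits)
  qed
qed (simp add: val_ge_def)

lemma val_ge_None: "rv x = None \<Longrightarrow> V \<gamma> x" and digit_None: "rv x = None \<Longrightarrow> dg \<gamma> x = 0"
  by (auto simp: val_ge_def digit_def)

lemma val_ge_mult: "V \<gamma> x \<Longrightarrow> V \<delta> y \<Longrightarrow> V (\<gamma> + \<delta>) (x * y)"
  by (auto simp: val_ge_def rv_mult split: option.splits)

lemma digit_mult: "V \<gamma> x \<Longrightarrow> V \<delta> y \<Longrightarrow> dg (\<gamma> + \<delta>) (x * y) = dg \<gamma> x * dg \<delta> y mod int p"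
  by (auto simp: val_ge_def digit_def rv_mult split: option.splits)

lemma rv_mult_None: "rv x = None \<or> rv y = None \<Longrightarrow> rv (x * y) = None"
  by (cases "rv x"; cases "rv y") (auto simp: rv_mult)

lemma lead_mult_eq_None: assumes "rv x \<noteq> None" "rv y \<noteq> None" shows "rv (x * y) \<noteq> None"
  using assms by (auto simp: rv_mult)

lemma val_ge_1 [simp]: "V 0 1" and digit_1 [simp]: "dg 0 1 = 1"
  by (auto simp: val_ge_def digit_def rv_1)

lemma val_ge_minus: assumes "V \<gamma> x" shows "V \<gamma> (- x)"
proof -
  \<comment> \<open>From (-1)^2 = 1 the valuation of -1 is 0, as the integers have no
    torsion.\<close>
  have "lead_mult p (rv (- 1)) (rv (- 1)) = Some (0, 1)"
    using rv_mult[of "- 1" "- 1"] rv_1 by simp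
  hence "V 0 (- 1)" by (cases "rv (- 1)") (auto simp: val_ge_def)
  hence "V (0 + \<gamma>) (- 1 * x)" using assms by (rule val_ge_mult)
  thus ?thesis by simp
qed

lemma digit_minus: assumes "V \<gamma> x" shows "dg \<gamma> (- x) = (- dg \<gamma> x) mod int p"
proof -
  have "(dg \<gamma> x + dg \<gamma> (- x)) mod int p = 0"
    using digit_add[OF assms val_ge_minus[OF assms]] by simp
  hence "int p dvd dg \<gamma> (- x) - (- dg \<gamma> x)" by (simp add: dvd_eq_mod_eq_0 add.commute)
  hence "dg \<gamma> (- x) mod int p = (- dg \<gamma> x) mod int p" by (simp only: mod_eq_dvd_iff)
  thus ?thesis by (simp only: digit_mod)
qed

lemma val_ge_diff: "V \<gamma> x \<Longrightarrow> V \<gamma> y \<Longrightarrow> V \<gamma> (x - y)"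
  using val_ge_add[of \<gamma> x "- y"] val_ge_minus[of \<gamma> y] by simp

lemma digit_diff: "V \<gamma> x \<Longrightarrow> V \<gamma> y \<Longrightarrow> dg \<gamma> (x - y) = (dg \<gamma> x - dg \<gamma> y) mod int p"
  using digit_add[of \<gamma> x "- y"] val_ge_minus[of \<gamma> y] digit_minus[of \<gamma> y]
  by (simp add: mod_simps)

lemma val_ge_sum: "(\<And>i. i \<in> A \<Longrightarrow> V \<gamma> (f i)) \<Longrightarrow> V \<gamma> (sum f A)"
  by (induction A rule: infinite_finite_induct) (auto intro: val_ge_add)

lemma digit_sum: "(\<And>i. i \<in> A \<Longrightarrow> V \<gamma> (f i)) \<Longrightarrow>
    dg \<gamma> (sum f A) = (\<Sum>i\<in>A. dg \<gamma> (f i)) mod int p"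
proof (induction A rule: infinite_finite_induct)
  case (insert x F)
  thus ?case by (simp add: digit_add val_ge_sum mod_simps)
qed auto

lemma rv_add_None: "rv x = None \<Longrightarrow> rv y = None \<Longrightarrow> rv (x + y) = None"
  by (metis rv_eq_None_iff val_ge_add)

lemma rv_diff_None: "rv x = None \<Longrightarrow> rv y = None \<Longrightarrow> rv (x - y) = None"
  by (metis rv_eq_None_iff val_ge_diff)

lemma rv_sum_None: "(\<And>i. i \<in> A \<Longrightarrow> rv (f i) = None) \<Longrightarrow> rv (sum f A) = None"
  by (induction A rule: infinite_finite_induct) (auto intro: rv_add_None)

lemma rv_eqI:
  assumes "V (\<gamma> + 1) (x - y)" "rv x = Some (\<gamma>, a)"
  shows "rv y = Some (\<gamma>, a)"
proof -
  have x: "V \<gamma> x" "dg \<gamma> x = a" "a \<noteq> 0" using assms(2) rv_eq_Some_iff by auto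
  have d: "V \<gamma> (x - y)" using assms(1) by (rule val_ge_mono) simp
  have "dg \<gamma> (x - y) = 0" using assms(1) d digit_eq_0_iff by blast
  moreover have "y = x - (x - y)" by simp
  ultimately have "V \<gamma> y" "dg \<gamma> y = a"
    using val_ge_diff[OF x(1) d] digit_diff[OF x(1) d] x(2) digit_mod[of \<gamma> x] by auto
  thus ?thesis using x rv_eq_Some_iff by blast
qed

text \<open>This makes \<open>rv\<close> a function on the quotient by the elements with leading
  term \<open>None\<close>.\<close>

lemma rv_cong: assumes "rv (x - y) = None" shows "rv x = rv y"
proof (cases "rv x")
  case None
  have "rv (x - (x - y)) = None" using None assms by (rule rv_diff_None)
  thus ?thesis using None by simp
next
  case (Some ga)
  thus ?thesis using rv_eqI[of "fst ga" x y "snd ga"] val_ge_None[OF assms] by (cases ga) auto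
qed

lemma val_ge_power: "V 0 x \<Longrightarrow> V 0 (x ^ n)"
proof (induction n)
  case (Suc n)
  thus ?case using val_ge_mult[of 0 x 0 "x ^ n"] by simp
qed simp

end

section \<open>Hasse derivatives\<close>

text \<open>The derivative \<^const>\<open>pderiv\<close> of the library is restricted to rings without zero divisors.\<close>

definition hasse :: "nat \<Rightarrow> 'a::comm_ring_1 poly \<Rightarrow> 'a poly" where
  "hasse j P = (\<Sum>n\<le>degree P. monom (of_nat ((n + j) choose j) * coeff P (n + j)) n)"

lemma coeff_hasse: "coeff (hasse j P) n = of_nat ((n + j) choose j) * coeff P (n + j)"
  by (cases "n \<le> degree P")
     (auto simp: hasse_def coeff_sum coeff_eq_0 sum.delta if_distrib cong: if_cong)

lemma hasse_0 [simp]: "hasse 0 P = P"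
  by (rule poly_eqI) (simp add: coeff_hasse)

lemma hasse_Suc_pCons: "hasse (Suc j) (pCons a P) = hasse j P + pCons 0 (hasse (Suc j) P)"
proof (rule poly_eqI)
  fix n show "coeff (hasse (Suc j) (pCons a P)) n = coeff (hasse j P + pCons 0 (hasse (Suc j) P)) n"
    by (cases n) (simp_all add: coeff_hasse algebra_simps)
qed

lemma degree_hasse_le: "degree (hasse j P) \<le> degree P - j"
  by (rule degree_le) (auto simp: coeff_hasse coeff_eq_0)

lemma hasse_eq_0: "degree P < j \<Longrightarrow> hasse j P = 0"
  by (rule poly_eqI) (auto simp: coeff_hasse coeff_eq_0)

text \<open>Taylor expansion: \<open>hasse j P\<close> is the j-th derivative divided by j!. The
  factor z moves the point c + z to 1, so that what happens near c + z can be studied near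
  1.\<close>

lemma coeff_pcompose_linear_hasse:
  "coeff (pcompose P [:c, z:]) j = poly (hasse j P) c * z ^ j"
proof (induction P arbitrary: j)
  case 0
  have "hasse j 0 = (0 :: 'a poly)" by (rule poly_eqI) (simp add: coeff_hasse)
  thus ?case by simp
next
  case (pCons a P)
  show ?case
  proof (cases j)
    case 0
    thus ?thesis by (simp add: pcompose_pCons)
  next
    case (Suc i)
    thus ?thesis
      by (simp add: pcompose_pCons pCons.IH hasse_Suc_pCons algebra_simps)
  qed
qed

lemma pcompose_linear_linear:
  "pcompose (pcompose P [:c, z:]) [:u, w:] = pcompose P [:c + z * u, z * w:]"
  by (simp add: pcompose_assoc[symmetric] pcompose_pCons algebra_simps)

lemma hasse_pcompose:
  "poly (hasse j (pcompose P [:c, z:])) u = poly (hasse j P) (c + z * u) * z ^ j"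
proof -
  have "poly (hasse j (pcompose P [:c, z:])) u = coeff (pcompose (pcompose P [:c, z:]) [:u, 1:]) j"
    by (simp add: coeff_pcompose_linear_hasse)
  also have "\<dots> = coeff (pcompose P [:c + z * u, z:]) j" by (simp add: pcompose_linear_linear)
  finally show ?thesis by (simp add: coeff_pcompose_linear_hasse)
qed

lemma poly_sum_upto: "degree (P :: 'a::comm_ring_1 poly) \<le> n \<Longrightarrow> poly P x = (\<Sum>i\<le>n. coeff P i * x ^ i)"
  by (subst poly_altdef, rule sum.mono_neutral_left) (auto simp: coeff_eq_0)

lemma degree_pcompose_linear_le: "degree (pcompose P [:c, z:]) \<le> degree P"
  by (rule order_trans[OF degree_pcompose_le]) (metis mult.right_neutral mult_le_mono2
      degree_pCons_le degree_pCons_0 One_nat_def)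

lemma taylor:
  assumes "degree P \<le> n"
  shows "poly P (c + z) = (\<Sum>i\<le>n. poly (hasse i P) c * z ^ i)"
proof -
  have "poly P (c + z) = poly (pcompose P [:c, z:]) 1" by (simp add: poly_pcompose)
  also have "\<dots> = (\<Sum>i\<le>n. coeff (pcompose P [:c, z:]) i)"
    by (subst poly_sum_upto[of _ n]) (use degree_pcompose_linear_le[of P c z] assms in auto)
  finally show ?thesis by (simp add: coeff_pcompose_linear_hasse)
qed

lemma hasse_hasse: "hasse i (hasse j P) = smult (of_nat ((i + j) choose j)) (hasse (i + j) P)"
proof (rule poly_eqI)
  fix n
  have "((n + i) choose i) * ((n + i + j) choose j) = ((i + j) choose j) * ((n + (i + j)) choose (i + j))"
    using choose_mult[of j "i + j" "n + i + j"] by (simp add: ac_simps)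
  hence "of_nat ((n + i) choose i) * of_nat ((n + i + j) choose j) =
      (of_nat ((i + j) choose j) * of_nat ((n + (i + j)) choose (i + j)) :: 'a)"
    by (metis of_nat_mult)
  thus "coeff (hasse i (hasse j P)) n = coeff (smult (of_nat ((i + j) choose j)) (hasse (i + j) P)) n"
    by (simp add: coeff_hasse mult.assoc[symmetric] add.assoc)
qed

text \<open>The factor \<open>Suc j\<close> is why p has to exceed the degrees: it must be a unit
  for a nonzero derivative of order \<open>Suc j\<close> to make a root of \<open>hasse j P\<close>
  simple.\<close>

lemma hasse_1_hasse: "hasse 1 (hasse j P) = smult (of_nat (Suc j)) (hasse (Suc j) P)"
  by (simp add: hasse_hasse binomial_Suc_n del: of_nat_Suc)

lemma hasse_pcompose_eq:
  "hasse j (pcompose P [:c, z:]) = smult (z ^ j) (pcompose (hasse j P) [:c, z:])"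
  by (rule poly_eqI)
     (simp add: coeff_hasse coeff_pcompose_linear_hasse hasse_hasse power_add algebra_simps)

definition coeffs_ge :: "('k::zero \<Rightarrow> lead) \<Rightarrow> int \<Rightarrow> 'k poly \<Rightarrow> bool" where
  "coeffs_ge rv \<gamma> P \<longleftrightarrow> (\<forall>i. val_ge rv \<gamma> (coeff P i))"

text \<open>Nonzero over the quotient field, where elements with leading term \<open>None\<close>
  count as 0.\<close>

definition nonzero_poly :: "('k::zero \<Rightarrow> lead) \<Rightarrow> 'k poly \<Rightarrow> bool" where
  "nonzero_poly rv P \<longleftrightarrow> (\<exists>i. rv (coeff P i) \<noteq> None)"

section \<open>Hensel's lemma near 1\<close>

context lead_ring
begin

lemma val_ge_of_nat: "V 0 (of_nat n)" and digit_of_nat: "dg 0 (of_nat n) = int n mod int p"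
proof (induction n)
  case (Suc n)
  { case 1 thus ?case using val_ge_add[of 0 1 "of_nat n"] Suc by simp }
  { case 2 thus ?case using digit_add[of 0 1 "of_nat n"] Suc by (simp add: mod_simps) }
qed auto

lemma val_ge_of_nat_mult: "V \<gamma> x \<Longrightarrow> V \<gamma> (of_nat n * x)"
  using val_ge_mult[OF val_ge_of_nat, of \<gamma> x n] by simp

lemma digit_of_nat_mult: "V \<gamma> x \<Longrightarrow> dg \<gamma> (of_nat n * x) = (int n * dg \<gamma> x) mod int p"
  using digit_mult[OF val_ge_of_nat, of \<gamma> x n] by (simp add: digit_of_nat mod_simps)

lemma coeffs_ge_hasse: "coeffs_ge rv \<gamma> P \<Longrightarrow> coeffs_ge rv \<gamma> (hasse j P)"
  by (auto simp: coeffs_ge_def coeff_hasse intro: val_ge_of_nat_mult)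

lemma val_ge_poly: assumes "coeffs_ge rv \<gamma> P" "V 0 u" shows "V \<gamma> (poly P u)"
proof -
  have "V (\<gamma> + 0) (coeff P i * u ^ i)" for i
    using assms by (intro val_ge_mult val_ge_power) (auto simp: coeffs_ge_def)
  thus ?thesis unfolding poly_altdef by (intro val_ge_sum) simp
qed

text \<open>The i-th Taylor term has valuation at least \<gamma> + n * i, so what is left after the
  terms of order 0, or of order 0 and 1, is small.\<close>

lemma taylor_remainder:
  assumes P: "coeffs_ge rv \<gamma> P" and u: "V 0 u" and w: "V (int n) w"
  shows "V (\<gamma> + int n) (poly P (u + w) - poly P u)"
    and "V (\<gamma> + 2 * int n) (poly P (u + w) - poly P u - poly (hasse 1 P) u * w)"
proof -
  define N where "N = degree P"
  have wi: "V (int n * int i) (w ^ i)" for i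
  proof (induction i)
    case (Suc i)
    thus ?case using val_ge_mult[OF w Suc] by (simp add: algebra_simps)
  qed simp
  have t: "V (\<gamma> + int n * int i) (poly (hasse i P) u * w ^ i)" for i
    by (intro val_ge_mult wi val_ge_poly coeffs_ge_hasse P u)
  \<comment> \<open>Two terms more than the degree asks for, so that those of order 0 and 1 can be
    split off even if P is constant.\<close>
  have e: "poly P (u + w) = (\<Sum>i\<le>Suc (Suc N). poly (hasse i P) u * w ^ i)"
    by (rule taylor) (simp add: N_def)
  have e2: "poly P (u + w) - poly P u - poly (hasse 1 P) u * w =
      (\<Sum>i\<le>N. poly (hasse (Suc (Suc i)) P) u * w ^ Suc (Suc i))"
    unfolding e sum.atMost_Suc_shift by simp
  show *: "V (\<gamma> + 2 * int n) (poly P (u + w) - poly P u - poly (hasse 1 P) u * w)"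
    unfolding e2 using t[of "Suc (Suc _)"]
    by (intro val_ge_sum) (rule val_ge_mono[OF t], simp add: algebra_simps)
  have "V (\<gamma> + int n) (poly (hasse 1 P) u * w)" using t[of 1] by simp
  moreover have "V (\<gamma> + int n) (poly P (u + w) - poly P u - poly (hasse 1 P) u * w)"
    using * by (rule val_ge_mono) simp
  ultimately have "V (\<gamma> + int n)
      ((poly P (u + w) - poly P u - poly (hasse 1 P) u * w) + poly (hasse 1 P) u * w)"
    by (intro val_ge_add)
  thus "V (\<gamma> + int n) (poly P (u + w) - poly P u)" by simp
qed

lemma val_ge_near_1: assumes "V 1 (u - 1)" shows "V 0 u"
proof -
  have "V 0 ((u - 1) + 1)" by (intro val_ge_add val_ge_mono[OF assms]) auto
  thus ?thesis by simp
qed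

lemma digit_poly_near_1:
  assumes P: "coeffs_ge rv \<gamma> P" and u: "V 1 (u - 1)"
  shows "dg \<gamma> (poly P u) = dg \<gamma> (poly P 1)"
proof -
  have d: "V (\<gamma> + 1) (poly P u - poly P 1)"
    using taylor_remainder(1)[OF P, of 1 1 "u - 1"] u by simp
  have d': "V \<gamma> (poly P u - poly P 1)" using d by (rule val_ge_mono) simp
  have "dg \<gamma> (poly P 1 + (poly P u - poly P 1)) =
      (dg \<gamma> (poly P 1) + dg \<gamma> (poly P u - poly P 1)) mod int p"
    by (intro digit_add d' val_ge_poly P) auto
  moreover have "dg \<gamma> (poly P u - poly P 1) = 0" using d d' digit_eq_0_iff by blast
  ultimately show ?thesis by simp
qed

lemma hensel_step:
  assumes P: "coeffs_ge rv \<gamma> P" and b: "dg \<gamma> (poly (hasse 1 P) 1) \<noteq> 0"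
    and n: "n \<ge> 1" and u: "V 1 (u - 1)" and Pu: "V (\<gamma> + int n) (poly P u)"
  shows "\<exists>u'. V (int n) (u' - u) \<and> V 1 (u' - 1) \<and> V (\<gamma> + int (Suc n)) (poly P u')"
proof -
  define \<alpha> where "\<alpha> = dg (\<gamma> + int n) (poly P u)"
  define \<beta> where "\<beta> = dg \<gamma> (poly (hasse 1 P) u)"
  have \<beta>: "0 < \<beta>" "\<beta> < int p"
    using b digit_poly_near_1[OF coeffs_ge_hasse[OF P] u, of 1] digit_ge_0 digit_less \<beta>_def
    by (metis order_le_less, metis)
  have "coprime \<beta> (int p)"
    using \<beta> prime_p by (metis coprime_commute prime_imp_coprime_int prime_int_nat_transfer
        prime_nat_int_transfer zdvd_not_zless)
  then obtain b' where b': "[\<beta> * b' = 1] (mod int p)" using cong_solve_coprime_int by blast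
  \<comment> \<open>The digit of the correction w. The digit of P(u + w) at level \<gamma> + n will
    be \<alpha> + \<beta> * a, because the Taylor remainder has valuation at least \<gamma> + 2 * n,
    and n is at least 1.\<close>
  define a where "a = (- \<alpha> * b') mod int p"
  have "(\<alpha> + \<beta> * a) mod int p = (\<alpha> + \<beta> * (- \<alpha> * b')) mod int p"
    unfolding a_def by (metis mod_add_right_eq mod_mult_right_eq)
  also have "\<alpha> + \<beta> * (- \<alpha> * b') = \<alpha> - \<alpha> * (\<beta> * b')"
    by (simp add: algebra_simps)
  also have "(\<alpha> - \<alpha> * (\<beta> * b')) mod int p = (\<alpha> - \<alpha> * 1) mod int p"
    using b' by (metis cong_def mod_diff_right_eq mod_mult_right_eq)
  finally have a: "(\<alpha> + \<beta> * a) mod int p = 0" by simp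
  have a_range: "0 \<le> a" "a < int p" using p_gt_1 by (auto simp: a_def)
  have "\<exists>w. V (int n) w \<and> dg (int n) w = a"
  proof (cases "a = 0")
    case True
    thus ?thesis by (intro exI[of _ 0]) simp
  next
    case False
    thus ?thesis using rv_surj[of a "int n"] a_range by (auto simp: rv_eq_Some_iff)
  qed
  then obtain w where w: "V (int n) w" "dg (int n) w = a" by blast
  have u0: "V 0 u" using u by (rule val_ge_near_1)
  let ?R = "poly P (u + w) - poly P u - poly (hasse 1 P) u * w"
  have "V (\<gamma> + int n + 1) ?R"
    using taylor_remainder(2)[OF P u0 w(1)] by (rule val_ge_mono) (use n in simp)
  moreover have R: "V (\<gamma> + int n) ?R" using calculation by (rule val_ge_mono) simp
  ultimately have R0: "dg (\<gamma> + int n) ?R = 0" using digit_eq_0_iff by blast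
  have h: "V \<gamma> (poly (hasse 1 P) u)" by (intro val_ge_poly coeffs_ge_hasse P u0)
  have hw: "V (\<gamma> + int n) (poly (hasse 1 P) u * w)" using h w(1) by (rule val_ge_mult)
  have eq: "poly P (u + w) = (poly P u + poly (hasse 1 P) u * w) + ?R" by simp
  have V: "V (\<gamma> + int n) (poly P (u + w))"
    by (subst eq) (intro val_ge_add Pu hw R)
  have "dg (\<gamma> + int n) (poly P (u + w)) = (\<alpha> + \<beta> * a) mod int p"
    by (subst eq, subst digit_add[OF val_ge_add[OF Pu hw] R], subst digit_add[OF Pu hw],
        subst digit_mult[OF h w(1)])
       (simp only: R0 w(2) \<alpha>_def \<beta>_def mod_simps add_0_right mod_mod_trivial)
  hence "V (\<gamma> + int n + 1) (poly P (u + w))" using V a digit_eq_0_iff by simp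
  moreover have "V 1 ((u - 1) + w)"
    using u w(1) n by (intro val_ge_add) (auto elim: val_ge_mono)
  ultimately show ?thesis using w(1)
    by (intro exI[of _ "u + w"]) (simp add: algebra_simps)
qed

text \<open>Digit by digit lifting of a simple root of the reduction of P at level \<gamma>. The
  point 1 is enough, since a substitution moves the point under study there; \<gamma> allows for
  coefficients of any valuation.\<close>

lemma hensel:
  assumes P: "coeffs_ge rv \<gamma> P" and a: "dg \<gamma> (poly P 1) = 0"
    and b: "dg \<gamma> (poly (hasse 1 P) 1) \<noteq> 0"
  shows "\<exists>u. V 1 (u - 1) \<and> rv (poly P u) = None"
proof -
  \<comment> \<open>The index is shifted because 1 already is a root up to valuation \<gamma> + 1,
    and \<open>hensel_step\<close> starts at n = 1.\<close>
  define Q where "Q = (\<lambda>n u. V 1 (u - 1) \<and> V (\<gamma> + int (Suc n)) (poly P u))"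
  have "V \<gamma> (poly P 1)" by (intro val_ge_poly P) simp
  hence "Q 0 1" using a digit_eq_0_iff by (simp add: Q_def)
  moreover have "\<exists>u'. Q (Suc n) u' \<and> V (int (Suc n)) (u' - u)" if "Q n u" for n u
    using hensel_step[OF P b, of "Suc n" u] that by (auto simp: Q_def)
  ultimately obtain X where X: "\<And>n. Q n (X n)" "\<And>n. V (int (Suc n)) (X (Suc n) - X n)"
    using dependent_nat_choice[of Q "\<lambda>n u u'. V (int (Suc n)) (u' - u)"] by blast
  have "V (int n) (X (Suc n) - X n)" for n using X(2) by (rule val_ge_mono) simp
  moreover have "V 0 (X 0)" using X(1) val_ge_near_1 unfolding Q_def by blast
  ultimately obtain s where s: "\<And>n. V (int n) (s - X n)" using complete by blast
  have "V 1 ((s - X 1) + (X 1 - 1))"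
    using s[of 1] X(1)[of 1] by (intro val_ge_add) (auto simp: Q_def)
  hence s1: "V 1 (s - 1)" by simp
  have "V (\<gamma> + int n) (poly P s)" for n
  proof -
    have Xn: "V 1 (X n - 1)" "V (\<gamma> + int (Suc n)) (poly P (X n))" using X(1) unfolding Q_def by auto
    have "V (\<gamma> + int n) (poly P (X n + (s - X n)) - poly P (X n))"
      by (intro taylor_remainder P val_ge_near_1 Xn s)
    moreover have "V (\<gamma> + int n) (poly P (X n))" using Xn(2) by (rule val_ge_mono) simp
    ultimately have "V (\<gamma> + int n) ((poly P s - poly P (X n)) + poly P (X n))"
      by (intro val_ge_add) auto
    thus ?thesis by simp
  qed
  \<comment> \<open>\<gamma> may have either sign; this index is large enough for its sum with
    \<gamma> to reach n.\<close>
  hence "V (\<gamma> + int (nat \<bar>int n - \<gamma>\<bar>)) (poly P s)" for n .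
  hence "V (int n) (poly P s)" for n
    by (rule val_ge_mono[of "\<gamma> + int (nat \<bar>int n - \<gamma>\<bar>)"]) simp
  thus ?thesis using s1 rv_eq_None_iff by blast
qed

section \<open>Cancellation of leading digits and nearby roots of derivatives\<close>

section \<open>Collisions\<close>

lemma gauss_valuation:
  assumes "nonzero_poly rv P"
  obtains \<gamma> i where "coeffs_ge rv \<gamma> P" "dg \<gamma> (coeff P i) \<noteq> 0"
proof -
  define S where "S = {i. i \<le> degree P \<and> rv (coeff P i) \<noteq> None}"
  have fin: "finite S" unfolding S_def by auto
  have mem: "i \<in> S" if "rv (coeff P i) \<noteq> None" for i
    using that by (auto simp: S_def intro!: le_degree)
  hence ne: "S \<noteq> {}" using assms by (auto simp: nonzero_poly_def)
  define \<gamma> where "\<gamma> = Min ((\<lambda>i. fst (the (rv (coeff P i)))) ` S)"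
  have "\<gamma> \<in> (\<lambda>i. fst (the (rv (coeff P i)))) ` S" unfolding \<gamma>_def using fin ne by (intro Min_in) auto
  then obtain i where i: "i \<in> S" "\<gamma> = fst (the (rv (coeff P i)))" by auto
  obtain a where ia: "rv (coeff P i) = Some (\<gamma>, a)" using i S_def by auto
  have "V \<gamma> (coeff P j)" for j
  proof (cases "rv (coeff P j)")
    case (Some ga)
    hence "\<gamma> \<le> fst ga" unfolding \<gamma>_def using fin mem[of j] by (intro Min_le) force+
    thus ?thesis using Some by (auto simp: val_ge_def split: prod.splits)
  qed (rule val_ge_None)
  thus ?thesis using that[of \<gamma> i] ia by (auto simp: coeffs_ge_def rv_eq_Some_iff)
qed

lemma digit_of_nat_mult_eq_0:
  assumes "V \<gamma> x" "0 < n" "n < p" "dg \<gamma> x \<noteq> 0" shows "dg \<gamma> (of_nat n * x) \<noteq> 0"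
proof
  assume "dg \<gamma> (of_nat n * x) = 0"
  hence "int p dvd int n * dg \<gamma> x" using assms(1) by (simp add: digit_of_nat_mult mod_eq_0_iff_dvd)
  hence "int p dvd int n \<or> int p dvd dg \<gamma> x"
    using prime_p by (simp add: prime_dvd_mult_eq_int)
  thus False using assms digit_ge_0[of \<gamma> x] digit_less[of \<gamma> x]
    by (metis nat_dvd_not_less int_dvd_int_iff zdvd_not_zless order_le_less)
qed

lemma collision:
  assumes G: "coeffs_ge rv \<gamma> G" and nz: "dg \<gamma> (coeff G k) \<noteq> 0" and deg: "degree G < p"
    and coll: "dg \<gamma> (poly G 1) = 0"
  shows "\<exists>j u. j < degree G \<and> V 1 (u - 1) \<and> rv (poly (hasse j G) u) = None \<and>
    nonzero_poly rv (hasse j G) \<and> (dg \<gamma> (poly (hasse 1 G) 1) = 0 \<longrightarrow> j \<ge> 1)"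
proof -
  let ?D = "\<lambda>m. dg \<gamma> (poly (hasse m G) 1)"
  \<comment> \<open>The degree of the reduction. Its divided derivative of this order is the leading
    coefficient, hence nonzero at 1, which bounds m by k0.\<close>
  define k0 where "k0 = Max {i. i \<le> degree G \<and> dg \<gamma> (coeff G i) \<noteq> 0}"
  have kd: "k \<le> degree G" using nz by (metis digit_0 coeff_eq_0 not_le)
  have "k0 \<in> {i. i \<le> degree G \<and> dg \<gamma> (coeff G i) \<noteq> 0}"
    unfolding k0_def by (rule Max_in) (use nz kd in auto)
  hence k0: "k0 \<le> degree G" "dg \<gamma> (coeff G k0) \<noteq> 0" by auto
  have above: "dg \<gamma> (coeff G i) = 0" if "i > k0" for i
  proof (rule ccontr)
    assume "dg \<gamma> (coeff G i) \<noteq> 0"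
    moreover have "i \<le> degree G" using calculation by (metis digit_0 coeff_eq_0 not_le)
    ultimately have "i \<le> k0" unfolding k0_def by (intro Max_ge) auto
    thus False using that by simp
  qed
  have VG: "V \<gamma> (coeff G i)" for i using G by (simp add: coeffs_ge_def)
  have "?D k0 = (\<Sum>n\<le>degree G. dg \<gamma> (coeff (hasse k0 G) n)) mod int p"
    using coeffs_ge_hasse[OF G, of k0] degree_hasse_le[of k0 G]
    by (subst poly_sum_upto[of _ "degree G"]) (auto intro!: digit_sum simp: coeffs_ge_def)
  also have "(\<Sum>n\<le>degree G. dg \<gamma> (coeff (hasse k0 G) n)) =
      (\<Sum>n\<in>{0}. dg \<gamma> (coeff (hasse k0 G) n))"
    by (rule sum.mono_neutral_right) (auto simp: coeff_hasse digit_of_nat_mult VG above)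
  also have "\<dots> mod int p = dg \<gamma> (coeff G k0)" by (simp add: coeff_hasse)
  finally have Dk0: "?D k0 \<noteq> 0" using k0 by simp
  define m where "m = (LEAST m. ?D m \<noteq> 0)"
  have m: "?D m \<noteq> 0" "m \<le> k0" unfolding m_def using Dk0 by (rule LeastI, intro Least_le)
  have "m \<noteq> 0" using m(1) coll by (cases m) auto
  then obtain j where j: "m = Suc j" by (cases m) auto
  have Dj: "?D j = 0" using not_less_Least[of j "\<lambda>m. ?D m \<noteq> 0"] j unfolding m_def by auto
  have "V \<gamma> (poly (hasse m G) 1)" by (intro val_ge_poly coeffs_ge_hasse G) simp
  hence "dg \<gamma> (poly (hasse 1 (hasse j G)) 1) \<noteq> 0"
    unfolding hasse_1_hasse poly_smult j[symmetric]
    using m k0 deg j by (intro digit_of_nat_mult_eq_0) auto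
  note nd = this
  obtain u where u: "V 1 (u - 1)" "rv (poly (hasse j G) u) = None"
    using hensel[OF coeffs_ge_hasse[OF G, of j] Dj nd] by blast
  have "nonzero_poly rv (hasse j G)"
  proof (rule ccontr)
    assume "\<not> nonzero_poly rv (hasse j G)"
    hence "rv (coeff (hasse j G) i) = None" for i
      unfolding nonzero_poly_def by blast
    hence "rv (coeff (hasse 1 (hasse j G)) i) = None" for i
      by (subst coeff_hasse) (intro rv_mult_None disjI2)
    hence "rv (poly (hasse 1 (hasse j G)) 1) = None"
      unfolding poly_altdef by (intro rv_sum_None rv_mult_None) auto
    thus False using nd by (simp add: digit_None)
  qed
  moreover have "j \<ge> 1" if "?D 1 = 0" using that m(1) j by (cases j) auto
  ultimately show ?thesis using u j m k0 by (intro exI[of _ j] exI[of _ u]) auto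
qed

end

section \<open>Matching roots and points\<close>

definition homo :: "('a::comm_ring_1 \<Rightarrow> 'k::comm_ring_1) \<Rightarrow> bool" where
  "homo f \<longleftrightarrow> f 0 = 0 \<and> f 1 = 1 \<and> (\<forall>x y. f (x + y) = f x + f y) \<and> (\<forall>x y. f (x * y) = f x * f y)"

context
  fixes f :: "'a::comm_ring_1 \<Rightarrow> 'k::comm_ring_1"
  assumes f: "homo f"
begin

lemma homo_simps: "f 0 = 0" "f 1 = 1" "f (x + y) = f x + f y" "f (x * y) = f x * f y"
  using f by (auto simp: homo_def)

lemma homo_power: "f (x ^ n) = f x ^ n"
  by (induction n) (simp_all add: homo_simps)

lemma homo_of_nat: "f (of_nat n) = of_nat n"
  by (induction n) (simp_all add: homo_simps)

lemma homo_sum: "f (sum g A) = (\<Sum>i\<in>A. f (g i))"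
  by (induction A rule: infinite_finite_induct) (simp_all add: homo_simps)

lemma coeff_map: "coeff (map_poly f P) i = f (coeff P i)"
  by (simp add: coeff_map_poly homo_simps)

lemma map_poly_plus: "map_poly f (P + Q) = map_poly f P + map_poly f Q"
  by (rule poly_eqI) (simp add: coeff_map homo_simps)

lemma map_poly_times: "map_poly f (P * Q) = map_poly f P * map_poly f Q"
  by (rule poly_eqI) (simp add: coeff_map homo_simps coeff_mult homo_sum)

lemma map_poly_scale: "map_poly f (smult a P) = smult (f a) (map_poly f P)"
  by (rule poly_eqI) (simp add: coeff_map homo_simps)

lemma map_poly_hasse: "map_poly f (hasse j P) = hasse j (map_poly f P)"
  by (rule poly_eqI) (simp add: coeff_map coeff_hasse homo_simps homo_of_nat)

lemma degree_map_le: "degree (map_poly f P) \<le> degree P"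
  by (rule degree_le) (simp add: coeff_map coeff_eq_0 homo_simps)

end

text \<open>The leading coefficient is not inverted, so one division serves all specialisations of
  the coefficients.\<close>

lemma pseudo_remainder:
  fixes F P :: "'a::comm_ring_1 poly"
  assumes F: "degree F \<le> d" "0 < d"
  shows "\<exists>k Q R. smult (coeff F d ^ k) P = Q * F + R \<and> degree R < d"
proof (induction "degree P" arbitrary: P rule: less_induct)
  case less
  let ?a = "coeff F d"
  show ?case
  proof (cases "degree P < d")
    case True
    thus ?thesis by (intro exI[of _ 0] exI[of _ P]) simp
  next
    case False
    define n where "n = degree P"
    define M where "M = monom (coeff P n) (n - d)"
    define P' where "P' = smult ?a P - M * F"
    have "degree P' \<le> n - 1"
    proof (rule degree_le, intro allI impI)
      fix i assume "n - 1 < i"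
      hence i: "n \<le> i" using False F by (auto simp: n_def)
      have "coeff (M * F) i = coeff P n * coeff F (i - (n - d))"
        using i by (simp add: M_def coeff_monom_mult)
      moreover have "coeff F (i - (n - d)) = (if i = n then ?a else 0)"
        using i F False by (auto simp: n_def intro!: coeff_eq_0)
      moreover have "coeff P i = 0" if "i \<noteq> n" using i that by (intro coeff_eq_0) (simp add: n_def)
      ultimately show "coeff P' i = 0" by (auto simp: P'_def mult.commute)
    qed
    hence "degree P' < degree P" using False F by (simp add: n_def)
    from less[OF this] obtain k Q R where *: "smult (?a ^ k) P' = Q * F + R" "degree R < d" by blast
    have "smult (?a ^ Suc k) P = smult (?a ^ k) P' + smult (?a ^ k) (M * F)"
      by (simp add: P'_def smult_diff_right algebra_simps)
    also have "\<dots> = (Q + smult (?a ^ k) M) * F + R"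
      using *(1) by (simp add: algebra_simps)
    finally show ?thesis using *(2) by blast
  qed
qed

section \<open>Closest centers and isolated points\<close>

context lead_ring
begin

lemma rv_poly_cong: assumes "rv (x - y) = None" shows "rv (poly Q x) = rv (poly Q y)"
proof -
  have "rv (poly Q x - poly Q y) = None"
  proof (induction Q)
    case (pCons a Q)
    have "poly (pCons a Q) x - poly (pCons a Q) y =
        (x - y) * poly Q x + y * (poly Q x - poly Q y)" by (simp add: algebra_simps)
    also have "rv \<dots> = None" using pCons.IH assms by (intro rv_add_None rv_mult_None) auto
    finally show ?case .
  qed simp
  thus ?thesis by (rule rv_cong)
qed

lemma rv_poly_locally_constant:
  assumes "rv (poly Q c) \<noteq> None"
  shows "\<exists>n. \<forall>w. V (int n) w \<longrightarrow> rv (poly Q (c + w)) \<noteq> None"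
proof -
  obtain g a where ga: "rv (poly Q c) = Some (g, a)" using assms by auto
  define H where "H = pcompose Q [:c, 1:]"
  have H: "poly H w = poly Q (c + w)" for w by (simp add: H_def poly_pcompose)
  have "nonzero_poly rv H" unfolding nonzero_poly_def
    by (rule exI[of _ 0]) (use assms H[of 0] in \<open>simp add: poly_0_coeff_0\<close>)
  then obtain \<gamma> where \<gamma>: "coeffs_ge rv \<gamma> H" using gauss_valuation by blast
  \<comment> \<open>\<gamma> bounds the Taylor coefficients at c from below, so changing c by
    valuation n changes the value by valuation above g, too little to alter its leading
    term.\<close>
  define n where "n = nat (g + 1 - \<gamma>)"
  have "rv (poly Q (c + w)) \<noteq> None" if w: "V (int n) w" for w
  proof -
    have "V (\<gamma> + int n) (poly H (0 + w) - poly H 0)"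
      by (intro taylor_remainder \<gamma> w) simp
    hence "V (g + 1) (poly H (0 + w) - poly H 0)" by (rule val_ge_mono) (simp add: n_def)
    hence "V (g + 1) (poly Q c - poly Q (c + w))"
      using val_ge_minus[of "g + 1" "poly H (0 + w) - poly H 0"] by (simp add: H)
    thus ?thesis using rv_eqI ga by (metis option.distinct(1))
  qed
  thus ?thesis by blast
qed

text \<open>A closest root exists because \<open>v (c - c0)\<close> is bounded above when \<open>c0\<close> runs over the roots of a
  polynomial that does not vanish at \<open>c\<close>.\<close>

lemma closest_center:
  assumes fin: "finite W" and c: "rv c \<noteq> None"
    and nr: "\<And>Q. Q \<in> W \<Longrightarrow> nonzero_poly rv Q \<Longrightarrow> rv (poly Q c) \<noteq> None"
  obtains c0 \<gamma> a where "c0 = 0 \<or> (\<exists>Q\<in>W. nonzero_poly rv Q \<and> rv (poly Q c0) = None)"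
    "rv (c - c0) = Some (\<gamma>, a)"
    "\<And>Q c1. Q \<in> W \<Longrightarrow> nonzero_poly rv Q \<Longrightarrow> rv (poly Q c1) = None \<Longrightarrow> \<not> V (\<gamma> + 1) (c - c1)"
proof -
  define C where "C = {c0. c0 = 0 \<or> (\<exists>Q\<in>W. nonzero_poly rv Q \<and> rv (poly Q c0) = None)}"
  define v where "v x = fst (the (rv (c - x)))" for x
  have v: "\<exists>a. rv (c - x) = Some (v x, a)" if xC: "x \<in> C" for x
  proof -
    have "rv (c - x) \<noteq> None"
    proof
      assume *: "rv (c - x) = None"
      show False
      proof (cases "x = 0")
        case False
        then obtain Q where Q: "Q \<in> W" "nonzero_poly rv Q" "rv (poly Q x) = None"
          using xC by (auto simp: C_def)
        thus False using nr[OF Q(1,2)] rv_poly_cong[OF *, of Q] by simp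
      qed (use * c in simp)
    qed
    thus ?thesis by (auto simp: v_def)
  qed
  have "\<forall>Q\<in>{Q\<in>W. nonzero_poly rv Q}. \<exists>n. \<forall>w. V (int n) w \<longrightarrow> rv (poly Q (c + w)) \<noteq> None"
    using rv_poly_locally_constant nr by auto
  then obtain n where n: "\<And>Q w. Q \<in> W \<Longrightarrow> nonzero_poly rv Q \<Longrightarrow> V (int (n Q)) w \<Longrightarrow>
      rv (poly Q (c + w)) \<noteq> None"
    unfolding bchoice_iff by blast
  define B where "B = Max (insert (nat (v 0 + 1)) (n ` W))"
  have bound: "\<not> V (int B) (c - x)" if x: "x \<in> C" for x
  proof
    assume V: "V (int B) (c - x)"
    show False
    proof (cases "x = 0")
      case True
      have "nat (v 0 + 1) \<le> B" unfolding B_def using fin by (intro Max_ge) auto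
      moreover have "int B \<le> v 0"
        using v[OF x] V True by (auto simp: val_ge_def)
      ultimately show False by linarith
    next
      case False
      then obtain Q where Q: "Q \<in> W" "nonzero_poly rv Q" "rv (poly Q x) = None"
        using x by (auto simp: C_def)
      have "n Q \<le> B" unfolding B_def using fin Q by (intro Max_ge) auto
      hence "V (int (n Q)) (- (c - x))" using V by (intro val_ge_minus) (auto elim: val_ge_mono)
      thus False using n[OF Q(1,2), of "- (c - x)"] Q(3) by simp
    qed
  qed
  \<comment> \<open>Shifted to natural numbers for the search of a maximum; candidates farther from
    c than the center 0 are discarded.\<close>
  define f where "f x = nat (v x - v 0)" for x
  have "v x < int B" if "x \<in> C" for x using bound[OF that] v[OF that] by (auto simp: val_ge_def)
  hence "f x < nat (int B - v 0) + 1" if "x \<in> C \<and> v 0 \<le> v x" for x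
    using that unfolding f_def by fastforce
  moreover have "0 \<in> C \<and> v 0 \<le> v 0" by (simp add: C_def)
  ultimately obtain c0 where c0: "c0 \<in> C" "v 0 \<le> v c0"
      "\<And>x. x \<in> C \<Longrightarrow> v 0 \<le> v x \<Longrightarrow> f x \<le> f c0"
    using ex_has_greatest_nat[of "\<lambda>x. x \<in> C \<and> v 0 \<le> v x" 0 f "nat (int B - v 0) + 1"] by blast
  have max: "v x \<le> v c0" if "x \<in> C" for x
    using c0(2) c0(3)[OF that] by (cases "v 0 \<le> v x") (auto simp: f_def)
  obtain a where a: "rv (c - c0) = Some (v c0, a)" using v c0(1) by blast
  show ?thesis
  proof (rule that[OF _ a])
    fix Q c1 assume Q: "Q \<in> W" "nonzero_poly rv Q" "rv (poly Q c1) = None"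
    hence "c1 \<in> C" by (auto simp: C_def)
    thus "\<not> V (v c0 + 1) (c - c1)" using max v by (fastforce simp: val_ge_def)
  qed (use c0(1) in \<open>auto simp: C_def\<close>)
qed

text \<open>If the leading digits cancelled at 1 after rescaling, \<open>collision\<close> would
  give a root u of a derivative with u - 1 of positive valuation, and c0 + z * u would be a root too
  close to c0 + z. For k = 1 isolation is only assumed from roots of proper derivatives, and the
  digits of the first derivative must cancel as well.\<close>

lemma isolated_no_collision:
  assumes z: "rv z = Some (\<gamma>, a)" and deg: "degree P < p"
    and iso: "\<And>j c1. j < degree P \<Longrightarrow> nonzero_poly rv (hasse j P) \<Longrightarrow>
      rv (poly (hasse j P) c1) = None \<Longrightarrow> k \<le> j \<Longrightarrow> \<not> V (\<gamma> + 1) (c0 + z - c1)"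
    and G: "coeffs_ge rv \<delta> (pcompose P [:c0, z:])" "dg \<delta> (coeff (pcompose P [:c0, z:]) i) \<noteq> 0"
    and coll: "dg \<delta> (poly (pcompose P [:c0, z:]) 1) = 0"
    and k: "k = 0 \<or> k = 1 \<and> dg \<delta> (poly (hasse 1 (pcompose P [:c0, z:])) 1) = 0"
  shows False
proof -
  let ?G = "pcompose P [:c0, z:]"
  have dG: "degree ?G \<le> degree P" by (rule degree_pcompose_linear_le)
  obtain j u where ju: "j < degree ?G" "V 1 (u - 1)" "rv (poly (hasse j ?G) u) = None"
      "nonzero_poly rv (hasse j ?G)" "dg \<delta> (poly (hasse 1 ?G) 1) = 0 \<Longrightarrow> j \<ge> 1"
    using collision[OF G le_less_trans[OF dG deg] coll] by blast
  define c1 where "c1 = c0 + z * u"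
  have zj: "rv (z ^ j) \<noteq> None" for j
    by (induction j) (use z in \<open>auto simp: rv_1 rv_mult\<close>)
  have "rv (poly (hasse j P) c1 * z ^ j) = None" using ju(3) by (simp add: hasse_pcompose c1_def)
  hence root: "rv (poly (hasse j P) c1) = None" using zj lead_mult_eq_None by blast
  have "nonzero_poly rv (hasse j P)"
  proof (rule ccontr)
    assume "\<not> nonzero_poly rv (hasse j P)"
    hence c: "rv (coeff (hasse j P) i) = None" for i by (metis nonzero_poly_def)
    have "rv (coeff (hasse i (hasse j P)) l) = None" for i l
      by (subst coeff_hasse) (intro rv_mult_None disjI2 c)
    hence "rv (poly (hasse i (hasse j P)) c0) = None" for i
      unfolding poly_altdef by (intro rv_sum_None rv_mult_None disjI1)
    hence "rv (coeff (hasse j ?G) i) = None" for i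
      by (simp add: hasse_pcompose_eq coeff_pcompose_linear_hasse rv_mult_None)
    thus False using ju(4) by (simp add: nonzero_poly_def)
  qed
  moreover have "k \<le> j" using k ju(5) by auto
  ultimately have "\<not> V (\<gamma> + 1) (c0 + z - c1)"
    using iso[OF less_le_trans[OF ju(1) dG] _ root] by blast
  moreover have "V (\<gamma> + 1) (z * (1 - u))"
  proof (intro val_ge_mult)
    show "V \<gamma> z" using z by (simp add: val_ge_def)
    show "V 1 (1 - u)" using val_ge_minus[OF ju(2)] by simp
  qed
  ultimately show False by (simp add: c1_def right_diff_distrib)
qed

end

section \<open>Comparison of two valued fields with equal value groups and residue fields\<close>

locale lead_ring_pair = A: lead_ring p r1 + B: lead_ring p r2
  for p and r1 r2 :: "'k::comm_ring_1 \<Rightarrow> lead"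
begin

lemma rv_mult_eq: "r1 x = r2 x' \<Longrightarrow> r1 y = r2 y' \<Longrightarrow> r1 (x * y) = r2 (x' * y')"
  by (simp add: A.rv_mult B.rv_mult)

lemma rv_power_eq: "r1 x = r2 x' \<Longrightarrow> r1 (x ^ n) = r2 (x' ^ n)"
  by (induction n) (simp_all add: A.rv_1 B.rv_1 rv_mult_eq)

text \<open>Nonzero digits are units modulo p. This undoes the multiplication by a power of the
  leading coefficient in a pseudo-division.\<close>

lemma rv_cancel:
  assumes x: "r1 x = r2 x'" "r1 x \<noteq> None" and xy: "r1 (x * y) = r2 (x' * y')"
  shows "r1 y = r2 y'"
proof -
  obtain g a where ga: "r1 x = Some (g, a)" using x by auto
  have a: "coprime a (int p)" using A.rv_range[OF ga] A.prime_p
    by (metis coprime_commute prime_imp_coprime_int prime_int_nat_transfer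
        prime_nat_int_transfer zdvd_not_zless)
  show ?thesis
  proof (cases "r1 y"; cases "r2 y'")
    fix hb hb' assume *: "r1 y = Some hb" "r2 y' = Some hb'"
    obtain h b h' b' where hb: "hb = (h, b)" "hb' = (h', b')" by fastforce
    have "[a * b = a * b'] (mod int p)" "h = h'"
      using xy * ga x hb by (auto simp: A.rv_mult B.rv_mult cong_def)
    moreover from this have "b mod int p = b' mod int p"
      using a by (simp add: cong_def[symmetric] cong_mult_lcancel)
    moreover have "0 < b" "b < int p" "0 < b'" "b' < int p"
      using A.rv_range[of y h b] B.rv_range[of y' h' b'] * hb by auto
    ultimately show ?thesis using * hb by simp
  qed (use xy ga x in \<open>auto simp: A.rv_mult B.rv_mult\<close>)
qed

text \<open>Leading terms of sums are not determined by those of the summands, but at a level below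
  which no summand has its valuation, the digit of the sum is the sum of the digits modulo
  p.\<close>

lemma digits_transfer:
  assumes eq: "\<And>i. r1 (coeff G1 i) = r2 (coeff G2 i)" and G: "coeffs_ge r1 \<gamma> G1"
  shows "coeffs_ge r2 \<gamma> G2"
    and "digit r1 \<gamma> (poly (hasse j G1) 1) = digit r2 \<gamma> (poly (hasse j G2) 1)"
proof -
  have V1: "val_ge r1 \<gamma> (coeff G1 i)" for i using G by (simp add: coeffs_ge_def)
  hence V2: "val_ge r2 \<gamma> (coeff G2 i)" for i using eq by (simp add: val_ge_def)
  thus G2: "coeffs_ge r2 \<gamma> G2" by (simp add: coeffs_ge_def)
  have D: "digit r1 \<gamma> (coeff G1 i) = digit r2 \<gamma> (coeff G2 i)" for i
    using eq by (simp add: digit_def)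
  define n where "n = max (degree G1) (degree G2)"
  have d: "degree (hasse j G1) \<le> n" "degree (hasse j G2) \<le> n"
    using degree_hasse_le[of j G1] degree_hasse_le[of j G2] by (auto simp: n_def)
  have "digit r1 \<gamma> (poly (hasse j G1) 1) = (\<Sum>i\<le>n. digit r1 \<gamma> (coeff (hasse j G1) i)) mod int p"
    using A.coeffs_ge_hasse[OF G, of j]
    by (subst poly_sum_upto[OF d(1)]) (auto intro!: A.digit_sum simp: coeffs_ge_def)
  also have "(\<Sum>i\<le>n. digit r1 \<gamma> (coeff (hasse j G1) i)) = (\<Sum>i\<le>n. digit r2 \<gamma> (coeff (hasse j G2) i))"
    by (intro sum.cong refl)
       (simp only: coeff_hasse A.digit_of_nat_mult[OF V1] B.digit_of_nat_mult[OF V2] D)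
  also have "\<dots> mod int p = digit r2 \<gamma> (poly (hasse j G2) 1)"
    using B.coeffs_ge_hasse[OF G2, of j]
    by (subst poly_sum_upto[OF d(2)]) (auto intro!: B.digit_sum[symmetric] simp: coeffs_ge_def)
  finally show "digit r1 \<gamma> (poly (hasse j G1) 1) = digit r2 \<gamma> (poly (hasse j G2) 1)" .
qed

lemma rv_coeff_pcompose_eq:
  assumes "\<And>j. j \<le> d \<Longrightarrow> r1 (poly (hasse j P1) c0) = r2 (poly (hasse j P2) c0')"
    and "r1 z = r2 z'" "degree P1 \<le> d" "degree P2 \<le> d"
  shows "r1 (coeff (pcompose P1 [:c0, z:]) i) = r2 (coeff (pcompose P2 [:c0', z':]) i)"
proof (cases "i \<le> d")
  case True
  thus ?thesis using assms by (simp add: coeff_pcompose_linear_hasse rv_mult_eq rv_power_eq)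
next
  case False
  thus ?thesis using assms by (simp add: coeff_pcompose_linear_hasse hasse_eq_0)
qed

text \<open>At the minimal valuation \<delta> of the rescaled coefficients, the digit of the value
  is the same in both fields. Isolation makes it nonzero, so it is the leading digit. It does not
  change when 1 is replaced by u, which admits the u found by
  \<open>isolated_root_match\<close>.\<close>

lemma isolated_match:
  assumes m: "\<And>j. j \<le> d \<Longrightarrow> r1 (poly (hasse j P1) c0) = r2 (poly (hasse j P2) c0')"
    and z: "r1 z = Some (\<gamma>, a)" "r1 z = r2 z'" and deg: "degree P1 \<le> d" "degree P2 \<le> d" "d < p"
    and iso: "\<And>j c1. j \<le> d \<Longrightarrow> nonzero_poly r1 (hasse j P1) \<Longrightarrow>
      r1 (poly (hasse j P1) c1) = None \<Longrightarrow> \<not> val_ge r1 (\<gamma> + 1) (c0 + z - c1)"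
    and u: "val_ge r2 1 (u - 1)"
  shows "r1 (poly P1 (c0 + z)) = r2 (poly P2 (c0' + z' * u))"
proof -
  let ?G1 = "pcompose P1 [:c0, z:]" and ?G2 = "pcompose P2 [:c0', z':]"
  have eq: "r1 (coeff ?G1 i) = r2 (coeff ?G2 i)" for i
    by (rule rv_coeff_pcompose_eq[OF m z(2) deg(1,2)])
  have "r1 (poly ?G1 1) = r2 (poly ?G2 u)"
  proof (cases "nonzero_poly r1 ?G1")
    case False
    hence 1: "r1 (coeff ?G1 i) = None" for i by (metis nonzero_poly_def)
    have "r1 (poly ?G1 1) = None" "r2 (poly ?G2 u) = None"
      unfolding poly_altdef using 1 eq
      by (auto intro!: A.rv_sum_None B.rv_sum_None B.rv_mult_None)
    thus ?thesis by simp
  next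
    case True
    then obtain \<delta> i where G: "coeffs_ge r1 \<delta> ?G1" "digit r1 \<delta> (coeff ?G1 i) \<noteq> 0"
      using A.gauss_valuation by blast
    have ne: "digit r1 \<delta> (poly ?G1 1) \<noteq> 0"
    proof
      assume "digit r1 \<delta> (poly ?G1 1) = 0"
      moreover have "\<not> val_ge r1 (\<gamma> + 1) (c0 + z - c1)"
        if "j < degree P1" "nonzero_poly r1 (hasse j P1)" "r1 (poly (hasse j P1) c1) = None" for j c1
        using iso[OF _ that(2,3)] that(1) deg by simp
      ultimately show False
        by (intro A.isolated_no_collision[OF z(1) _ _ G, where k = 0]) (use deg in auto)
    qed
    note G2 = digits_transfer[OF eq G(1)]
    have "digit r2 \<delta> (poly ?G2 u) = digit r1 \<delta> (poly ?G1 1)"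
      using B.digit_poly_near_1[OF G2(1) u] G2(2)[of 0] by simp
    moreover have "val_ge r2 \<delta> (poly ?G2 u)" by (intro B.val_ge_poly G2 B.val_ge_near_1 u)
    moreover have "val_ge r1 \<delta> (poly ?G1 1)" by (intro A.val_ge_poly G) simp
    ultimately show ?thesis using ne by (metis A.rv_eq_Some_iff B.rv_eq_Some_iff)
  qed
  thus ?thesis by (simp add: poly_pcompose mult.commute[of z' u])
qed

text \<open>At a root of F1 the digits do cancel. A second cancellation, in the first derivative, is
  excluded by isolation from the roots of proper derivatives; both facts are visible in r2 by
  \<open>digits_transfer\<close>, and \<open>hensel\<close> there yields u.\<close>

lemma isolated_root_match:
  assumes m: "\<And>j. j \<le> d \<Longrightarrow> r1 (poly (hasse j F1) c0) = r2 (poly (hasse j F2) c0')"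
    and z: "r1 z = Some (\<gamma>, a)" "r1 z = r2 z'" and deg: "degree F1 \<le> d" "degree F2 \<le> d" "d < p"
    and iso: "\<And>j c1. 1 \<le> j \<Longrightarrow> j \<le> d \<Longrightarrow> nonzero_poly r1 (hasse j F1) \<Longrightarrow>
      r1 (poly (hasse j F1) c1) = None \<Longrightarrow> \<not> val_ge r1 (\<gamma> + 1) (c0 + z - c1)"
    and root: "r1 (poly F1 (c0 + z)) = None" and lead: "r1 (coeff F1 d) \<noteq> None"
  obtains u where "val_ge r2 1 (u - 1)" "r2 (poly F2 (c0' + z' * u)) = None"
proof -
  let ?G1 = "pcompose F1 [:c0, z:]" and ?G2 = "pcompose F2 [:c0', z':]"
  have eq: "r1 (coeff ?G1 i) = r2 (coeff ?G2 i)" for i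
    by (rule rv_coeff_pcompose_eq[OF m z(2) deg(1,2)])
  \<comment> \<open>The Taylor coefficient of order d is the same at every center, which shows that
    the rescaled polynomial is nonzero.\<close>
  have hd: "hasse d F1 = [:coeff F1 d:]"
    using deg(1) by (intro poly_eqI) (auto simp: coeff_hasse coeff_pCons coeff_eq_0 split: nat.split)
  have "r1 (z ^ d) \<noteq> None" by (induction d) (use z in \<open>auto simp: A.rv_1 A.rv_mult\<close>)
  hence "r1 (coeff ?G1 d) \<noteq> None"
    using lead by (simp add: coeff_pcompose_linear_hasse hd A.lead_mult_eq_None)
  hence "nonzero_poly r1 ?G1" unfolding nonzero_poly_def by blast
  then obtain \<delta> i where G: "coeffs_ge r1 \<delta> ?G1" "digit r1 \<delta> (coeff ?G1 i) \<noteq> 0"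
    using A.gauss_valuation by blast
  have G0: "digit r1 \<delta> (poly ?G1 1) = 0" using root by (simp add: poly_pcompose A.digit_None)
  have "digit r1 \<delta> (poly (hasse 1 ?G1) 1) \<noteq> 0"
  proof
    assume "digit r1 \<delta> (poly (hasse 1 ?G1) 1) = 0"
    thus False
      by (intro A.isolated_no_collision[OF z(1) _ _ G G0, where k = 1]) (use iso deg in auto)
  qed
  note G2 = digits_transfer[OF eq G(1)]
  obtain u where "val_ge r2 1 (u - 1)" "r2 (poly ?G2 u) = None"
    using B.hensel[OF G2(1)] G2(2)[of 0] G2(2)[of 1] G0
      \<open>digit r1 \<delta> (poly (hasse 1 ?G1) 1) \<noteq> 0\<close> by auto
  thus ?thesis using that[of u] by (simp add: poly_pcompose mult.commute)
qed

end

section \<open>Statements uniform in p and in the two fields\<close>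

definition agree :: "nat \<Rightarrow> ('k::comm_ring_1 \<Rightarrow> lead) \<Rightarrow> ('k \<Rightarrow> lead) \<Rightarrow> ('a::comm_ring_1 \<Rightarrow> 'k) \<Rightarrow>
    ('a \<Rightarrow> 'k) \<Rightarrow> 'a set \<Rightarrow> bool" where
  "agree p r1 r2 f1 f2 S \<longleftrightarrow> lead_ring p r1 \<and> lead_ring p r2 \<and> homo f1 \<and> homo f2 \<and>
     (\<forall>s\<in>S. r1 (f1 s) = r2 (f2 s))"

text \<open>N and S are chosen before p, the fields and the specialisations f1, f2. S collects the
  coefficients whose leading terms have to coincide; being finite, it can be carried through an
  induction on formulas.\<close>

definition uniformly :: "(nat \<Rightarrow> ('k::comm_ring_1 \<Rightarrow> lead) \<Rightarrow> ('k \<Rightarrow> lead) \<Rightarrow> ('a::comm_ring_1 \<Rightarrow> 'k) \<Rightarrow>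
    ('a \<Rightarrow> 'k) \<Rightarrow> bool) \<Rightarrow> bool" where
  "uniformly \<Phi> \<longleftrightarrow> (\<exists>N S. finite S \<and>
     (\<forall>p>N. \<forall>r1 r2 f1 f2. agree p r1 r2 f1 f2 S \<longrightarrow> \<Phi> p r1 r2 f1 f2))"

lemma uniformlyI:
  assumes "finite S" "\<And>p r1 r2 f1 f2. N < p \<Longrightarrow> agree p r1 r2 f1 f2 S \<Longrightarrow> \<Phi> p r1 r2 f1 f2"
  shows "uniformly \<Phi>"
  using assms unfolding uniformly_def by blast

text \<open>Agreement on the empty set still provides the axioms of both fields and the homomorphism
  laws.\<close>

lemma uniformly_mono:
  assumes "uniformly \<Phi>"
    and "\<And>p r1 r2 f1 f2. agree p r1 r2 f1 f2 {} \<Longrightarrow> \<Phi> p r1 r2 f1 f2 \<Longrightarrow> \<Psi> p r1 r2 f1 f2"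
  shows "uniformly \<Psi>"
  using assms unfolding uniformly_def agree_def by (metis empty_iff)

lemma uniformly_conj:
  assumes "uniformly \<Phi>" "uniformly \<Psi>"
  shows "uniformly (\<lambda>p r1 r2 f1 f2. \<Phi> p r1 r2 f1 f2 \<and> \<Psi> p r1 r2 f1 f2)"
proof -
  obtain N S N' S' where S: "finite S" "\<And>p r1 r2 f1 f2. N < p \<Longrightarrow> agree p r1 r2 f1 f2 S \<Longrightarrow> \<Phi> p r1 r2 f1 f2"
      "finite S'" "\<And>p r1 r2 f1 f2. N' < p \<Longrightarrow> agree p r1 r2 f1 f2 S' \<Longrightarrow> \<Psi> p r1 r2 f1 f2"
    using assms unfolding uniformly_def by metis
  show ?thesis
    by (rule uniformlyI[of "S \<union> S'" "max N N'"]) (use S in \<open>auto simp: agree_def\<close>)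
qed

lemma uniformly_ball:
  assumes "finite A" "\<And>x. x \<in> A \<Longrightarrow> uniformly (\<Phi> x)"
  shows "uniformly (\<lambda>p r1 r2 f1 f2. \<forall>x\<in>A. \<Phi> x p r1 r2 f1 f2)"
  using assms
proof (induction A)
  case empty
  show ?case by (rule uniformlyI[of "{}" 0]) auto
next
  case (insert x A)
  hence "uniformly (\<lambda>p r1 r2 f1 f2. \<Phi> x p r1 r2 f1 f2 \<and> (\<forall>x\<in>A. \<Phi> x p r1 r2 f1 f2))"
    by (intro uniformly_conj) auto
  thus ?case by (rule uniformly_mono) auto
qed

lemma uniformly_rv_eq: "uniformly (\<lambda>p r1 r2 f1 f2. r1 (f1 s) = r2 (f2 s))"
  by (rule uniformlyI[of "{s}" 0]) (auto simp: agree_def)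

lemma uniformly_gt: "uniformly (\<lambda>p r1 r2 f1 f2. n < p)"
  by (rule uniformlyI[of "{}" n]) auto

definition matching :: "'a::comm_ring_1 poly set \<Rightarrow> ('k::comm_ring_1 \<Rightarrow> lead) \<Rightarrow> ('k \<Rightarrow> lead) \<Rightarrow>
    ('a \<Rightarrow> 'k) \<Rightarrow> ('a \<Rightarrow> 'k) \<Rightarrow> 'k \<Rightarrow> 'k \<Rightarrow> bool" where
  "matching T r1 r2 f1 f2 c c' \<longleftrightarrow>
     (\<forall>P\<in>T. r1 (poly (map_poly f1 P) c) = r2 (poly (map_poly f2 P) c'))"

definition root_of :: "'a::comm_ring_1 poly \<Rightarrow> ('k::comm_ring_1 \<Rightarrow> lead) \<Rightarrow> ('a \<Rightarrow> 'k) \<Rightarrow> 'k \<Rightarrow> bool" where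
  "root_of F r f c \<longleftrightarrow> nonzero_poly r (map_poly f F) \<and> r (poly (map_poly f F) c) = None"

lemma matching_subset: "matching T r1 r2 f1 f2 c c' \<Longrightarrow> S \<subseteq> T \<Longrightarrow> matching S r1 r2 f1 f2 c c'"
  by (auto simp: matching_def)

lemma uniformly_matching_0:
  assumes "finite T"
  shows "uniformly (\<lambda>p r1 r2 f1 f2. matching T r1 r2 f1 f2 0 0)"
proof -
  have "uniformly (\<lambda>p r1 r2 f1 f2. \<forall>P\<in>T. r1 (f1 (coeff P 0)) = r2 (f2 (coeff P 0)))"
    by (intro uniformly_ball uniformly_rv_eq assms)
  thus ?thesis
    by (rule uniformly_mono) (auto simp: matching_def poly_0_coeff_0 coeff_map agree_def)
qed

definition hasse_closure :: "nat \<Rightarrow> 'a::comm_ring_1 poly set \<Rightarrow> 'a poly set" where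
  "hasse_closure d U = (\<lambda>(j, P). hasse j P) ` ({..d} \<times> U)"

lemma finite_hasse_closure: "finite U \<Longrightarrow> finite (hasse_closure d U)"
  by (simp add: hasse_closure_def)

lemma hasse_closureI: "j \<le> d \<Longrightarrow> P \<in> U \<Longrightarrow> hasse j P \<in> hasse_closure d U"
  by (force simp: hasse_closure_def)

lemma degree_hasse_closure:
  assumes "Q \<in> hasse_closure d U" "\<And>P. P \<in> U \<Longrightarrow> degree P \<le> n" shows "degree Q \<le> n"
  using assms degree_hasse_le by (fastforce simp: hasse_closure_def intro: order_trans)

context lead_ring_pair
begin

text \<open>The case distinction shared by both matching theorems. A point that is zero or itself a
  root of some Q has a partner already. Otherwise it is c0 + z for a closest center c0, and
  \<open>rv_surj\<close> provides a z' with the leading term of z in the second field.\<close>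

lemma center_cases:
  assumes f: "homo f1" "homo f2" and W: "finite W"
    and zero: "matching T r1 r2 f1 f2 0 0"
    and roots: "\<And>Q c0. Q \<in> W \<Longrightarrow> root_of Q r1 f1 c0 \<Longrightarrow> \<exists>c'. matching T r1 r2 f1 f2 c0 c'"
  obtains (match) c' where "matching T r1 r2 f1 f2 c c'"
  | (isolated) c0 z c0' z' \<gamma> a where "c = c0 + z" "r1 z = Some (\<gamma>, a)" "r1 z = r2 z'"
      "matching T r1 r2 f1 f2 c0 c0'"
      "\<And>Q c1. Q \<in> W \<Longrightarrow> root_of Q r1 f1 c1 \<Longrightarrow> \<not> val_ge r1 (\<gamma> + 1) (c0 + z - c1)"
proof (cases "r1 c = None \<or> (\<exists>Q\<in>W. root_of Q r1 f1 c)")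
  case True
  thus ?thesis
  proof
    assume "r1 c = None"
    hence "r1 (poly Q c) = r1 (poly Q 0)" for Q by (intro A.rv_poly_cong) simp
    hence "matching T r1 r2 f1 f2 c 0" using zero by (simp add: matching_def)
    thus ?thesis by (rule match)
  next
    assume "\<exists>Q\<in>W. root_of Q r1 f1 c"
    thus ?thesis using roots match by blast
  qed
next
  case False
  have fin: "finite (map_poly f1 ` W)" using W by simp
  have nr: "r1 (poly Q c) \<noteq> None" if "Q \<in> map_poly f1 ` W" "nonzero_poly r1 Q" for Q
    using that False by (auto simp: root_of_def)
  obtain c0 \<gamma> a where c0: "c0 = 0 \<or> (\<exists>Q\<in>map_poly f1 ` W. nonzero_poly r1 Q \<and> r1 (poly Q c0) = None)"
      "r1 (c - c0) = Some (\<gamma>, a)"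
      "\<And>Q c1. Q \<in> map_poly f1 ` W \<Longrightarrow> nonzero_poly r1 Q \<Longrightarrow> r1 (poly Q c1) = None \<Longrightarrow>
         \<not> val_ge r1 (\<gamma> + 1) (c - c1)"
    using A.closest_center[OF fin _ nr] False by blast
  obtain c0' where c0': "matching T r1 r2 f1 f2 c0 c0'"
    using c0(1) zero roots unfolding root_of_def by blast
  obtain z' where z': "r2 z' = Some (\<gamma>, a)"
    using B.rv_surj A.rv_range[OF c0(2)] by blast
  show ?thesis
    by (rule isolated[of c0 "c - c0" \<gamma> a z' c0'])
       (use c0 c0' z' in \<open>auto simp: root_of_def\<close>)
qed

end

text \<open>Induction on the degree bound, with F and T arbitrary because roots of smaller
  polynomials have to be matched against larger sets.\<close>

lemma uniformly_root_matching:
  fixes F :: "'a::comm_ring_1 poly"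
  assumes "degree F \<le> d" "finite T"
  shows "uniformly (\<lambda>p (r1 :: 'k::comm_ring_1 \<Rightarrow> lead) r2 f1 f2.
    \<forall>c. root_of F r1 f1 c \<longrightarrow> (\<exists>c'. matching T r1 r2 f1 f2 c c'))"
  using assms
proof (induction d arbitrary: F T)
  case 0
  then obtain a where F: "F = [:a:]" by (metis le_zero_eq degree_eq_zeroE)
  \<comment> \<open>A nonzero constant has no roots.\<close>
  have "\<not> root_of F r f c" if "homo f" "lead_ring p r" for p and r :: "'k \<Rightarrow> lead" and f c
  proof -
    have "map_poly f F = [:f a:]"
      by (rule poly_eqI)
         (auto simp: F coeff_map[OF that(1)] coeff_pCons homo_simps[OF that(1)] split: nat.split)
    thus ?thesis using lead_ring.rv_0[OF that(2)]
      by (auto simp: root_of_def nonzero_poly_def coeff_pCons split: nat.splits)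
  qed
  thus ?case by (intro uniformlyI[of "{}" 0]) (auto simp: agree_def)
next
  case (Suc d')
  let ?d = "Suc d'"
  define a where "a = coeff F ?d"
  \<comment> \<open>Replaces F in those fields in which the coefficient a vanishes, where it has the
    same roots.\<close>
  define Fl where "Fl = F - monom a ?d"
  have dFl: "degree Fl \<le> d'"
  proof (rule degree_le, intro allI impI)
    fix i assume "d' < i"
    thus "coeff Fl i = 0" using Suc.prems(1)
      by (cases "i = ?d") (auto simp: Fl_def a_def intro: coeff_eq_0)
  qed
  have "\<forall>P. \<exists>k Q R. smult (a ^ k) P = Q * F + R \<and> degree R < ?d"
    using pseudo_remainder[OF Suc.prems(1)] by (simp add: a_def)
  then obtain k Q R where R: "\<And>P. smult (a ^ k P) P = Q P * F + R P" "\<And>P. degree (R P) < ?d"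
    by metis
  \<comment> \<open>All of degree at most d', so that roots of their derivatives are centers with
    known partners. The remainders stand for the elements of T at roots of F; the proper derivatives
    keep the rescaled root of F simple.\<close>
  define U where "U = R ` T \<union> (\<lambda>j. hasse j F) ` {1..?d}"
  define W where "W = hasse_closure ?d U"
  \<comment> \<open>Partners of centers must match the Taylor coefficients of F and of U, and also
    T, for the case that the root is itself a center.\<close>
  define T' where "T' = T \<union> hasse_closure ?d (insert F U)"
  have fin: "finite W" "finite T'" using Suc.prems(2)
    by (auto simp: W_def T'_def U_def intro!: finite_hasse_closure)
  have dU: "degree P \<le> d'" if "P \<in> U" for P
  proof -
    have "degree (hasse j F) \<le> d'" if "1 \<le> j" for j
      using degree_hasse_le[of j F] Suc.prems(1) that by linarith
    moreover have "degree (R P) \<le> d'" for P using R(2)[of P] by simp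
    ultimately show ?thesis using that by (auto simp: U_def)
  qed
  have dW: "degree P \<le> d'" if "P \<in> W" for P
    using that dU unfolding W_def by (rule degree_hasse_closure)
  have "uniformly (\<lambda>p (r1 :: 'k \<Rightarrow> lead) r2 f1 f2. ?d < p \<and> r1 (f1 a) = r2 (f2 a) \<and>
      matching T' r1 r2 f1 f2 0 0 \<and>
      (\<forall>Q\<in>W. \<forall>c. root_of Q r1 f1 c \<longrightarrow> (\<exists>c'. matching T' r1 r2 f1 f2 c c')) \<and>
      (\<forall>c. root_of Fl r1 f1 c \<longrightarrow> (\<exists>c'. matching T r1 r2 f1 f2 c c')))"
    by (intro uniformly_conj uniformly_ball uniformly_gt uniformly_rv_eq uniformly_matching_0
        Suc.IH fin dFl dW Suc.prems(2))
  thus ?case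
  proof (rule uniformly_mono, intro allI impI, elim conjE)
    fix p and r1 r2 :: "'k \<Rightarrow> lead" and f1 f2 and c :: 'k
    assume ag: "agree p r1 r2 f1 f2 {}" and dp: "?d < p" and ra: "r1 (f1 a) = r2 (f2 a)"
      and zero: "matching T' r1 r2 f1 f2 0 0"
      and roots: "\<forall>Q\<in>W. \<forall>c. root_of Q r1 f1 c \<longrightarrow> (\<exists>c'. matching T' r1 r2 f1 f2 c c')"
      and low: "\<forall>c. root_of Fl r1 f1 c \<longrightarrow> (\<exists>c'. matching T r1 r2 f1 f2 c c')"
      and c: "root_of F r1 f1 c"
    have f: "homo f1" "homo f2" using ag by (auto simp: agree_def)
    interpret lead_ring_pair p r1 r2
      using ag by (auto simp: agree_def lead_ring_pair_def)
    note map_simps = map_poly_plus map_poly_times map_poly_scale map_poly_hasse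
    have root: "r1 (poly (map_poly f1 F) c) = None" using c by (simp add: root_of_def)
    show "\<exists>c'. matching T r1 r2 f1 f2 c c'"
    proof (cases "r1 (f1 a) = None")
      case True
      have "map_poly f1 Fl = map_poly f1 F - monom (f1 a) ?d"
        using map_poly_plus[OF f(1), of Fl "monom a ?d"]
        by (simp add: Fl_def map_poly_monom homo_simps[OF f(1)])
      hence e: "poly (map_poly f1 Fl) c = poly (map_poly f1 F) c - f1 a * c ^ ?d"
        by (simp add: poly_monom)
      have "r1 (poly (map_poly f1 Fl) c) = None"
        unfolding e by (intro A.rv_diff_None A.rv_mult_None root disjI1 True)
      moreover obtain i where i: "r1 (f1 (coeff F i)) \<noteq> None"
        using c by (auto simp: root_of_def nonzero_poly_def coeff_map[OF f(1)])
      have "i \<noteq> ?d" using i True by (auto simp: a_def)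
      hence "r1 (coeff (map_poly f1 Fl) i) \<noteq> None"
        using i by (simp add: coeff_map[OF f(1)] Fl_def)
      hence "nonzero_poly r1 (map_poly f1 Fl)" unfolding nonzero_poly_def by blast
      ultimately show ?thesis using low by (simp add: root_of_def)
    next
      case False
      show ?thesis
      proof (rule center_cases[OF f fin(1) zero, of c])
        show "\<exists>c'. matching T' r1 r2 f1 f2 c0 c'" if "Q \<in> W" "root_of Q r1 f1 c0" for Q c0
          using roots that by blast
      next
        fix c' assume "matching T' r1 r2 f1 f2 c c'"
        thus ?thesis using matching_subset[of T' r1 r2 f1 f2 c c' T] unfolding T'_def by blast
      next
        fix c0 z c0' z' \<gamma> b
        assume z: "c = c0 + z" "r1 z = Some (\<gamma>, b)" "r1 z = r2 z'"
          and m: "matching T' r1 r2 f1 f2 c0 c0'"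
          and iso: "\<And>Q c1. Q \<in> W \<Longrightarrow> root_of Q r1 f1 c1 \<Longrightarrow> \<not> val_ge r1 (\<gamma> + 1) (c0 + z - c1)"
        have m': "r1 (poly (hasse j (map_poly f1 P)) c0) = r2 (poly (hasse j (map_poly f2 P)) c0')"
          if "j \<le> ?d" "P \<in> insert F U" for j P
          using m hasse_closureI[OF that] f
          by (auto simp: matching_def T'_def map_poly_hasse[symmetric])
        have deg: "degree (map_poly f1 P) \<le> ?d" "degree (map_poly f2 P) \<le> ?d"
          if "P \<in> insert F U" for P
        proof -
          have "degree P \<le> ?d" using that dU[of P] Suc.prems(1) by auto
          thus "degree (map_poly f1 P) \<le> ?d" "degree (map_poly f2 P) \<le> ?d"
            using degree_map_le f order_trans by blast+
        qed
        have iso': "\<not> val_ge r1 (\<gamma> + 1) (c0 + z - c1)"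
          if "j \<le> ?d" "P \<in> U" "nonzero_poly r1 (hasse j (map_poly f1 P))"
            "r1 (poly (hasse j (map_poly f1 P)) c1) = None" for j c1 P
          using iso[of "hasse j P" c1] hasse_closureI[OF that(1,2)] that(3,4)
          by (simp add: W_def root_of_def map_poly_hasse f)
        have iso_F: "\<not> val_ge r1 (\<gamma> + 1) (c0 + z - c1)"
          if "1 \<le> j" "j \<le> ?d" "nonzero_poly r1 (hasse j (map_poly f1 F))"
            "r1 (poly (hasse j (map_poly f1 F)) c1) = None" for j c1
        \<comment> \<open>A proper derivative of F is an element of U, taken with order 0.\<close>
        proof (rule iso'[of 0 "hasse j F"])
          show "hasse j F \<in> U" using that by (auto simp: U_def)
        qed (use that in \<open>simp_all add: map_poly_hasse f\<close>)
        obtain u where u: "val_ge r2 1 (u - 1)" "r2 (poly (map_poly f2 F) (c0' + z' * u)) = None"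
        proof (rule isolated_root_match[OF m' z(2,3) deg dp iso_F])
          show "r1 (poly (map_poly f1 F) (c0 + z)) = None" using root z(1) by simp
          show "r1 (coeff (map_poly f1 F) ?d) \<noteq> None" using False f by (simp add: coeff_map a_def)
        qed auto
        let ?c' = "c0' + z' * u"
        \<comment> \<open>The u found for F is used for all of U: the point is isolated with respect
          to the derivatives of these polynomials, including those of order 0.\<close>
        have mU: "r1 (poly (map_poly f1 P) c) = r2 (poly (map_poly f2 P) ?c')" if "P \<in> U" for P
          unfolding z(1)
          by (rule isolated_match[OF m' z(2,3) deg dp iso' u(1)]) (use that in auto)
        have "r1 (poly (map_poly f1 P) c) = r2 (poly (map_poly f2 P) ?c')" if "P \<in> T" for P
        \<comment> \<open>At roots of F the pseudo-division reads a^k * P = R, and a has the same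
          leading term, different from \<open>None\<close>, in both fields.\<close>
        proof (rule rv_cancel[of "f1 a ^ k P" "f2 a ^ k P"])
          have e: "f a ^ k P * poly (map_poly f P) x =
              poly (map_poly f (Q P)) x * poly (map_poly f F) x + poly (map_poly f (R P)) x"
            if "homo f" for f :: "'a \<Rightarrow> 'k" and x
          proof -
            have "poly (map_poly f (smult (a ^ k P) P)) x = poly (map_poly f (Q P * F + R P)) x"
              by (simp add: R(1))
            thus ?thesis using that by (simp add: map_poly_plus map_poly_times map_poly_scale homo_power)
          qed
          have "r1 (f1 a ^ k P * poly (map_poly f1 P) c) = r1 (poly (map_poly f1 (R P)) c)"
            by (rule A.rv_cong) (simp add: e f A.rv_mult_None root)
          also have "\<dots> = r2 (poly (map_poly f2 (R P)) ?c')"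
            by (rule mU) (use that in \<open>simp add: U_def\<close>)
          also have "\<dots> = r2 (f2 a ^ k P * poly (map_poly f2 P) ?c')"
            by (rule B.rv_cong[symmetric]) (simp add: e f B.rv_mult_None u(2))
          finally show "r1 (f1 a ^ k P * poly (map_poly f1 P) c) =
              r2 (f2 a ^ k P * poly (map_poly f2 P) ?c')" .
          show "r1 (f1 a ^ k P) = r2 (f2 a ^ k P)" by (rule rv_power_eq[OF ra])
          have "r1 (f1 a ^ n) \<noteq> None" for n
            by (induction n) (use False in \<open>auto simp: A.rv_1 A.rv_mult\<close>)
          thus "r1 (f1 a ^ k P) \<noteq> None" .
        qed
        thus ?thesis unfolding matching_def by blast
      qed
    qed
  qed
qed

theorem uniformly_point_matching:
  fixes T :: "'a::comm_ring_1 poly set"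
  assumes T: "finite T"
  shows "uniformly (\<lambda>p (r1 :: 'k::comm_ring_1 \<Rightarrow> lead) r2 f1 f2.
    \<forall>c. \<exists>c'. matching T r1 r2 f1 f2 c c')"
proof -
  define d where "d = Max (insert 0 (degree ` T))"
  have dT: "degree P \<le> d" if "P \<in> T" for P
    unfolding d_def using T that by (intro Max_ge) auto
  define W where "W = hasse_closure d T"
  have fin: "finite W" "finite (T \<union> W)" using T by (auto simp: W_def finite_hasse_closure)
  have dW: "degree P \<le> d" if "P \<in> W" for P
    using that dT unfolding W_def by (rule degree_hasse_closure)
  have "uniformly (\<lambda>p (r1 :: 'k \<Rightarrow> lead) r2 f1 f2. d < p \<and> matching (T \<union> W) r1 r2 f1 f2 0 0 \<and>
      (\<forall>Q\<in>W. \<forall>c. root_of Q r1 f1 c \<longrightarrow> (\<exists>c'. matching (T \<union> W) r1 r2 f1 f2 c c')))"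
    by (intro uniformly_conj uniformly_ball uniformly_gt uniformly_matching_0
        uniformly_root_matching[of _ d] fin dW)
  thus ?thesis
  proof (rule uniformly_mono, intro allI, elim conjE)
    fix p and r1 r2 :: "'k \<Rightarrow> lead" and f1 f2 and c :: 'k
    assume ag: "agree p r1 r2 f1 f2 {}" and dp: "d < p"
      and zero: "matching (T \<union> W) r1 r2 f1 f2 0 0"
      and roots: "\<forall>Q\<in>W. \<forall>c. root_of Q r1 f1 c \<longrightarrow> (\<exists>c'. matching (T \<union> W) r1 r2 f1 f2 c c')"
    have f: "homo f1" "homo f2" using ag by (auto simp: agree_def)
    interpret lead_ring_pair p r1 r2
      using ag by (auto simp: agree_def lead_ring_pair_def)
    show "\<exists>c'. matching T r1 r2 f1 f2 c c'"
    proof (rule center_cases[OF f fin(1) zero, of c])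
      show "\<exists>c'. matching (T \<union> W) r1 r2 f1 f2 c0 c'" if "Q \<in> W" "root_of Q r1 f1 c0" for Q c0
        using roots that by blast
    next
      fix c' assume "matching (T \<union> W) r1 r2 f1 f2 c c'"
      thus ?thesis using matching_subset[of "T \<union> W"] by blast
    next
      fix c0 z c0' z' \<gamma> b
      assume z: "c = c0 + z" "r1 z = Some (\<gamma>, b)" "r1 z = r2 z'"
        and m: "matching (T \<union> W) r1 r2 f1 f2 c0 c0'"
        and iso: "\<And>Q c1. Q \<in> W \<Longrightarrow> root_of Q r1 f1 c1 \<Longrightarrow> \<not> val_ge r1 (\<gamma> + 1) (c0 + z - c1)"
      have "r1 (poly (map_poly f1 P) (c0 + z)) = r2 (poly (map_poly f2 P) (c0' + z' * 1))"
        if P: "P \<in> T" for P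
      proof (rule isolated_match[OF _ z(2,3) _ _ dp])
        show "r1 (poly (hasse j (map_poly f1 P)) c0) = r2 (poly (hasse j (map_poly f2 P)) c0')"
          if "j \<le> d" for j
          using m hasse_closureI[OF that P] f
          by (auto simp: matching_def W_def map_poly_hasse[symmetric])
        show "degree (map_poly f1 P) \<le> d" "degree (map_poly f2 P) \<le> d"
          using degree_map_le f dT[OF P] order_trans by blast+
        show "\<not> val_ge r1 (\<gamma> + 1) (c0 + z - c1)"
          if "j \<le> d" "nonzero_poly r1 (hasse j (map_poly f1 P))"
            "r1 (poly (hasse j (map_poly f1 P)) c1) = None" for j c1
          using iso[of "hasse j P" c1] hasse_closureI[OF that(1) P] that(2,3)
          by (simp add: W_def root_of_def map_poly_hasse f)
      qed simp
      thus ?thesis using z(1) unfolding matching_def by auto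
    qed
  qed
qed

section \<open>The ring of term functions\<close>

primrec term_eval :: "(nat \<Rightarrow> 'k::comm_ring_1) \<Rightarrow> ring_term \<Rightarrow> 'k" where
  "term_eval e (RVar n) = e n"
| "term_eval e RZero = 0"
| "term_eval e ROne = 1"
| "term_eval e (RAdd s t) = term_eval e s + term_eval e t"
| "term_eval e (RNeg t) = - term_eval e t"
| "term_eval e (RMult s t) = term_eval e s * term_eval e t"

text \<open>This ring stands for the integer polynomials in the variables \<open>RVar n\<close>.\<close>

typedef (overloaded) 'k term_fun = "range (\<lambda>t (e :: nat \<Rightarrow> 'k::comm_ring_1). term_eval e t)"
  morphisms apply_tf Abs_tf by blast

setup_lifting type_definition_term_fun

instantiation term_fun :: (comm_ring_1) comm_ring_1
begin

lift_definition zero_term_fun :: "'a term_fun" is "\<lambda>e. 0"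
  by (rule range_eqI[of _ _ RZero]) simp
lift_definition one_term_fun :: "'a term_fun" is "\<lambda>e. 1"
  by (rule range_eqI[of _ _ ROne]) simp
lift_definition plus_term_fun :: "'a term_fun \<Rightarrow> 'a term_fun \<Rightarrow> 'a term_fun" is "\<lambda>f g e. f e + g e"
  by (elim rangeE, rule range_eqI[of _ _ "RAdd _ _"]) simp
lift_definition times_term_fun :: "'a term_fun \<Rightarrow> 'a term_fun \<Rightarrow> 'a term_fun" is "\<lambda>f g e. f e * g e"
  by (elim rangeE, rule range_eqI[of _ _ "RMult _ _"]) simp
lift_definition uminus_term_fun :: "'a term_fun \<Rightarrow> 'a term_fun" is "\<lambda>f e. - f e"
  by (elim rangeE, rule range_eqI[of _ _ "RNeg _"]) simp
lift_definition minus_term_fun :: "'a term_fun \<Rightarrow> 'a term_fun \<Rightarrow> 'a term_fun" is "\<lambda>f g e. f e - g e"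
  by (elim rangeE, rule range_eqI[of _ _ "RAdd _ (RNeg _)"]) simp

instance
  by standard (transfer; simp add: algebra_simps fun_eq_iff)+

end

lift_definition term_fun :: "ring_term \<Rightarrow> 'k::comm_ring_1 term_fun" is "\<lambda>t e. term_eval e t"
  by blast

lemma apply_term_fun [simp]: "apply_tf (term_fun t) e = term_eval e t"
  by transfer simp

lemma apply_tf_is_term: "\<exists>t. \<forall>e. apply_tf x e = term_eval e t"
  by transfer auto

lemma apply_tf_simps [simp]:
  "apply_tf 0 e = 0" "apply_tf 1 e = 1" "apply_tf (x + y) e = apply_tf x e + apply_tf y e"
  "apply_tf (x * y) e = apply_tf x e * apply_tf y e" "apply_tf (- x) e = - apply_tf x e"
  by (transfer; simp)+

lemma homo_apply_tf: "homo (\<lambda>x. apply_tf x e)"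
  by (simp add: homo_def)

text \<open>Separates the variable bound by a quantifier from the others, which enter through the
  coefficients. Term functions rather than terms serve as coefficients because they form a
  commutative ring.\<close>

lemma term_as_poly:
  "\<exists>P :: 'k::comm_ring_1 term_fun poly. \<forall>e a.
     term_eval (e(n := a)) t = poly (map_poly (\<lambda>x. apply_tf x e) P) a"
proof (induction t)
  case (RVar m)
  show ?case
  proof (cases "m = n")
    case True
    thus ?thesis by (intro exI[of _ "[:0, 1:]"]) (simp add: map_poly_pCons)
  next
    case False
    thus ?thesis by (intro exI[of _ "[:term_fun (RVar m):]"]) (simp add: map_poly_pCons)
  qed
next
  case RZero
  show ?case by (rule exI[of _ 0]) simp
next
  case ROne
  show ?case by (rule exI[of _ "[:1:]"]) (simp add: map_poly_pCons)
next
  case (RAdd s t)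
  then obtain P Q :: "'k term_fun poly" where
    "\<forall>e a. term_eval (e(n := a)) s = poly (map_poly (\<lambda>x. apply_tf x e) P) a"
    "\<forall>e a. term_eval (e(n := a)) t = poly (map_poly (\<lambda>x. apply_tf x e) Q) a" by blast
  thus ?case by (intro exI[of _ "P + Q"]) (simp only: map_poly_plus homo_apply_tf term_eval.simps poly_add simp_thms)
next
  case (RNeg t)
  then obtain P :: "'k term_fun poly" where
    "\<forall>e a. term_eval (e(n := a)) t = poly (map_poly (\<lambda>x. apply_tf x e) P) a" by blast
  thus ?case by (intro exI[of _ "smult (- 1) P"])
      (simp only: map_poly_scale homo_apply_tf term_eval.simps poly_smult apply_tf_simps mult_minus1 simp_thms)
next
  case (RMult s t)
  then obtain P Q :: "'k term_fun poly" where
    "\<forall>e a. term_eval (e(n := a)) s = poly (map_poly (\<lambda>x. apply_tf x e) P) a"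
    "\<forall>e a. term_eval (e(n := a)) t = poly (map_poly (\<lambda>x. apply_tf x e) Q) a" by blast
  thus ?case by (intro exI[of _ "P * Q"]) (simp only: map_poly_times homo_apply_tf term_eval.simps poly_mult simp_thms)
qed

definition same_lead :: "ring_term set \<Rightarrow> ('k::comm_ring_1 \<Rightarrow> lead) \<Rightarrow> ('k \<Rightarrow> lead) \<Rightarrow>
    (nat \<Rightarrow> 'k) \<Rightarrow> (nat \<Rightarrow> 'k) \<Rightarrow> bool" where
  "same_lead S r1 r2 e1 e2 \<longleftrightarrow> (\<forall>t\<in>S. r1 (term_eval e1 t) = r2 (term_eval e2 t))"

lemma same_lead_sym: "same_lead S r1 r2 e1 e2 \<Longrightarrow> same_lead S r2 r1 e2 e1"
  by (auto simp: same_lead_def)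

lemma same_lead_Un: "same_lead (S \<union> T) r1 r2 e1 e2 \<longleftrightarrow> same_lead S r1 r2 e1 e2 \<and> same_lead T r1 r2 e1 e2"
  by (auto simp: same_lead_def)

text \<open>\<open>uniformly_point_matching\<close> applied to the specialisations given by
  evaluation at e1 and e2. The finitely many coefficients in question are term functions; choosing a
  term for each turns them into the set S.\<close>

lemma same_lead_extend:
  assumes "finite T"
  shows "\<exists>N S. finite S \<and> (\<forall>p>N. \<forall>(r1 :: 'k::comm_ring_1 \<Rightarrow> lead) r2 e1 e2.
    lead_ring p r1 \<longrightarrow> lead_ring p r2 \<longrightarrow> same_lead S r1 r2 e1 e2 \<longrightarrow>
    (\<forall>a. \<exists>b. same_lead T r1 r2 (e1(n := a)) (e2(n := b))))"
proof -
  have "\<forall>t. \<exists>P :: 'k term_fun poly. \<forall>e a.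
      term_eval (e(n := a)) t = poly (map_poly (\<lambda>x. apply_tf x e) P) a"
    by (intro allI term_as_poly)
  from choice[OF this] obtain P :: "ring_term \<Rightarrow> 'k term_fun poly" where
    "\<forall>t e a. term_eval (e(n := a)) t = poly (map_poly (\<lambda>x. apply_tf x e) (P t)) a"
    by (elim exE) (rule that)
  hence P: "term_eval (e(n := a)) t = poly (map_poly (\<lambda>x. apply_tf x e) (P t)) a" for t e a
    by (elim allE)
  from uniformly_point_matching[OF finite_imageI[OF assms], of P, where 'k = 'k]
  obtain N S where S: "finite S" "\<forall>p>N. \<forall>r1 r2 (f1 :: 'k term_fun \<Rightarrow> 'k) f2.
      agree p r1 r2 f1 f2 S \<longrightarrow> (\<forall>c. \<exists>c'. matching (P ` T) r1 r2 f1 f2 c c')"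
    unfolding uniformly_def by (elim exE conjE) (rule that)
  have "\<forall>x :: 'k term_fun. \<exists>t. \<forall>e. apply_tf x e = term_eval e t"
    by (intro allI apply_tf_is_term)
  from choice[OF this] obtain \<tau> where "\<forall>(x :: 'k term_fun) e. apply_tf x e = term_eval e (\<tau> x)"
    by (elim exE) (rule that)
  hence \<tau>: "apply_tf x e = term_eval e (\<tau> x)" for x :: "'k term_fun" and e by (elim allE)
  have ext: "\<exists>b. same_lead T r1 r2 (e1(n := a)) (e2(n := b))"
    if "N < p" "lead_ring p r1" "lead_ring p r2" "same_lead (\<tau> ` S) r1 r2 e1 e2"
    for p and r1 r2 :: "'k \<Rightarrow> lead" and e1 e2 a
  proof -
    have "agree p r1 r2 (\<lambda>x. apply_tf x e1) (\<lambda>x. apply_tf x e2) S"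
      using that by (auto simp: agree_def homo_apply_tf \<tau>[symmetric] same_lead_def)
    from S(2)[rule_format, OF that(1) this] obtain b where
      "matching (P ` T) r1 r2 (\<lambda>x. apply_tf x e1) (\<lambda>x. apply_tf x e2) a b" by blast
    thus ?thesis unfolding same_lead_def P matching_def by blast
  qed
  show ?thesis
    by (intro exI[of _ N] exI[of _ "\<tau> ` S"] conjI allI impI ext finite_imageI S(1))
qed

section \<open>Structures represented by rings with leading terms\<close>

definition residue_digit :: "('k \<Rightarrow> lead) \<Rightarrow> 'k \<Rightarrow> int" where
  "residue_digit rv x = (if val_ge rv 0 x then digit rv 0 x else 0)"

definition lead_val :: "lead \<Rightarrow> int with_infty" where
  "lead_val r = (case r of None \<Rightarrow> Infty | Some (g, a) \<Rightarrow> Fin g)"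

text \<open>The field sort is \<open>'k\<close> modulo leading term \<open>None\<close>, named by H;
  the residue field is named by integers. Valuation and residue depend on \<open>rv\<close> alone,
  and two structures represented for the same p can share assignments for the residue and group
  sorts.\<close>

locale represents = lead_ring p rv for p and rv :: "'k::comm_ring_1 \<Rightarrow> lead" +
  fixes M :: "('x, 'y, int with_infty) vf_structure" and H :: "'k \<Rightarrow> 'x" and \<iota> :: "int \<Rightarrow> 'y"
  assumes H_range: "range H = carrier (field_sort M)"
    and H_eq_iff: "H x = H y \<longleftrightarrow> rv (x - y) = None"
    and H_ring: "H 0 = \<zero>\<^bsub>field_sort M\<^esub>" "H 1 = \<one>\<^bsub>field_sort M\<^esub>"
      "H (x + y) = H x \<oplus>\<^bsub>field_sort M\<^esub> H y" "H (x * y) = H x \<otimes>\<^bsub>field_sort M\<^esub> H y"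
      "H (- x) = \<ominus>\<^bsub>field_sort M\<^esub> H x"
    and \<iota>_range: "range \<iota> = carrier (residue_sort M)"
    and \<iota>_eq_iff: "\<iota> a = \<iota> b \<longleftrightarrow> a mod int p = b mod int p"
    and \<iota>_ring: "\<iota> 0 = \<zero>\<^bsub>residue_sort M\<^esub>" "\<iota> 1 = \<one>\<^bsub>residue_sort M\<^esub>"
      "\<iota> (a + b) = \<iota> a \<oplus>\<^bsub>residue_sort M\<^esub> \<iota> b" "\<iota> (a * b) = \<iota> a \<otimes>\<^bsub>residue_sort M\<^esub> \<iota> b"
      "\<iota> (- a) = \<ominus>\<^bsub>residue_sort M\<^esub> \<iota> a"
    and val_H: "val_map M (H x) = lead_val (rv x)"
    and res_H: "res_map M (H x) = \<iota> (residue_digit rv x)"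
    and group_part: "group_sort M = UNIV" "group_add M = (+)" "group_neg M = uminus"
      "group_less M = (<)" "group_zero M = 0" "group_infty M = Infty"

primrec res_terms :: "res_term \<Rightarrow> ring_term set" where
  "res_terms (KVar n) = {}"
| "res_terms KZero = {}"
| "res_terms KOne = {}"
| "res_terms (KAdd s t) = res_terms s \<union> res_terms t"
| "res_terms (KNeg t) = res_terms t"
| "res_terms (KMult s t) = res_terms s \<union> res_terms t"
| "res_terms (Res t) = {t}"

primrec grp_terms :: "grp_term \<Rightarrow> ring_term set" where
  "grp_terms (GVar n) = {}"
| "grp_terms GZero = {}"
| "grp_terms GInfty = {}"
| "grp_terms (GAdd s t) = grp_terms s \<union> grp_terms t"
| "grp_terms (GNeg t) = grp_terms t"
| "grp_terms (Valuation t) = {t}"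

primrec res_int :: "('k::comm_ring_1 \<Rightarrow> lead) \<Rightarrow> (nat \<Rightarrow> 'k) \<Rightarrow> (nat \<Rightarrow> int) \<Rightarrow> res_term \<Rightarrow> int" where
  "res_int rv e f (KVar n) = f n"
| "res_int rv e f KZero = 0"
| "res_int rv e f KOne = 1"
| "res_int rv e f (KAdd s t) = res_int rv e f s + res_int rv e f t"
| "res_int rv e f (KNeg t) = - res_int rv e f t"
| "res_int rv e f (KMult s t) = res_int rv e f s * res_int rv e f t"
| "res_int rv e f (Res t) = residue_digit rv (term_eval e t)"

lemma finite_res_terms: "finite (res_terms t)"
  by (induction t) auto

lemma finite_grp_terms: "finite (grp_terms t)"
  by (induction t) auto

lemma res_int_same_lead: "same_lead (res_terms t) r1 r2 e1 e2 \<Longrightarrow> res_int r1 e1 f t = res_int r2 e2 f t"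
  by (induction t) (auto simp: same_lead_def residue_digit_def val_ge_def digit_def)

context represents
begin

lemma ring_eval_H: "ring_eval (field_sort M) (H \<circ> e) t = H (term_eval e t)"
  by (induction t) (simp_all add: H_ring)

lemma res_eval_\<iota>: "res_eval M (H \<circ> e) (\<iota> \<circ> f) t = \<iota> (res_int rv e f t)"
  by (induction t) (simp_all add: \<iota>_ring res_H ring_eval_H[unfolded comp_def])

end

lemma grp_eval_same_lead:
  assumes "represents p r1 M1 H1 \<iota>1" "represents p r2 M2 H2 \<iota>2"
    and "same_lead (grp_terms t) r1 r2 e1 e2"
  shows "grp_eval M1 (H1 \<circ> e1) g t = grp_eval M2 (H2 \<circ> e2) g t"
proof -
  interpret A: represents p r1 M1 H1 \<iota>1 by fact
  interpret B: represents p r2 M2 H2 \<iota>2 by fact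
  show ?thesis using assms(3)
    by (induction t) (auto simp: A.group_part B.group_part A.ring_eval_H B.ring_eval_H
        A.val_H B.val_H same_lead_def)
qed

lemma ExF_transfer:
  assumes A: "represents p r1 M1 H1 \<iota>1" and B: "represents p r2 M2 H2 \<iota>2"
    and IH: "\<And>e1 e2. same_lead T r1 r2 e1 e2 \<Longrightarrow>
      vf_sat M1 (H1 \<circ> e1) f1 g \<phi> \<Longrightarrow> vf_sat M2 (H2 \<circ> e2) f2 g \<phi>"
    and ext: "\<And>a. \<exists>b. same_lead T r1 r2 (e1(n := a)) (e2(n := b))"
    and sat: "vf_sat M1 (H1 \<circ> e1) f1 g (ExF n \<phi>)"
  shows "vf_sat M2 (H2 \<circ> e2) f2 g (ExF n \<phi>)"
proof -
  interpret A: represents p r1 M1 H1 \<iota>1 by fact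
  interpret B: represents p r2 M2 H2 \<iota>2 by fact
  obtain x where x: "x \<in> carrier (field_sort M1)" "vf_sat M1 ((H1 \<circ> e1)(n := x)) f1 g \<phi>"
    using sat by auto
  obtain a where "x = H1 a" using x(1) A.H_range by auto
  hence a: "vf_sat M1 (H1 \<circ> e1(n := a)) f1 g \<phi>" using x(2) by (simp add: fun_upd_comp)
  obtain b where "same_lead T r1 r2 (e1(n := a)) (e2(n := b))" using ext by blast
  hence "vf_sat M2 (H2 \<circ> e2(n := b)) f2 g \<phi>" using IH a by blast
  moreover have "H2 b \<in> carrier (field_sort M2)" using B.H_range by auto
  ultimately show ?thesis by (auto simp: fun_upd_comp)
qed

lemma ExK_sat: assumes "represents p rv M H \<iota>"
  shows "vf_sat M e (\<iota> \<circ> f) g (ExK n \<phi>) \<longleftrightarrow> (\<exists>a. vf_sat M e (\<iota> \<circ> f(n := a)) g \<phi>)"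
  by (simp add: represents.\<iota>_range[OF assms, symmetric] fun_upd_comp)

text \<open>The assignments f and g are common to both structures, so quantifiers over the residue
  field and the value group pass through unchanged. Only \<open>ExF\<close> calls for new terms,
  through \<open>same_lead_extend\<close>.\<close>

theorem vf_sat_uniform:
  "\<exists>N S. finite S \<and> (\<forall>p>N. \<forall>(r1 :: 'k::comm_ring_1 \<Rightarrow> lead) r2
      (M1 :: ('x, 'y, int with_infty) vf_structure) (M2 :: ('x, 'y, int with_infty) vf_structure)
      H1 H2 \<iota>1 \<iota>2 e1 e2 f g.
    represents p r1 M1 H1 \<iota>1 \<longrightarrow> represents p r2 M2 H2 \<iota>2 \<longrightarrow> same_lead S r1 r2 e1 e2 \<longrightarrow>
    vf_sat M1 (H1 \<circ> e1) (\<iota>1 \<circ> f) g \<phi> = vf_sat M2 (H2 \<circ> e2) (\<iota>2 \<circ> f) g \<phi>)"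
    (is "\<exists>N S. ?Q N S \<phi>")
proof (induction \<phi>)
  case (EqF s t)
  show ?case
  \<comment> \<open>Equality of s and t in the field is the vanishing of s - t, hence a property of
    its leading term.\<close>
  proof (intro exI[of _ 0] exI[of _ "{RAdd s (RNeg t)}"] conjI allI impI, goal_cases)
    case (2 p r1 r2 M1 M2 H1 H2 \<iota>1 \<iota>2 e1 e2 f g)
    show ?case using 2(4)
      by (simp only: vf_sat.simps represents.ring_eval_H[OF 2(2)] represents.ring_eval_H[OF 2(3)]
          represents.H_eq_iff[OF 2(2)] represents.H_eq_iff[OF 2(3)] same_lead_def) simp
  qed simp
next
  case (EqK s t)
  show ?case
  proof (intro exI[of _ 0] exI[of _ "res_terms s \<union> res_terms t"] conjI allI impI, goal_cases)
    case (2 p r1 r2 M1 M2 H1 H2 \<iota>1 \<iota>2 e1 e2 f g)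
    show ?case using 2(4)
      by (simp only: vf_sat.simps represents.res_eval_\<iota>[OF 2(2)] represents.res_eval_\<iota>[OF 2(3)]
          represents.\<iota>_eq_iff[OF 2(2)] represents.\<iota>_eq_iff[OF 2(3)] same_lead_Un
          res_int_same_lead[of _ r1 r2 e1 e2])
  qed (simp add: finite_res_terms)
next
  case (EqG s t)
  show ?case
  proof (intro exI[of _ 0] exI[of _ "grp_terms s \<union> grp_terms t"] conjI allI impI, goal_cases)
    case (2 p r1 r2 M1 M2 H1 H2 \<iota>1 \<iota>2 e1 e2 f g)
    show ?case using 2(4)
      by (simp only: vf_sat.simps same_lead_Un grp_eval_same_lead[OF 2(2,3), where ?e1.0 = e1 and ?e2.0 = e2])
  qed (simp add: finite_grp_terms)
next
  case (LessG s t)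
  show ?case
  proof (intro exI[of _ 0] exI[of _ "grp_terms s \<union> grp_terms t"] conjI allI impI, goal_cases)
    case (2 p r1 r2 M1 M2 H1 H2 \<iota>1 \<iota>2 e1 e2 f g)
    show ?case using 2(4)
      by (simp only: vf_sat.simps same_lead_Un grp_eval_same_lead[OF 2(2,3), where ?e1.0 = e1 and ?e2.0 = e2]
          represents.group_part[OF 2(2)] represents.group_part[OF 2(3)])
  qed (simp add: finite_grp_terms)
next
  case (NotV \<phi>)
  thus ?case by (simp only: vf_sat.simps not_iff) (simp only: simp_thms)
next
  case (AndV \<phi> \<psi>)
  then obtain N S N' S' where Q: "?Q N S \<phi>" "?Q N' S' \<psi>"
    by (elim exE) (rule that)
  show ?case
  proof (intro exI[of _ "max N N'"] exI[of _ "S \<union> S'"] conjI allI impI, goal_cases)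
    case (2 p r1 r2 M1 M2 H1 H2 \<iota>1 \<iota>2 e1 e2 f g)
    have p: "N < p" "N' < p" and S: "same_lead S r1 r2 e1 e2" "same_lead S' r1 r2 e1 e2"
      using 2(1,4) by (auto simp: same_lead_Un)
    show ?case
      unfolding vf_sat.simps Q(1)[THEN conjunct2, rule_format, OF p(1) 2(2,3) S(1)]
        Q(2)[THEN conjunct2, rule_format, OF p(2) 2(2,3) S(2)] ..
  qed (simp add: Q[THEN conjunct1])
next
  case (ExF n \<phi>)
  then obtain N T where T: "?Q N T \<phi>" by (elim exE) (rule that)
  from same_lead_extend[OF T[THEN conjunct1], where 'k = 'k and n = n]
  obtain N' S where S: "finite S" "\<forall>p>N'. \<forall>(r1 :: 'k \<Rightarrow> lead) r2 e1 e2.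
      lead_ring p r1 \<longrightarrow> lead_ring p r2 \<longrightarrow> same_lead S r1 r2 e1 e2 \<longrightarrow>
      (\<forall>a. \<exists>b. same_lead T r1 r2 (e1(n := a)) (e2(n := b)))"
    by (elim exE conjE) (rule that)
  have imp: "vf_sat M2 (H2 \<circ> e2) (\<iota>2 \<circ> f) g (ExF n \<phi>)"
    if p: "max N N' < p" and M: "represents p r1 M1 H1 \<iota>1" "represents p r2 M2 H2 \<iota>2"
      and same: "same_lead S r1 r2 e1 e2" and sat: "vf_sat M1 (H1 \<circ> e1) (\<iota>1 \<circ> f) g (ExF n \<phi>)"
    for p and r1 r2 :: "'k \<Rightarrow> lead" and M1 M2 :: "('x, 'y, int with_infty) vf_structure"
      and H1 H2 \<iota>1 \<iota>2 e1 e2 f g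
  proof (rule ExF_transfer[OF M _ _ sat])
    show "\<exists>b. same_lead T r1 r2 (e1(n := a)) (e2(n := b))" for a
      by (rule S(2)[rule_format]) (use p same represents.axioms(1)[OF M(1)] represents.axioms(1)[OF M(2)] in auto)
    show "vf_sat M2 (H2 \<circ> e2) (\<iota>2 \<circ> f) g \<phi>"
      if "same_lead T r1 r2 e1 e2" "vf_sat M1 (H1 \<circ> e1) (\<iota>1 \<circ> f) g \<phi>" for e1 e2
    proof -
      have "N < p" using p by simp
      from T[THEN conjunct2, rule_format, OF this M that(1)] show ?thesis using that(2) by (rule iffD1)
    qed
  qed
  show ?case
  proof (intro exI[of _ "max N N'"] exI[of _ S] conjI allI impI, goal_cases)
    case (2 p r1 r2 M1 M2 H1 H2 \<iota>1 \<iota>2 e1 e2 f g)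
    show ?case
      \<comment> \<open>The converse follows by exchanging the two structures, as N and S are chosen
        for all pairs.\<close>
      using imp[OF 2(1,2,3,4)] imp[OF 2(1,3,2) same_lead_sym[OF 2(4)]] by blast
  qed (rule S(1))
next
  case (ExK n \<phi>)
  then obtain N S where S: "?Q N S \<phi>" by (elim exE) (rule that)
  show ?case
  proof (intro exI[of _ N] exI[of _ S] conjI allI impI, goal_cases)
    case (2 p r1 r2 M1 M2 H1 H2 \<iota>1 \<iota>2 e1 e2 f g)
    show ?case
      unfolding ExK_sat[OF 2(2)] ExK_sat[OF 2(3)] S[THEN conjunct2, rule_format, OF 2] ..
  qed (rule S[THEN conjunct1])
next
  case (ExG n \<phi>)
  then obtain N S where S: "?Q N S \<phi>" by (elim exE) (rule that)
  show ?case
  proof (intro exI[of _ N] exI[of _ S] conjI allI impI, goal_cases)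
    case (2 p r1 r2 M1 M2 H1 H2 \<iota>1 \<iota>2 e1 e2 f g)
    show ?case
      unfolding vf_sat.simps represents.group_part(1)[OF 2(2)] represents.group_part(1)[OF 2(3)]
        S[THEN conjunct2, rule_format, OF 2] ..
  qed (rule S[THEN conjunct1])
qed

section \<open>Quotients of the ring of integral Laurent series\<close>

definition Xpow :: "int \<Rightarrow> int fls" where
  "Xpow n = fls_X_intpow n"

abbreviation emb :: "int fps \<Rightarrow> int fls" where
  "emb \<equiv> fps_to_fls"

lemma Xpow_add: "Xpow (m + n) = Xpow m * Xpow n"
  by (simp add: Xpow_def fls_X_intpow_times_fls_X_intpow)

lemma Xpow_0 [simp]: "Xpow 0 = 1"
  by (simp add: Xpow_def)

lemma Xpow_of_nat: "Xpow (int n) = emb (fps_X ^ n)"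
  by (simp add: Xpow_def fps_to_fls_power fls_X_power_conv_shift_1)

lemma Xpow_mult_emb: "Xpow (m + int n) * emb g = Xpow m * emb (fps_X ^ n * g)"
  by (simp add: Xpow_add Xpow_of_nat fls_times_fps_to_fls mult.assoc)

lemma fls_eq_Xpow_emb: assumes "- int n \<le> fls_subdegree F" shows "\<exists>g. F = Xpow (- int n) * emb g"
proof -
  obtain g where "F = fls_shift (int n) (emb g)"
    using fls_as_fps'[of F "int n"] assms by auto
  moreover have "Xpow (- int n) * emb g = fls_shift (int n) (emb g)"
    using fls_X_intpow_times_conv_shift(1)[of "- int n" "emb g"] by (simp add: Xpow_def)
  ultimately show ?thesis by metis
qed

lemma fls_Xpow_embE: obtains n g where "F = Xpow (- int n) * emb g"
proof -
  have "- int (nat (- fls_subdegree F)) \<le> fls_subdegree F" by simp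
  from fls_eq_Xpow_emb[OF this] that show ?thesis by blast
qed

text \<open>What the ideals generated by p - X and by p have in common: modulo I, the prime p is a
  multiple of X, X is no zero divisor, and the X-adic topology is separated. Then the quotient is a
  complete discrete valuation ring with uniformizer X and residue field of p elements.\<close>

locale quot_ideal =
  fixes p :: nat and I :: "int fps set"
  assumes prime_p: "prime p"
    and I_0: "0 \<in> I"
    and I_add: "f \<in> I \<Longrightarrow> g \<in> I \<Longrightarrow> f + g \<in> I"
    and I_mult: "f \<in> I \<Longrightarrow> g * f \<in> I"
    and I_const: "f \<in> I \<Longrightarrow> int p dvd f $ 0"
    and I_p: "\<exists>g. fps_const (int p) - fps_X * g \<in> I"
    and I_X: "fps_X * f \<in> I \<Longrightarrow> f \<in> I"
    and I_sep: "(\<And>n. \<exists>g. f - fps_X ^ n * g \<in> I) \<Longrightarrow> f \<in> I"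
begin

lemma I_minus: "f \<in> I \<Longrightarrow> - f \<in> I"
  using I_mult[of f "- 1"] by simp

lemma I_diff: "f \<in> I \<Longrightarrow> g \<in> I \<Longrightarrow> f - g \<in> I"
  using I_add[of f "- g"] I_minus by simp

lemma I_X_power: "fps_X ^ n * f \<in> I \<longleftrightarrow> f \<in> I"
proof (induction n)
  case (Suc n)
  have "fps_X ^ Suc n * f \<in> I \<longleftrightarrow> fps_X ^ n * f \<in> I"
    using I_X[of "fps_X ^ n * f"] I_mult[of "fps_X ^ n * f" fps_X] by (auto simp: mult.assoc)
  thus ?case using Suc by simp
qed simp

lemma I_shift:
  assumes "int p dvd f $ 0" shows "\<exists>g. f - fps_X * g \<in> I"
proof -
  obtain m where m: "f $ 0 = int p * m" using assms by auto
  obtain g where g: "fps_const (int p) - fps_X * g \<in> I" using I_p by blast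
  have "f = fps_const (f $ 0) + fps_X * fps_shift 1 f"
    by (rule fps_ext) (auto simp: fps_X_mult_nth)
  hence "f - fps_X * (fps_const m * g + fps_shift 1 f) = fps_const m * (fps_const (int p) - fps_X * g)"
    unfolding m by (simp add: algebra_simps fps_const_mult[symmetric] del: fps_const_mult)
  thus ?thesis using I_mult[OF g, of "fps_const m"] by metis
qed

text \<open>The ideal that I generates in the Laurent series.\<close>

definition J :: "int fls set" where
  "J = {Xpow n * emb g | n g. g \<in> I}"

text \<open>Powers of X can be cancelled modulo I, so J meets the power series in I only.\<close>

lemma Xpow_emb_in_J_iff: "Xpow n * emb g \<in> J \<longleftrightarrow> g \<in> I"
proof
  assume "Xpow n * emb g \<in> J"
  then obtain m h where h: "Xpow n * emb g = Xpow m * emb h" "h \<in> I" by (auto simp: J_def)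
  have cancel: "Xpow k * F = Xpow k * G \<Longrightarrow> F = G" for k F G by (simp add: Xpow_def)
  show "g \<in> I"
  proof (cases "n \<le> m")
    case True
    have "Xpow m * emb h = Xpow n * emb (fps_X ^ nat (m - n) * h)"
      using Xpow_mult_emb[of n "nat (m - n)" h] True by simp
    hence "emb g = emb (fps_X ^ nat (m - n) * h)" using h(1) cancel by metis
    hence "g = fps_X ^ nat (m - n) * h" by simp
    thus ?thesis using I_mult h(2) by simp
  next
    case False
    have "Xpow n * emb g = Xpow m * emb (fps_X ^ nat (n - m) * g)"
      using Xpow_mult_emb[of m "nat (n - m)" g] False by simp
    hence "emb (fps_X ^ nat (n - m) * g) = emb h" using h(1) cancel by metis
    hence "fps_X ^ nat (n - m) * g = h" by simp
    thus ?thesis using I_X_power h(2) by metis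
  qed
qed (auto simp: J_def)

lemma emb_in_J_iff: "emb g \<in> J \<longleftrightarrow> g \<in> I"
  using Xpow_emb_in_J_iff[of 0 g] by simp

lemma J_mult: assumes "F \<in> J" shows "G * F \<in> J"
proof -
  obtain n g where F: "F = Xpow n * emb g" "g \<in> I" using assms by (auto simp: J_def)
  obtain m h where G: "G = Xpow m * emb h" by (rule fls_Xpow_embE)
  have "G * F = Xpow (m + n) * emb (h * g)"
    by (simp add: F G Xpow_add fls_times_fps_to_fls algebra_simps)
  thus ?thesis using Xpow_emb_in_J_iff I_mult F(2) by metis
qed

lemma J_add: assumes "F \<in> J" "G \<in> J" shows "F + G \<in> J"
proof -
  obtain n g m h where F: "F = Xpow n * emb g" "g \<in> I" and G: "G = Xpow m * emb h" "h \<in> I"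
    using assms by (auto simp: J_def)
  define l where "l = min n m"
  have "F = Xpow l * emb (fps_X ^ nat (n - l) * g)" "G = Xpow l * emb (fps_X ^ nat (m - l) * h)"
    using Xpow_mult_emb[of l "nat (n - l)" g] Xpow_mult_emb[of l "nat (m - l)" h]
    by (simp_all add: F G l_def)
  hence "F + G = Xpow l * emb (fps_X ^ nat (n - l) * g + fps_X ^ nat (m - l) * h)"
    by (simp add: distrib_left)
  thus ?thesis using Xpow_emb_in_J_iff I_mult I_add F(2) G(2) by metis
qed

lemma J_0: "0 \<in> J"
  using emb_in_J_iff[of 0] I_0 by simp

lemma J_minus: "F \<in> J \<Longrightarrow> - F \<in> J"
  using J_mult[of F "- 1"] by simp

lemma J_diff: "F \<in> J \<Longrightarrow> G \<in> J \<Longrightarrow> F - G \<in> J"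
  using J_add[of F "- G"] J_minus by simp

lemma digit_unique:
  assumes "F - Xpow \<gamma> * emb g \<in> J" "F - Xpow \<gamma> * emb h \<in> J"
  shows "g $ 0 mod int p = h $ 0 mod int p"
proof -
  have "Xpow \<gamma> * emb (g - h) \<in> J" using J_diff[OF assms(2,1)] by (simp add: algebra_simps)
  hence "int p dvd (g - h) $ 0" using Xpow_emb_in_J_iff I_const by blast
  thus ?thesis by (simp add: mod_eq_dvd_iff)
qed

lemma digit_below:
  assumes "F - Xpow \<gamma> * emb g \<in> J" "F - Xpow \<delta> * emb h \<in> J" "\<gamma> < \<delta>"
  shows "int p dvd g $ 0"
proof -
  have "F - Xpow \<gamma> * emb (fps_X ^ nat (\<delta> - \<gamma>) * h) \<in> J"
    using assms Xpow_mult_emb[of \<gamma> "nat (\<delta> - \<gamma>)" h] by simp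
  from digit_unique[OF assms(1) this] show ?thesis using assms(3) by (simp add: fps_X_power_mult_nth dvd_eq_mod_eq_0)
qed

text \<open>Modulo J, an element outside J is a power of X times a series whose constant coefficient
  is prime to p. Exponent and residue class are unique by \<open>digit_below\<close> and
  \<open>digit_unique\<close>, so the choice operator picks the only candidate.\<close>

definition rv :: "int fls \<Rightarrow> lead" where
  "rv F = (if \<exists>\<gamma> g. F - Xpow \<gamma> * emb g \<in> J \<and> \<not> int p dvd g $ 0
     then Some (SOME (\<gamma>, a). \<exists>g. F - Xpow \<gamma> * emb g \<in> J \<and> \<not> int p dvd g $ 0 \<and> a = g $ 0 mod int p)
     else None)"

lemma rv_SomeI:
  assumes "F - Xpow \<gamma> * emb g \<in> J" "\<not> int p dvd g $ 0"
  shows "rv F = Some (\<gamma>, g $ 0 mod int p)"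
proof -
  have "(SOME (\<gamma>, a). \<exists>g. F - Xpow \<gamma> * emb g \<in> J \<and> \<not> int p dvd g $ 0 \<and> a = g $ 0 mod int p) =
      (\<gamma>, g $ 0 mod int p)"
  proof (rule some_equality)
    show "case (\<gamma>, g $ 0 mod int p) of (\<gamma>, a) \<Rightarrow>
        \<exists>g. F - Xpow \<gamma> * emb g \<in> J \<and> \<not> int p dvd g $ 0 \<and> a = g $ 0 mod int p"
      using assms by auto
  next
    fix \<delta>a assume "case \<delta>a of (\<gamma>, a) \<Rightarrow>
        \<exists>g. F - Xpow \<gamma> * emb g \<in> J \<and> \<not> int p dvd g $ 0 \<and> a = g $ 0 mod int p"
    then obtain \<delta> h where h: "\<delta>a = (\<delta>, h $ 0 mod int p)" "F - Xpow \<delta> * emb h \<in> J" "\<not> int p dvd h $ 0"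
      by auto
    have "\<delta> = \<gamma>" using digit_below[OF assms(1) h(2)] digit_below[OF h(2) assms(1)] assms(2) h(3)
      by (meson linorder_neqE_linordered_idom)
    thus "\<delta>a = (\<gamma>, g $ 0 mod int p)" using digit_unique[OF assms(1)] h by auto
  qed
  thus ?thesis using assms unfolding rv_def by auto
qed

text \<open>Without a leading term a further factor X can be split off modulo I again and again by
  \<open>I_shift\<close>, and \<open>I_sep\<close> applies.\<close>

lemma rv_eq_None_iff: "rv F = None \<longleftrightarrow> F \<in> J"
proof
  assume F: "F \<in> J"
  have "int p dvd g $ 0" if "F - Xpow \<gamma> * emb g \<in> J" for \<gamma> g
  proof -
    have "Xpow \<gamma> * emb g \<in> J" using J_diff[OF F that] by simp
    thus ?thesis using Xpow_emb_in_J_iff I_const by blast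
  qed
  thus "rv F = None" by (auto simp: rv_def)
next
  assume None: "rv F = None"
  obtain n g where F: "F = Xpow n * emb g" by (rule fls_Xpow_embE)
  have "\<exists>h. g - fps_X ^ m * h \<in> I" for m
  proof (induction m)
    case 0
    show ?case by (rule exI[of _ g]) (simp add: I_0)
  next
    case (Suc m)
    then obtain h where h: "g - fps_X ^ m * h \<in> I" by blast
    have "F - Xpow (n + int m) * emb h = Xpow n * emb (g - fps_X ^ m * h)"
      unfolding F Xpow_mult_emb by (simp add: algebra_simps)
    hence "F - Xpow (n + int m) * emb h \<in> J" using h Xpow_emb_in_J_iff by metis
    hence "int p dvd h $ 0" using rv_SomeI None by (metis option.distinct(1))
    then obtain h' where "h - fps_X * h' \<in> I" using I_shift by blast
    hence "(g - fps_X ^ m * h) + fps_X ^ m * (h - fps_X * h') \<in> I" using h I_add I_mult by blast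
    thus ?case by (intro exI[of _ h']) (simp add: algebra_simps)
  qed
  hence "g \<in> I" by (rule I_sep)
  thus "F \<in> J" by (simp add: F Xpow_emb_in_J_iff)
qed

lemma rv_SomeD:
  assumes "rv F = Some (\<gamma>, a)"
  obtains g where "F - Xpow \<gamma> * emb g \<in> J" "\<not> int p dvd g $ 0" "a = g $ 0 mod int p"
proof -
  obtain \<delta> g where g: "F - Xpow \<delta> * emb g \<in> J" "\<not> int p dvd g $ 0"
    using assms unfolding rv_def by (auto split: if_splits)
  from rv_SomeI[OF this] g that[of g] show ?thesis using assms by simp
qed

lemma val_ge_iff: "val_ge rv \<gamma> F \<longleftrightarrow> (\<exists>g. F - Xpow \<gamma> * emb g \<in> J)"
  and digit_eq: "F - Xpow \<gamma> * emb g \<in> J \<Longrightarrow> digit rv \<gamma> F = g $ 0 mod int p"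
proof -
  have "(val_ge rv \<gamma> F \<longleftrightarrow> (\<exists>g. F - Xpow \<gamma> * emb g \<in> J)) \<and>
      (\<forall>g. F - Xpow \<gamma> * emb g \<in> J \<longrightarrow> digit rv \<gamma> F = g $ 0 mod int p)"
  proof (cases "rv F")
    case None
    hence F: "F \<in> J" using rv_eq_None_iff by blast
    have "F - Xpow \<gamma> * emb 0 \<in> J" using F by simp
    moreover from this have "g $ 0 mod int p = 0" if "F - Xpow \<gamma> * emb g \<in> J" for g
      using digit_unique[OF that] by fastforce
    ultimately show ?thesis using None unfolding val_ge_def digit_def by (auto intro: exI[of _ 0])
  next
    case (Some \<delta>a)
    then obtain \<delta> a where Some: "rv F = Some (\<delta>, a)" by (cases \<delta>a) auto
    then obtain h where h: "F - Xpow \<delta> * emb h \<in> J" "\<not> int p dvd h $ 0" "a = h $ 0 mod int p"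
      by (rule rv_SomeD)
    consider "\<gamma> = \<delta>" | "\<gamma> < \<delta>" | "\<gamma> > \<delta>" by linarith
    thus ?thesis
    proof cases
      case 1
      have "val_ge rv \<gamma> F" "digit rv \<gamma> F = a" using Some 1 by (simp_all add: val_ge_def digit_def)
      moreover have "g $ 0 mod int p = a" if "F - Xpow \<gamma> * emb g \<in> J" for g
        using digit_unique[OF that] h 1 by simp
      moreover have "\<exists>g. F - Xpow \<gamma> * emb g \<in> J" using h(1) 1 by blast
      ultimately show ?thesis by simp
    next
      case 2
      have "F - Xpow \<gamma> * emb (fps_X ^ nat (\<delta> - \<gamma>) * h) \<in> J"
        using h(1) Xpow_mult_emb[of \<gamma> "nat (\<delta> - \<gamma>)" h] 2 by simp
      moreover have "g $ 0 mod int p = 0" if "F - Xpow \<gamma> * emb g \<in> J" for g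
        using digit_below[OF that h(1) 2] by simp
      moreover have "val_ge rv \<gamma> F" "digit rv \<gamma> F = 0"
        using Some 2 by (simp_all add: val_ge_def digit_def)
      ultimately show ?thesis by auto
    next
      case 3
      hence "\<not> val_ge rv \<gamma> F" using Some by (simp add: val_ge_def)
      moreover have "F - Xpow \<gamma> * emb g \<notin> J" for g using digit_below[OF h(1) _ 3] h(2) by blast
      ultimately show ?thesis by blast
    qed
  qed
  thus "val_ge rv \<gamma> F \<longleftrightarrow> (\<exists>g. F - Xpow \<gamma> * emb g \<in> J)"
    and "F - Xpow \<gamma> * emb g \<in> J \<Longrightarrow> digit rv \<gamma> F = g $ 0 mod int p" by blast+
qed

lemma complete_rv:
  assumes step: "\<And>n. val_ge rv (int n) (S (Suc n) - S n)" and "val_ge rv 0 (S 0)"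
  shows "\<exists>s. \<forall>n. val_ge rv (int n) (s - S n)"
proof -
  obtain g0 where g0: "S 0 - emb g0 \<in> J" using assms(2) unfolding val_ge_iff by auto
  have "\<forall>n. \<exists>g. S (Suc n) - S n - Xpow (int n) * emb g \<in> J" using step val_ge_iff by blast
  then obtain g where g: "\<And>n. S (Suc n) - S n - Xpow (int n) * emb (g n) \<in> J" by metis
  \<comment> \<open>The tail of the series of all steps, divided by X^n: r n is the sum of X^i * g
    (n + i) over all i, and only finitely many summands contribute to each coefficient.\<close>
  define r where "r n = Abs_fps (\<lambda>k. \<Sum>i\<le>k. g (n + i) $ (k - i))" for n
  have r: "r n = g n + fps_X * r (Suc n)" for n
  proof (rule fps_ext)
    fix k show "r n $ k = (g n + fps_X * r (Suc n)) $ k"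
      by (cases k) (simp_all add: r_def sum.atMost_Suc_shift del: sum.atMost_Suc)
  qed
  define s where "s = emb (g0 + r 0)"
  have "s - S n - Xpow (int n) * emb (r n) \<in> J" for n
  proof (induction n)
    case 0
    have e: "s - S 0 - Xpow (int 0) * emb (r 0) = - (S 0 - emb g0)" by (simp add: s_def)
    show ?case unfolding e by (rule J_minus[OF g0])
  next
    case (Suc n)
    have "Xpow (int n) * emb (r n) = Xpow (int n) * emb (g n) + Xpow (int (Suc n)) * emb (r (Suc n))"
      using Xpow_mult_emb[of "int n" 1 "r (Suc n)"] by (subst r) (simp add: algebra_simps)
    hence "s - S (Suc n) - Xpow (int (Suc n)) * emb (r (Suc n)) =
        (s - S n - Xpow (int n) * emb (r n)) - (S (Suc n) - S n - Xpow (int n) * emb (g n))"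
      by (simp add: algebra_simps)
    thus ?case using J_diff[OF Suc g] by metis
  qed
  thus ?thesis using val_ge_iff by blast
qed

sublocale lead_ring p rv
proof
  show "prime p" by (rule prime_p)
  have p1: "1 < int p" using prime_gt_1_nat[OF prime_p] by simp
  show "0 < a \<and> a < int p" if Fa: "rv F = Some (\<gamma>, a)" for F \<gamma> a
  proof -
    obtain g where "\<not> int p dvd g $ 0" "a = g $ 0 mod int p" using Fa by (rule rv_SomeD)
    thus ?thesis using p1 pos_mod_bound[of "int p" "g $ 0"] pos_mod_sign[of "int p" "g $ 0"]
      by (simp add: dvd_eq_mod_eq_0 order_less_le)
  qed
  show "rv 0 = None" using J_0 rv_eq_None_iff by blast
  show "rv 1 = Some (0, 1)" using rv_SomeI[of 1 0 1] p1 by (simp add: J_0 zmod_trivial_iff)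
  show "rv (F * G) = lead_mult p (rv F) (rv G)" for F G
  proof (cases "rv F = None \<or> rv G = None")
    case True
    hence "F * G \<in> J" using J_mult[of F G] J_mult[of G F] rv_eq_None_iff by (auto simp: mult.commute)
    hence "rv (F * G) = None" using rv_eq_None_iff by blast
    thus ?thesis using True by (cases "rv F"; cases "rv G") auto
  next
    case False
    then obtain \<gamma> a \<delta> b where ab: "rv F = Some (\<gamma>, a)" "rv G = Some (\<delta>, b)" by auto
    obtain g where g: "F - Xpow \<gamma> * emb g \<in> J" "\<not> int p dvd g $ 0" "a = g $ 0 mod int p"
      using ab(1) by (rule rv_SomeD)
    obtain h where h: "G - Xpow \<delta> * emb h \<in> J" "\<not> int p dvd h $ 0" "b = h $ 0 mod int p"
      using ab(2) by (rule rv_SomeD)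
    have "F * G - Xpow (\<gamma> + \<delta>) * emb (g * h) =
        F * (G - Xpow \<delta> * emb h) + (Xpow \<delta> * emb h) * (F - Xpow \<gamma> * emb g)"
      by (simp add: Xpow_add fls_times_fps_to_fls algebra_simps)
    also have "\<dots> \<in> J" by (intro J_add J_mult g h)
    finally have "F * G - Xpow (\<gamma> + \<delta>) * emb (g * h) \<in> J" .
    moreover have "\<not> int p dvd (g * h) $ 0"
      using g(2) h(2) prime_p by (simp add: fps_mult_nth prime_dvd_mult_iff)
    ultimately have "rv (F * G) = Some (\<gamma> + \<delta>, (g * h) $ 0 mod int p)" by (rule rv_SomeI)
    thus ?thesis using ab g(3) h(3) by (simp add: fps_mult_nth mod_mult_eq)
  qed
  have add: "val_ge rv \<gamma> (F + G) \<and> digit rv \<gamma> (F + G) = (digit rv \<gamma> F + digit rv \<gamma> G) mod int p"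
    if FG: "val_ge rv \<gamma> F" "val_ge rv \<gamma> G" for \<gamma> F G
  proof -
    obtain g h where gh: "F - Xpow \<gamma> * emb g \<in> J" "G - Xpow \<gamma> * emb h \<in> J"
      using FG val_ge_iff by blast
    have e: "F + G - Xpow \<gamma> * emb (g + h) = (F - Xpow \<gamma> * emb g) + (G - Xpow \<gamma> * emb h)"
      by (simp add: algebra_simps)
    have "F + G - Xpow \<gamma> * emb (g + h) \<in> J" unfolding e by (intro J_add gh)
    hence "val_ge rv \<gamma> (F + G)" "digit rv \<gamma> (F + G) = (g + h) $ 0 mod int p"
      using val_ge_iff digit_eq by blast+
    thus ?thesis by (simp add: digit_eq[OF gh(1)] digit_eq[OF gh(2)] mod_add_eq)
  qed
  show "val_ge rv \<gamma> (F + G)" if "val_ge rv \<gamma> F" "val_ge rv \<gamma> G" for \<gamma> F G using add[OF that] ..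
  show "digit rv \<gamma> (F + G) = (digit rv \<gamma> F + digit rv \<gamma> G) mod int p"
    if "val_ge rv \<gamma> F" "val_ge rv \<gamma> G" for \<gamma> F G using add[OF that] ..
  show "\<exists>F. rv F = Some (\<gamma>, a)" if a: "0 < a" "a < int p" for a \<gamma>
  proof
    have "\<not> int p dvd fps_const a $ 0" using a by (simp add: zdvd_not_zless)
    moreover have "Xpow \<gamma> * emb (fps_const a) - Xpow \<gamma> * emb (fps_const a) \<in> J" using J_0 by simp
    ultimately show "rv (Xpow \<gamma> * emb (fps_const a)) = Some (\<gamma>, a)" using rv_SomeI a by fastforce
  qed
  show "\<exists>s. \<forall>n. val_ge rv (int n) (s - X n)"
    if "\<And>n. val_ge rv (int n) (X (Suc n) - X n)" "val_ge rv 0 (X 0)" for X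
    by (rule complete_rv[OF that])
qed

end

section \<open>Fraction fields as quotients of the integral Laurent series\<close>

text \<open>Ring laws are inherited along a surjection, and negation is preserved because additive
  inverses are unique.\<close>

lemma cring_of_surj:
  fixes h :: "'a::comm_ring_1 \<Rightarrow> 'r" and R (structure)
  assumes range: "range h = carrier R" and h: "h 0 = \<zero>" "h 1 = \<one>"
    "\<And>x y. h (x + y) = h x \<oplus> h y" "\<And>x y. h (x * y) = h x \<otimes> h y"
  shows "cring R" and "h (- x) = \<ominus> h x"
proof -
  have zero: "\<zero> = h 0" and one: "\<one> = h 1" using h by auto
  note simps = range[symmetric] zero one h(3,4)[symmetric]
  show R: "cring R"
  proof (intro cringI abelian_groupI comm_monoidI)
    fix x assume "x \<in> carrier R"
    then obtain a where "x = h a" by (auto simp: simps)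
    thus "\<exists>y\<in>carrier R. y \<oplus> x = \<zero>" by (intro bexI[of _ "h (- a)"]) (auto simp: simps)
  qed (auto simp: simps algebra_simps)
  interpret cring R by (rule R)
  have c: "h y \<in> carrier R" for y using range by auto
  have "h (- x) \<oplus> h x = \<zero>" by (simp add: simps)
  thus "h (- x) = \<ominus> h x" using c minus_equality by metis
qed

lemma UN_const_eq: "A \<noteq> {} \<Longrightarrow> (\<And>x. x \<in> A \<Longrightarrow> f x = B) \<Longrightarrow> (\<Union>x\<in>A. f x) = B"
  by auto

text \<open>R is presented as integral power series modulo I, so that fractions over R can be
  handled by congruences between series.\<close>

locale fraction_rep = quot_ideal +
  fixes R :: "'r ring" (structure) and h :: "int fps \<Rightarrow> 'r"
  assumes h_range: "range h = carrier R" and h_0: "h 0 = \<zero>" and h_1: "h 1 = \<one>"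
    and h_add: "h (f + g) = h f \<oplus> h g" and h_mult: "h (f * g) = h f \<otimes> h g"
    and h_eq_iff: "h f = h g \<longleftrightarrow> f - g \<in> I"
begin

sublocale R: cring R
  by (rule cring_of_surj(1)[OF h_range h_0 h_1 h_add h_mult])

abbreviation K where "K \<equiv> fraction_field R"
abbreviation val where "val \<equiv> adic_valuation R (h fps_X)"

lemma h_minus: "h (- f) = \<ominus> h f"
  by (rule cring_of_surj(2)[OF h_range h_0 h_1 h_add h_mult])

lemma h_closed [simp]: "h f \<in> carrier R"
  using h_range by auto

lemma I_iff: "f \<in> I \<longleftrightarrow> rv (emb f) = None"
  by (simp add: rv_eq_None_iff emb_in_J_iff)

text \<open>A product of two elements with leading terms has a leading term.\<close>

lemma I_prime: "f * g \<in> I \<longleftrightarrow> f \<in> I \<or> g \<in> I"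
  unfolding I_iff fls_times_fps_to_fls using lead_mult_eq_None rv_mult_None by blast

lemma one_notin_I: "1 \<notin> I"
  using I_const[of 1] p_gt_1 by (auto simp: zdvd_not_zless)

lemma X_power_notin_I: "fps_X ^ n \<notin> I"
  using I_X_power[of n 1] one_notin_I by simp

definition fr :: "int fps \<Rightarrow> int fps \<Rightarrow> ('r \<times> 'r) set" where
  "fr a b = frac_rel R `` {(h a, h b)}"

lemma h_eq_0_iff: "h b = \<zero> \<longleftrightarrow> b \<in> I"
  using h_eq_iff[of b 0] h_0 by simp

lemma frac_rel_iff: "((h a, h b), (h c, h d)) \<in> frac_rel R \<longleftrightarrow> b \<notin> I \<and> d \<notin> I \<and> a * d - c * b \<in> I"
  by (simp add: frac_rel_def h_eq_0_iff h_mult[symmetric] h_eq_iff)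

lemma fr_memD: "q \<in> fr a b \<Longrightarrow> \<exists>c d. q = (h c, h d) \<and> d \<notin> I \<and> a * d - c * b \<in> I"
proof -
  assume q: "q \<in> fr a b"
  hence "fst q \<in> carrier R" "snd q \<in> carrier R" by (auto simp: fr_def frac_rel_def)
  then obtain c d where "q = (h c, h d)" using h_range by (metis prod.collapse imageE)
  thus ?thesis using q frac_rel_iff[of a b c d] by (auto simp: fr_def)
qed

lemma fr_memI: "b \<notin> I \<Longrightarrow> d \<notin> I \<Longrightarrow> a * d - c * b \<in> I \<Longrightarrow> (h c, h d) \<in> fr a b"
  using frac_rel_iff by (simp add: fr_def)

lemma fr_subset:
  assumes "b \<notin> I" "d \<notin> I" "a * d - c * b \<in> I" shows "fr c d \<subseteq> fr a b"
proof
  fix q assume "q \<in> fr c d"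
  then obtain e f where q: "q = (h e, h f)" "f \<notin> I" "c * f - e * d \<in> I" using fr_memD by blast
  have "d * (a * f - e * b) = f * (a * d - c * b) + b * (c * f - e * d)" by (simp add: algebra_simps)
  also have "\<dots> \<in> I" by (intro I_add I_mult assms q)
  finally have "a * f - e * b \<in> I" using I_prime assms(2) by blast
  thus "q \<in> fr a b" using q(1,2) assms(1) fr_memI by simp
qed

lemma fr_eq_iff:
  assumes "b \<notin> I" "d \<notin> I" shows "fr a b = fr c d \<longleftrightarrow> a * d - c * b \<in> I"
proof
  assume "fr a b = fr c d"
  moreover have "(h c, h d) \<in> fr c d" using assms I_0 by (intro fr_memI) auto
  ultimately have "(h c, h d) \<in> fr a b" by simp
  hence "((h a, h b), (h c, h d)) \<in> frac_rel R" by (simp add: fr_def)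
  thus "a * d - c * b \<in> I" using frac_rel_iff by blast
next
  assume *: "a * d - c * b \<in> I"
  have "c * b - a * d \<in> I" using I_minus[OF *] by simp
  thus "fr a b = fr c d" using fr_subset assms * by blast
qed

lemma fr_nonempty: "b \<notin> I \<Longrightarrow> fr a b \<noteq> {}"
  using fr_memI[of b b a a] I_0 by auto

lemma fr_memE:
  assumes "q \<in> fr a b" "b \<notin> I"
  obtains c d where "q = (h c, h d)" "d \<notin> I" "fr c d = fr a b"
proof -
  obtain c d where *: "q = (h c, h d)" "d \<notin> I" "a * d - c * b \<in> I" using fr_memD[OF assms(1)] by blast
  thus ?thesis using that[of c d] fr_eq_iff[OF assms(2) *(2), of a c] by simp
qed

lemma K_carrier: "carrier K = {fr a b | a b. b \<notin> I}"
proof -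
  have "carrier K = (\<lambda>q. frac_rel R `` {q}) ` (carrier R \<times> (carrier R - {\<zero>}))"
    by (auto simp: fraction_field_def quotient_def)
  also have "carrier R \<times> (carrier R - {\<zero>}) = {(h a, h b) | a b. b \<notin> I}"
    by (auto simp: h_range[symmetric] h_eq_0_iff[symmetric])
  finally show ?thesis by (auto simp: fr_def)
qed

lemma K_one: "\<one>\<^bsub>K\<^esub> = fr 1 1" and K_zero: "\<zero>\<^bsub>K\<^esub> = fr 0 1"
  by (simp_all add: fraction_field_def fr_def h_1 h_0)

lemma K_mult:
  assumes b: "b \<notin> I" and d: "d \<notin> I"
  shows "fr a b \<otimes>\<^bsub>K\<^esub> fr c d = fr (a * c) (b * d)"
proof -
  have "(case q of (x, y) \<Rightarrow> \<Union>(x', y')\<in>fr c d. frac_rel R `` {(x \<otimes> x', y \<otimes> y')}) = fr (a * c) (b * d)"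
    if "q \<in> fr a b" for q
  proof -
    obtain a' b' where q: "q = (h a', h b')" "b' \<notin> I" "fr a' b' = fr a b"
      using fr_memE[OF \<open>q \<in> fr a b\<close> b] by blast
    have "(case q' of (x', y') \<Rightarrow> frac_rel R `` {(h a' \<otimes> x', h b' \<otimes> y')}) = fr (a * c) (b * d)"
      if "q' \<in> fr c d" for q'
    proof -
      obtain c' d' where q': "q' = (h c', h d')" "d' \<notin> I" "fr c' d' = fr c d"
        using fr_memE[OF \<open>q' \<in> fr c d\<close> d] by blast
      have 1: "a' * b - a * b' \<in> I" "c' * d - c * d' \<in> I"
        using q q' fr_eq_iff b d by blast+
      have "(a' * c') * (b * d) - (a * c) * (b' * d') =
          c' * d * (a' * b - a * b') + a * b' * (c' * d - c * d')" by (simp add: algebra_simps)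
      also have "\<dots> \<in> I" by (intro I_add I_mult 1)
      finally have "fr (a' * c') (b' * d') = fr (a * c) (b * d)"
        using fr_eq_iff I_prime b d q(2) q'(2) by blast
      thus ?thesis by (simp add: q' fr_def h_mult)
    qed
    thus ?thesis using fr_nonempty[OF d] by (simp add: q(1) UN_const_eq)
  qed
  thus ?thesis using fr_nonempty[OF b] by (simp add: fraction_field_def UN_const_eq)
qed

lemma K_add:
  assumes b: "b \<notin> I" and d: "d \<notin> I"
  shows "fr a b \<oplus>\<^bsub>K\<^esub> fr c d = fr (a * d + c * b) (b * d)"
proof -
  have "(case q of (x, y) \<Rightarrow> \<Union>(x', y')\<in>fr c d. frac_rel R `` {(x \<otimes> y' \<oplus> x' \<otimes> y, y \<otimes> y')}) =
      fr (a * d + c * b) (b * d)"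
    if "q \<in> fr a b" for q
  proof -
    obtain a' b' where q: "q = (h a', h b')" "b' \<notin> I" "fr a' b' = fr a b"
      using fr_memE[OF \<open>q \<in> fr a b\<close> b] by blast
    have "(case q' of (x', y') \<Rightarrow> frac_rel R `` {(h a' \<otimes> y' \<oplus> x' \<otimes> h b', h b' \<otimes> y')}) =
        fr (a * d + c * b) (b * d)"
      if "q' \<in> fr c d" for q'
    proof -
      obtain c' d' where q': "q' = (h c', h d')" "d' \<notin> I" "fr c' d' = fr c d"
        using fr_memE[OF \<open>q' \<in> fr c d\<close> d] by blast
      have 1: "a' * b - a * b' \<in> I" "c' * d - c * d' \<in> I"
        using q q' fr_eq_iff b d by blast+
      have "(a' * d' + c' * b') * (b * d) - (a * d + c * b) * (b' * d') =
          d' * d * (a' * b - a * b') + b' * b * (c' * d - c * d')" by (simp add: algebra_simps)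
      also have "\<dots> \<in> I" by (intro I_add I_mult 1)
      finally have "fr (a' * d' + c' * b') (b' * d') = fr (a * d + c * b) (b * d)"
        using fr_eq_iff I_prime b d q(2) q'(2) by blast
      thus ?thesis by (simp add: q' fr_def h_mult h_add)
    qed
    thus ?thesis using fr_nonempty[OF d] by (simp add: q(1) UN_const_eq)
  qed
  thus ?thesis using fr_nonempty[OF b] by (simp add: fraction_field_def UN_const_eq)
qed

subsection \<open>The map from Laurent series\<close>

text \<open>Fractions with a power of X as denominator, independent of the choice by
  \<open>H_eq\<close>; they exhaust K by \<open>H_range\<close>.\<close>

definition H :: "int fls \<Rightarrow> ('r \<times> 'r) set" where
  "H F = (SOME Q. \<exists>n g. F = Xpow (- int n) * emb g \<and> Q = fr g (fps_X ^ n))"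

lemma Xpow_cancel: "Xpow (- int n) * emb g = Xpow (- int m) * emb f \<longleftrightarrow> g * fps_X ^ m = f * fps_X ^ n"
proof -
  have "Xpow (- int n) * emb g = Xpow (- int n - int m) * emb (fps_X ^ m * g)"
    using Xpow_mult_emb[of "- int n - int m" m g] by simp
  moreover have "Xpow (- int m) * emb f = Xpow (- int n - int m) * emb (fps_X ^ n * f)"
    using Xpow_mult_emb[of "- int n - int m" n f] by simp
  moreover have "Xpow k \<noteq> 0" for k by (simp add: Xpow_def)
  ultimately show ?thesis by (simp add: mult.commute)
qed

lemma H_eq: "H (Xpow (- int n) * emb g) = fr g (fps_X ^ n)"
proof -
  have "\<exists>m f. Xpow (- int n) * emb g = Xpow (- int m) * emb f \<and> H (Xpow (- int n) * emb g) = fr f (fps_X ^ m)"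
    unfolding H_def by (rule someI_ex) blast
  then obtain m f where mf: "Xpow (- int n) * emb g = Xpow (- int m) * emb f"
      "H (Xpow (- int n) * emb g) = fr f (fps_X ^ m)" by blast
  have "fr g (fps_X ^ n) = fr f (fps_X ^ m)"
    using mf(1) by (simp add: fr_eq_iff X_power_notin_I Xpow_cancel I_0)
  thus ?thesis using mf(2) by simp
qed

lemma H_emb: "H (emb g) = fr g 1"
  using H_eq[of 0 g] by simp

lemma common_denominator:
  obtains n f g where "F = Xpow (- int n) * emb f" "G = Xpow (- int n) * emb g"
proof -
  define n where "n = nat (max (- fls_subdegree F) (- fls_subdegree G))"
  have "- int n \<le> fls_subdegree F" "- int n \<le> fls_subdegree G" by (auto simp: n_def)
  thus ?thesis using fls_eq_Xpow_emb that by metis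
qed

lemma H_plus: "H (F + G) = H F \<oplus>\<^bsub>K\<^esub> H G"
proof -
  obtain n f g where FG: "F = Xpow (- int n) * emb f" "G = Xpow (- int n) * emb g"
    by (rule common_denominator)
  have "F + G = Xpow (- int n) * emb (f + g)" by (simp add: FG distrib_left)
  hence "H (F + G) = fr (f + g) (fps_X ^ n)" using H_eq by metis
  also have "\<dots> = fr (f * fps_X ^ n + g * fps_X ^ n) (fps_X ^ n * fps_X ^ n)"
    by (subst fr_eq_iff) (simp_all add: X_power_notin_I I_prime algebra_simps I_0)
  also have "\<dots> = H F \<oplus>\<^bsub>K\<^esub> H G" by (simp add: FG H_eq K_add X_power_notin_I)
  finally show ?thesis .
qed

lemma H_times: "H (F * G) = H F \<otimes>\<^bsub>K\<^esub> H G"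
proof -
  obtain n f g where FG: "F = Xpow (- int n) * emb f" "G = Xpow (- int n) * emb g"
    by (rule common_denominator)
  have "F * G = Xpow (- int (n + n)) * emb (f * g)"
    by (simp add: FG Xpow_add[symmetric] fls_times_fps_to_fls Xpow_add algebra_simps)
  hence "H (F * G) = fr (f * g) (fps_X ^ (n + n))" using H_eq by metis
  also have "\<dots> = H F \<otimes>\<^bsub>K\<^esub> H G" by (simp add: FG H_eq K_mult X_power_notin_I power_add)
  finally show ?thesis .
qed

lemma H_0: "H 0 = \<zero>\<^bsub>K\<^esub>" and H_1: "H 1 = \<one>\<^bsub>K\<^esub>"
  using H_emb[of 0] H_emb[of 1] by (simp_all add: K_one K_zero)

lemma H_eq_iff: "H F = H G \<longleftrightarrow> rv (F - G) = None"
proof -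
  obtain n f g where FG: "F = Xpow (- int n) * emb f" "G = Xpow (- int n) * emb g"
    by (rule common_denominator)
  have "H F = H G \<longleftrightarrow> fps_X ^ n * (f - g) \<in> I"
    unfolding FG H_eq fr_eq_iff[OF X_power_notin_I X_power_notin_I] by (simp add: algebra_simps)
  also have "\<dots> \<longleftrightarrow> Xpow (- int n) * emb (f - g) \<in> J" by (simp only: I_X_power Xpow_emb_in_J_iff)
  also have "Xpow (- int n) * emb (f - g) = F - G" by (simp add: FG algebra_simps)
  finally show ?thesis by (simp add: rv_eq_None_iff)
qed

text \<open>After inverting the constant coefficient modulo p, the product is 1 + X * y modulo I,
  which has an inverse power series.\<close>

lemma unit_mod_I: assumes "\<not> int p dvd u $ 0" shows "\<exists>w. u * w - 1 \<in> I"
proof -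
  have "coprime (u $ 0) (int p)"
    using prime_imp_coprime_int[of "int p" "u $ 0"] prime_p assms by (simp add: coprime_commute)
  then obtain s where s: "[u $ 0 * s = 1] (mod int p)" using cong_solve_coprime_int by blast
  hence "int p dvd (u * fps_const s - 1) $ 0" by (simp add: cong_iff_dvd_diff)
  then obtain y where y: "u * fps_const s - 1 - fps_X * y \<in> I" using I_shift by blast
  have "(1 + fps_X * y) $ 0 * 1 = 1" by simp
  from fps_right_inverse[OF this] obtain z where z: "(1 + fps_X * y) * z = 1" by blast
  have "u * (fps_const s * z) - 1 = z * (u * fps_const s - 1 - fps_X * y)"
    using z by (simp add: algebra_simps)
  thus ?thesis using I_mult[OF y] by metis
qed

lemma emb_diff_in_J: "emb g - Xpow 0 * emb g \<in> J"
  using J_0 by simp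

lemma val_ge_emb: "val_ge rv 0 (emb g)"
  using emb_diff_in_J val_ge_iff by blast

lemma emb_leadE:
  assumes "a \<notin> I"
  obtains m u where "a - fps_X ^ m * u \<in> I" "\<not> int p dvd u $ 0"
    "rv (emb a) = Some (int m, u $ 0 mod int p)"
proof -
  obtain \<gamma> c where *: "rv (emb a) = Some (\<gamma>, c)" using assms I_iff by auto
  have \<gamma>: "0 \<le> \<gamma>" using * val_ge_emb[of a] by (simp add: val_ge_def)
  obtain u where u: "emb a - Xpow \<gamma> * emb u \<in> J" "\<not> int p dvd u $ 0" "c = u $ 0 mod int p"
    using * by (rule rv_SomeD)
  have "emb a - Xpow \<gamma> * emb u = emb (a - fps_X ^ nat \<gamma> * u)"
    using Xpow_of_nat[of "nat \<gamma>"] \<gamma> by (simp add: fls_times_fps_to_fls)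
  hence "a - fps_X ^ nat \<gamma> * u \<in> I" using u(1) emb_in_J_iff by metis
  thus ?thesis using that[of "nat \<gamma>" u] u * \<gamma> by simp
qed

lemma H_range: "range H = carrier K"
proof
  show "range H \<subseteq> carrier K"
  proof clarify
    fix F
    obtain n g where "F = Xpow (- int n) * emb g" by (rule fls_Xpow_embE)
    hence "H F = fr g (fps_X ^ n)" using H_eq by simp
    thus "H F \<in> carrier K" unfolding K_carrier using X_power_notin_I by blast
  qed
  show "carrier K \<subseteq> range H"
  proof
    fix q assume "q \<in> carrier K"
    then obtain a b where q: "q = fr a b" "b \<notin> I" using K_carrier by auto
    obtain m u where u: "b - fps_X ^ m * u \<in> I" "\<not> int p dvd u $ 0"
      using q(2) by (rule emb_leadE)
    obtain w where w: "u * w - 1 \<in> I" using unit_mod_I[OF u(2)] by blast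
    \<comment> \<open>As b is X^m * u modulo I and w inverts u, a / b equals a * w / X^m.\<close>
    have "a * fps_X ^ m - (a * w) * b = - (a * fps_X ^ m) * (u * w - 1) - (a * w) * (b - fps_X ^ m * u)"
      by (simp add: algebra_simps)
    also have "\<dots> \<in> I" by (intro I_diff I_mult u w)
    finally have "q = fr (a * w) (fps_X ^ m)" using q fr_eq_iff X_power_notin_I by blast
    thus "q \<in> range H" using H_eq by (metis rangeI)
  qed
qed

lemma H_minus: "H (- F) = \<ominus>\<^bsub>K\<^esub> H F"
  by (rule cring_of_surj(2)[OF H_range H_0 H_1 H_plus H_times])

subsection \<open>The valuation\<close>

lemma h_power: "h fps_X [^] n = h (fps_X ^ n)"
  by (induction n) (simp_all add: h_1 h_mult R.m_comm)

lemma divides_iff: "h fps_X [^] n divides h a \<longleftrightarrow> val_ge rv (int n) (emb a)"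
proof -
  have "h fps_X [^] n divides h a \<longleftrightarrow> (\<exists>g. a - fps_X ^ n * g \<in> I)"
    by (auto simp: factor_def h_power h_range[symmetric] h_mult[symmetric] h_eq_iff)
  also have "\<dots> \<longleftrightarrow> (\<exists>g. emb a - Xpow (int n) * emb g \<in> J)"
    by (simp add: emb_in_J_iff[symmetric] Xpow_of_nat fls_times_fps_to_fls)
  finally show ?thesis by (simp add: val_ge_iff)
qed

lemma adic_order_eq: assumes "rv (emb a) = Some (int m, c)" shows "adic_order R (h fps_X) (h a) = m"
  unfolding adic_order_def divides_iff using assms
  by (intro Greatest_equality) (auto simp: val_ge_def)

lemma val_fr:
  assumes a: "rv (emb a) = Some (int m, c)" and b: "rv (emb b) = Some (int n, d)"
  shows "val (fr a b) = Fin (int m - int n)"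
proof -
  have ab: "a \<notin> I" "b \<notin> I" using a b I_iff by auto
  have c: "(case q of (x, y) \<Rightarrow> int (adic_order R (h fps_X) x) - int (adic_order R (h fps_X) y)) = int m - int n"
    if q: "q \<in> fr a b" for q
  proof -
    obtain a' b' where q: "q = (h a', h b')" "b' \<notin> I" "fr a' b' = fr a b"
      using fr_memE[OF q ab(2)] by blast
    have I: "a' * b - a * b' \<in> I" using q ab fr_eq_iff by blast
    have "a' \<notin> I"
    proof
      assume "a' \<in> I"
      hence "b * a' - (a' * b - a * b') \<in> I" using I I_mult I_diff by blast
      thus False using I_prime ab q(2) by (simp add: mult.commute)
    qed
    then obtain m' c' where m': "rv (emb a') = Some (int m', c')" by (meson emb_leadE)
    obtain n' d' where n': "rv (emb b') = Some (int n', d')" using q(2) by (meson emb_leadE)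
    have "rv (emb (a' * b)) = rv (emb (a * b'))"
      using I by (intro rv_cong) (simp add: I_iff)
    hence "int m' + int n = int m + int n'"
      by (simp add: fls_times_fps_to_fls rv_mult a b m' n')
    thus ?thesis by (simp add: q adic_order_eq[OF m'] adic_order_eq[OF n'])
  qed
  have "(\<lambda>(x, y). int (adic_order R (h fps_X) x) - int (adic_order R (h fps_X) y)) ` fr a b =
      (\<lambda>_. int m - int n) ` fr a b"
    by (intro image_cong refl c)
  also have "\<dots> = {int m - int n}" using fr_nonempty[OF ab(2)] by (simp add: image_constant_conv)
  finally have "(\<lambda>(x, y). int (adic_order R (h fps_X) x) - int (adic_order R (h fps_X) y)) ` fr a b =
      {int m - int n}" .
  moreover have "fr a b \<noteq> \<zero>\<^bsub>K\<^esub>"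
    using fr_eq_iff[OF ab(2) one_notin_I, of a 0] ab by (simp add: K_zero)
  ultimately show ?thesis by (simp add: adic_valuation_def)
qed

lemma val_H: "val (H F) = lead_val (rv F)"
proof (cases "rv F")
  case None
  hence "H F = \<zero>\<^bsub>K\<^esub>" using H_eq_iff[of F 0] H_0 by simp
  thus ?thesis using None by (simp add: adic_valuation_def lead_val_def)
next
  case (Some \<gamma>c)
  then obtain \<gamma> c where F: "rv F = Some (\<gamma>, c)" by (cases \<gamma>c) auto
  obtain n g where ng: "F = Xpow (- int n) * emb g" by (rule fls_Xpow_embE)
  have X: "rv (Xpow k) = Some (k, 1)" for k
    using rv_SomeI[of "Xpow k" k 1] J_0 p_gt_1 by (simp add: zmod_trivial_iff)
  have "emb g = Xpow (int n) * F" using Xpow_add[of "int n" "- int n"] by (simp add: ng mult.assoc[symmetric])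
  hence g: "rv (emb g) = Some (int n + \<gamma>, c mod int p)" by (simp add: rv_mult X F)
  hence "g \<notin> I" using I_iff by simp
  then obtain m where m: "int n + \<gamma> = int m" using g by (metis emb_leadE option.inject prod.inject)
  have "rv (emb (fps_X ^ n)) = Some (int n, 1)" using X[of "int n"] by (simp add: Xpow_of_nat)
  from val_fr[OF _ this, of g m] g m have "val (fr g (fps_X ^ n)) = Fin (int m - int n)" by auto
  thus ?thesis using m by (simp add: ng[symmetric] H_eq[symmetric] F lead_val_def)
qed

subsection \<open>The residue field\<close>

lemma lead_val_ge_0_iff: "0 \<le> lead_val (rv F) \<longleftrightarrow> val_ge rv 0 F"
  and lead_val_gt_0_iff: "0 < lead_val (rv F) \<longleftrightarrow> val_ge rv 1 F"
  by (auto simp: lead_val_def val_ge_def zero_with_infty_def less_eq_with_infty_def split: option.splits)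

abbreviation VR where "VR \<equiv> valuation_ring K val"

lemma H_emb_cong: "F - emb g \<in> J \<Longrightarrow> H F = H (emb g)"
  by (simp add: H_eq_iff rv_eq_None_iff)

lemma val_ge_emb_iff: "val_ge rv 1 (emb g) \<longleftrightarrow> int p dvd g $ 0"
  using digit_eq[OF emb_diff_in_J] digit_eq_0_iff[OF val_ge_emb] by (simp add: dvd_eq_mod_eq_0)

lemma O_carrier: "carrier VR = range (\<lambda>g. H (emb g))"
proof -
  have "carrier VR = {a \<in> range H. 0 \<le> val a}" by (simp add: valuation_ring_def H_range)
  also have "\<dots> = H ` {F. val_ge rv 0 F}" by (auto simp: val_H lead_val_ge_0_iff)
  also have "\<dots> = range (\<lambda>g. H (emb g))"
  proof -
    have "H F \<in> range (\<lambda>g. H (emb g))" if "val_ge rv 0 F" for F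
      using that H_emb_cong by (auto simp: val_ge_iff)
    thus ?thesis using val_ge_emb by auto
  qed
  finally show ?thesis .
qed

text \<open>The residue class of k as a set of field elements, equal by \<open>coset_eq\<close> to
  the coset of the maximal ideal \<open>\<iota> 0\<close> that represents it in the factor
  ring.\<close>

definition \<iota> :: "int \<Rightarrow> ('r \<times> 'r) set set" where
  "\<iota> k = {H (emb f) | f. f $ 0 mod int p = k mod int p}"

lemma valuation_ideal_eq: "valuation_ideal K val = \<iota> 0"
proof -
  have "valuation_ideal K val = {a \<in> range H. 0 < val a}" by (simp add: valuation_ideal_def H_range)
  also have "\<dots> = H ` {F. val_ge rv 1 F}" by (auto simp: val_H lead_val_gt_0_iff)
  also have "\<dots> = \<iota> 0"
  proof -
    have "H F \<in> \<iota> 0" if F: "val_ge rv 1 F" for F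
    proof -
      obtain g where g: "F - Xpow 0 * emb g \<in> J" using val_ge_mono[OF F, of 0] val_ge_iff by auto
      hence "H F = H (emb g)" using H_emb_cong by simp
      moreover have "digit rv 0 F = 0" using val_ge_mono[OF F, of 0] digit_eq_0_iff[of 0 F] F by simp
      ultimately show ?thesis using digit_eq[OF g] by (auto simp: \<iota>_def)
    qed
    thus ?thesis using val_ge_emb_iff by (auto simp: \<iota>_def dvd_eq_mod_eq_0)
  qed
  finally show ?thesis .
qed

lemma O_ops: "x \<oplus>\<^bsub>VR\<^esub> y = x \<oplus>\<^bsub>K\<^esub> y" "x \<otimes>\<^bsub>VR\<^esub> y = x \<otimes>\<^bsub>K\<^esub> y" "\<one>\<^bsub>VR\<^esub> = \<one>\<^bsub>K\<^esub>"
  by (simp_all add: valuation_ring_def)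

lemma H_emb_ops: "H (emb f) \<oplus>\<^bsub>K\<^esub> H (emb g) = H (emb (f + g))"
  "H (emb f) \<otimes>\<^bsub>K\<^esub> H (emb g) = H (emb (f * g))"
  by (simp_all add: H_plus H_times fls_times_fps_to_fls)

lemma \<iota>_memI: "f $ 0 mod int p = k mod int p \<Longrightarrow> H (emb f) \<in> \<iota> k"
  by (auto simp: \<iota>_def)

lemma \<iota>_set_add: "(\<Union>x\<in>\<iota> k. \<Union>y\<in>\<iota> l. {x \<oplus>\<^bsub>K\<^esub> y}) = \<iota> (k + l)"
proof (intro equalityI subsetI)
  fix z assume "z \<in> \<iota> (k + l)"
  then obtain f where f: "z = H (emb f)" "f $ 0 mod int p = (k + l) mod int p" by (auto simp: \<iota>_def)
  have "H (emb (f - fps_const l)) \<in> \<iota> k"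
    using f(2) by (intro \<iota>_memI) (simp add: mod_eq_dvd_iff algebra_simps)
  moreover have "H (emb (fps_const l)) \<in> \<iota> l" by (intro \<iota>_memI) simp
  moreover have "z = H (emb (f - fps_const l)) \<oplus>\<^bsub>K\<^esub> H (emb (fps_const l))"
    unfolding H_emb_ops f(1) by simp
  ultimately show "z \<in> (\<Union>x\<in>\<iota> k. \<Union>y\<in>\<iota> l. {x \<oplus>\<^bsub>K\<^esub> y})" by blast
next
  fix z assume "z \<in> (\<Union>x\<in>\<iota> k. \<Union>y\<in>\<iota> l. {x \<oplus>\<^bsub>K\<^esub> y})"
  then obtain f g where fg: "f $ 0 mod int p = k mod int p" "g $ 0 mod int p = l mod int p"
      "z = H (emb f) \<oplus>\<^bsub>K\<^esub> H (emb g)" by (auto simp: \<iota>_def)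
  have "(f + g) $ 0 mod int p = (k + l) mod int p"
    using mod_add_cong[OF fg(1,2)] by simp
  thus "z \<in> \<iota> (k + l)" unfolding fg(3) H_emb_ops by (rule \<iota>_memI)
qed

lemma coset_eq: "\<iota> 0 +>\<^bsub>VR\<^esub> H (emb g) = \<iota> (g $ 0)"
proof -
  have "\<iota> 0 +>\<^bsub>VR\<^esub> H (emb g) = (\<Union>x\<in>\<iota> 0. {x \<oplus>\<^bsub>K\<^esub> H (emb g)})"
    by (simp add: a_r_coset_def' O_ops)
  also have "\<dots> = \<iota> (g $ 0)"
  proof (intro equalityI subsetI)
    fix z assume "z \<in> (\<Union>x\<in>\<iota> 0. {x \<oplus>\<^bsub>K\<^esub> H (emb g)})"
    moreover have "H (emb g) \<in> \<iota> (g $ 0)" by (rule \<iota>_memI) simp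
    ultimately have "z \<in> (\<Union>x\<in>\<iota> 0. \<Union>y\<in>\<iota> (g $ 0). {x \<oplus>\<^bsub>K\<^esub> y})" by blast
    thus "z \<in> \<iota> (g $ 0)" using \<iota>_set_add[of "g $ 0" 0] by simp
  next
    fix z assume "z \<in> \<iota> (g $ 0)"
    then obtain f where f: "z = H (emb f)" "f $ 0 mod int p = g $ 0 mod int p" by (auto simp: \<iota>_def)
    have "H (emb (f - g)) \<in> \<iota> 0" using f(2) by (intro \<iota>_memI) (simp add: mod_eq_dvd_iff dvd_eq_mod_eq_0[symmetric])
    moreover have "z = H (emb (f - g)) \<oplus>\<^bsub>K\<^esub> H (emb g)" unfolding H_emb_ops f(1) by simp
    ultimately show "z \<in> (\<Union>x\<in>\<iota> 0. {x \<oplus>\<^bsub>K\<^esub> H (emb g)})" by blast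
  qed
  finally show ?thesis .
qed

abbreviation KF where "KF \<equiv> residue_field K val"

lemma residue_field_eq: "KF = VR Quot \<iota> 0"
  by (simp add: residue_field_def valuation_ideal_eq)

lemma \<iota>_nonempty: "\<iota> l \<noteq> {}"
  using \<iota>_memI[of "fps_const l" l] by auto

lemma \<iota>_eq_iff: "\<iota> a = \<iota> b \<longleftrightarrow> a mod int p = b mod int p"
proof
  assume "\<iota> a = \<iota> b"
  hence "H (emb (fps_const a)) \<in> \<iota> b" using \<iota>_memI[of "fps_const a" a] by simp
  then obtain f where f: "H (emb (fps_const a)) = H (emb f)" "f $ 0 mod int p = b mod int p"
    by (auto simp: \<iota>_def)
  have "emb (fps_const a - f) \<in> J" using f(1) by (simp add: H_eq_iff rv_eq_None_iff)
  hence "int p dvd (fps_const a - f) $ 0" using emb_in_J_iff I_const by blast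
  hence "a mod int p = f $ 0 mod int p" by (simp add: mod_eq_dvd_iff)
  thus "a mod int p = b mod int p" using f(2) by simp
qed (simp add: \<iota>_def)

lemma \<iota>_range: "range \<iota> = carrier KF"
proof -
  have "carrier KF = (\<lambda>a. \<iota> 0 +>\<^bsub>VR\<^esub> a) ` carrier VR"
    by (auto simp: residue_field_eq FactRing_def A_RCOSETS_def')
  also have "\<dots> = range (\<lambda>g :: int fps. \<iota> (g $ 0))" by (simp add: O_carrier image_image coset_eq)
  also have "\<dots> = range \<iota>"
  proof -
    have "\<iota> l \<in> range (\<lambda>g :: int fps. \<iota> (g $ 0))" for l
      by (rule range_eqI[of _ _ "fps_const l"]) simp
    thus ?thesis by auto
  qed
  finally show ?thesis ..
qed

lemma \<iota>_0: "\<iota> 0 = \<zero>\<^bsub>KF\<^esub>" and \<iota>_1: "\<iota> 1 = \<one>\<^bsub>KF\<^esub>"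
  using coset_eq[of 1] by (simp_all add: residue_field_eq FactRing_def O_ops H_1[symmetric])

lemma \<iota>_add: "\<iota> (a + b) = \<iota> a \<oplus>\<^bsub>KF\<^esub> \<iota> b"
  by (simp add: residue_field_eq FactRing_def set_add_def' O_ops \<iota>_set_add)

lemma \<iota>_mult: "\<iota> (a * b) = \<iota> a \<otimes>\<^bsub>KF\<^esub> \<iota> b"
proof -
  have "\<iota> 0 +>\<^bsub>VR\<^esub> (x \<otimes>\<^bsub>VR\<^esub> y) = \<iota> (a * b)" if xy: "x \<in> \<iota> a" "y \<in> \<iota> b" for x y
  proof -
    obtain f g where fg: "f $ 0 mod int p = a mod int p" "g $ 0 mod int p = b mod int p"
        "x = H (emb f)" "y = H (emb g)" using xy by (auto simp: \<iota>_def)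
    have "\<iota> 0 +>\<^bsub>VR\<^esub> (x \<otimes>\<^bsub>VR\<^esub> y) = \<iota> ((f * g) $ 0)"
      unfolding fg O_ops H_emb_ops by (rule coset_eq)
    also have "\<dots> = \<iota> (a * b)"
      unfolding \<iota>_eq_iff using mod_mult_cong[OF fg(1,2)] by (simp add: fps_mult_nth)
    finally show ?thesis .
  qed
  hence "rcoset_mult VR (\<iota> 0) (\<iota> a) (\<iota> b) = \<iota> (a * b)"
    unfolding rcoset_mult_def by (intro UN_const_eq \<iota>_nonempty)
  thus ?thesis by (simp add: residue_field_eq FactRing_def)
qed

lemma \<iota>_minus: "\<iota> (- a) = \<ominus>\<^bsub>KF\<^esub> \<iota> a"
  by (rule cring_of_surj(2)[OF \<iota>_range \<iota>_0 \<iota>_1 \<iota>_add \<iota>_mult])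

lemma residue_map_H: "residue_map K val (H F) = \<iota> (residue_digit rv F)"
proof (cases "val_ge rv 0 F")
  case True
  then obtain g where g: "F - Xpow 0 * emb g \<in> J" using val_ge_iff by blast
  hence HF: "H F = H (emb g)" using H_emb_cong by simp
  hence "residue_map K val (H F) = \<iota> (g $ 0)"
    by (simp add: residue_map_def O_carrier valuation_ideal_eq coset_eq)
  thus ?thesis using True digit_eq[OF g] by (simp add: residue_digit_def \<iota>_eq_iff)
next
  case False
  hence "H F \<notin> carrier VR" by (simp add: valuation_ring_def val_H lead_val_ge_0_iff)
  thus ?thesis using False by (simp add: residue_map_def residue_digit_def \<iota>_0)
qed

theorem represents_K: "represents p rv (vf_structure_of K val) H \<iota>"
  by unfold_locales
     (simp_all add: vf_structure_of_def H_range H_eq_iff H_0 H_1 H_plus H_times H_minus \<iota>_range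
       \<iota>_eq_iff \<iota>_0 \<iota>_1 \<iota>_add \<iota>_mult \<iota>_minus val_H residue_map_H zero_with_infty_def)

end

section \<open>The p-adic integers\<close>

text \<open>The value at X = p of f truncated below degree n; modulo p^n it stands for the value of
  f itself.\<close>

definition psum :: "nat \<Rightarrow> int fps \<Rightarrow> nat \<Rightarrow> int" where
  "psum p f n = (\<Sum>i<n. f $ i * int p ^ i)"

text \<open>The ideal generated by \<open>p - X\<close>.\<close>

definition padic_ideal :: "nat \<Rightarrow> int fps set" where
  "padic_ideal p = {f. \<forall>n. int p ^ n dvd psum p f n}"

definition padic_of_fps :: "nat \<Rightarrow> int fps \<Rightarrow> nat \<Rightarrow> int" where
  "padic_of_fps p f = (\<lambda>n. psum p f n mod int p ^ n)"

lemma psum_add: "psum p (f + g) n = psum p f n + psum p g n"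
  and psum_diff: "psum p (f - g) n = psum p f n - psum p g n"
  by (simp_all add: psum_def sum.distrib sum_subtractf algebra_simps)

text \<open>The products lost by truncation have total degree at least n and are divisible by
  p^n.\<close>

lemma psum_mult: "int p ^ n dvd psum p f n * psum p g n - psum p (f * g) n"
proof -
  let ?t = "\<lambda>(i, j). f $ i * int p ^ i * (g $ j * int p ^ j)"
  have "psum p (f * g) n = (\<Sum>k<n. \<Sum>i\<le>k. ?t (i, k - i))"
    unfolding psum_def fps_mult_nth sum_distrib_right atMost_atLeast0
    by (intro sum.cong refl) (simp add: power_add[symmetric] algebra_simps flip: power_add)
  also have "\<dots> = sum ?t {(i, j). i + j < n}"
    using sum.triangle_reindex[of "\<lambda>i j. ?t (i, j)" n] by (simp add: case_prod_unfold)
  finally have "psum p (f * g) n = sum ?t {(i, j). i + j < n}" .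
  moreover have "psum p f n * psum p g n = sum ?t ({..<n} \<times> {..<n})"
    by (simp add: psum_def sum_product sum.cartesian_product)
  moreover have "{(i, j). i + j < n} \<subseteq> {..<n} \<times> {..<n}" by auto
  ultimately have "psum p f n * psum p g n - psum p (f * g) n =
      sum ?t ({..<n} \<times> {..<n} - {(i, j). i + j < n})"
    by (simp add: sum_diff)
  also have "int p ^ n dvd \<dots>"
  proof (intro dvd_sum)
    fix q assume "q \<in> {..<n} \<times> {..<n} - {(i, j). i + j < n}"
    then obtain i j where q: "q = (i, j)" "n \<le> i + j" by (cases q) auto
    have "?t q = f $ i * g $ j * int p ^ (i + j)" by (simp add: q power_add algebra_simps)
    thus "int p ^ n dvd ?t q" using le_imp_power_dvd[OF q(2), of "int p"] by (metis dvd_mult)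
  qed
  finally show ?thesis .
qed

lemma psum_Suc_X: "psum p (fps_X * f) (Suc n) = int p * psum p f n"
  by (simp add: psum_def sum.lessThan_Suc_shift sum_distrib_left algebra_simps del: sum.lessThan_Suc)

lemma psum_p_minus_X: "int p ^ n dvd psum p (fps_const (int p) - fps_X) n"
proof -
  have "psum p (fps_const (int p) - fps_X) (Suc (Suc m)) = 0" for m
    by (simp add: psum_def sum.lessThan_Suc_shift fps_X_def del: sum.lessThan_Suc)
  moreover have "psum p (fps_const (int p) - fps_X) (Suc 0) = int p" by (simp add: psum_def)
  ultimately show ?thesis
    by (cases n; cases "n - 1") (auto simp: psum_def[of _ _ 0])
qed

lemma padic_fraction_rep:
  assumes p: "prime p"
  shows "fraction_rep p (padic_ideal p) (padic_integers p) (padic_of_fps p)"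
proof
  let ?R = "padic_integers p"
  have p0: "0 < int p" using prime_gt_0_nat[OF p] by simp
  show "prime p" by (rule p)
  show "0 \<in> padic_ideal p" by (simp add: padic_ideal_def psum_def)
  show "f + g \<in> padic_ideal p" if "f \<in> padic_ideal p" "g \<in> padic_ideal p" for f g
    using that by (simp add: padic_ideal_def psum_add)
  show "g * f \<in> padic_ideal p" if "f \<in> padic_ideal p" for f g
    unfolding padic_ideal_def
  proof clarify
    fix n
    have "int p ^ n dvd psum p g n * psum p f n" using that by (simp add: padic_ideal_def)
    thus "int p ^ n dvd psum p (g * f) n" using psum_mult[of p n g f]
      by (metis dvd_diff_right_iff)
  qed
  show "int p dvd f $ 0" if "f \<in> padic_ideal p" for f
  proof -
    have "int p ^ 1 dvd psum p f 1" using that unfolding padic_ideal_def by blast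
    thus ?thesis by (simp add: psum_def)
  qed
  show "\<exists>g. fps_const (int p) - fps_X * g \<in> padic_ideal p"
    by (rule exI[of _ 1]) (simp add: padic_ideal_def psum_p_minus_X)
  show "f \<in> padic_ideal p" if "fps_X * f \<in> padic_ideal p" for f
    unfolding padic_ideal_def
  proof clarify
    fix n
    have "int p ^ Suc n dvd psum p (fps_X * f) (Suc n)" using that unfolding padic_ideal_def by blast
    thus "int p ^ n dvd psum p f n" unfolding psum_Suc_X using p0 by simp
  qed
  show "f \<in> padic_ideal p" if sep: "\<And>n. \<exists>g. f - fps_X ^ n * g \<in> padic_ideal p" for f
    unfolding padic_ideal_def
  proof clarify
    fix n
    obtain g where "f - fps_X ^ n * g \<in> padic_ideal p" using sep by blast
    hence "int p ^ n dvd psum p (f - fps_X ^ n * g) n" unfolding padic_ideal_def by blast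
    moreover have "psum p (fps_X ^ n * g) n = 0" by (simp add: psum_def fps_X_power_mult_nth)
    ultimately show "int p ^ n dvd psum p f n" by (simp add: psum_diff)
  qed
  show "range (padic_of_fps p) = carrier ?R"
  proof (intro equalityI subsetI)
    fix x assume "x \<in> range (padic_of_fps p)"
    then obtain f where x: "x = padic_of_fps p f" by blast
    have "psum p f (Suc n) mod int p ^ Suc n mod int p ^ n = psum p f n mod int p ^ n" for n
      by (simp add: mod_mod_cancel psum_def)
    thus "x \<in> carrier ?R" using p0 by (simp add: padic_integers_def x padic_of_fps_def)
  next
    fix x assume "x \<in> carrier ?R"
    hence x: "0 \<le> x n" "x n < int p ^ n" "x (Suc n) mod int p ^ n = x n" for n
      by (auto simp: padic_integers_def)
    \<comment> \<open>The coefficients are the p-adic digits of x, so the partial sums telescope to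
      x n.\<close>
    define f where "f = Abs_fps (\<lambda>i. (x (Suc i) - x i) div int p ^ i)"
    have "f $ i * int p ^ i = x (Suc i) - x i" for i
    proof -
      have "int p ^ i dvd x (Suc i) - x i"
        using x(3)[of i] by (metis dvd_minus_mod minus_mod_eq_mult_div dvd_triv_left)
      thus ?thesis by (simp add: f_def)
    qed
    hence "psum p f n = x n - x 0" for n by (simp add: psum_def sum_lessThan_telescope)
    moreover have "x 0 = 0" using x(1,2)[of 0] by simp
    ultimately have "x = padic_of_fps p f" using x(1,2) by (auto simp: padic_of_fps_def)
    thus "x \<in> range (padic_of_fps p)" by blast
  qed
  show "padic_of_fps p 0 = \<zero>\<^bsub>?R\<^esub>" by (simp add: padic_of_fps_def psum_def padic_integers_def)
  have "psum p 1 n mod int p ^ n = 1 mod int p ^ n" for n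
    by (cases n) (simp_all add: psum_def sum.lessThan_Suc_shift del: sum.lessThan_Suc)
  thus "padic_of_fps p 1 = \<one>\<^bsub>?R\<^esub>" by (simp add: padic_of_fps_def padic_integers_def)
  show "padic_of_fps p (f + g) = padic_of_fps p f \<oplus>\<^bsub>?R\<^esub> padic_of_fps p g" for f g
    by (simp add: padic_of_fps_def padic_integers_def psum_add mod_add_eq)
  show "padic_of_fps p (f * g) = padic_of_fps p f \<otimes>\<^bsub>?R\<^esub> padic_of_fps p g" for f g
    using psum_mult[of p _ f g]
    by (simp add: padic_of_fps_def padic_integers_def mod_mult_eq mod_eq_dvd_iff[symmetric])
  show "padic_of_fps p f = padic_of_fps p g \<longleftrightarrow> f - g \<in> padic_ideal p" for f g
    by (auto simp: padic_of_fps_def padic_ideal_def psum_diff mod_eq_dvd_iff fun_eq_iff)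
qed

text \<open>p and X are congruent modulo the ideal generated by p - X.\<close>

lemma padic_uniformizer:
  assumes p: "prime p"
  shows "add_pow (padic_integers p) p \<one>\<^bsub>padic_integers p\<^esub> = padic_of_fps p fps_X"
proof -
  interpret fraction_rep p "padic_ideal p" "padic_integers p" "padic_of_fps p"
    by (rule padic_fraction_rep[OF p])
  have "add_pow (padic_integers p) n \<one>\<^bsub>padic_integers p\<^esub> = padic_of_fps p (of_nat n)" for n :: nat
    by (induction n) (simp_all add: h_0 h_1 h_add R.add.nat_pow_Suc R.add.m_comm)
  moreover have "fps_const (int p) - fps_X \<in> padic_ideal p" by (simp add: padic_ideal_def psum_p_minus_X)
  hence "padic_of_fps p (of_nat p) = padic_of_fps p fps_X"
    by (simp add: h_eq_iff fps_of_nat[symmetric])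
  ultimately show ?thesis by simp
qed

section \<open>Power series over the prime field\<close>

text \<open>The ideal generated by p.\<close>

definition coeff_ideal :: "nat \<Rightarrow> int fps set" where
  "coeff_ideal p = {f. \<forall>n. int p dvd f $ n}"

definition Fp_series_of_fps :: "nat \<Rightarrow> int fps \<Rightarrow> nat \<Rightarrow> int" where
  "Fp_series_of_fps p f = (\<lambda>n. f $ n mod int p)"

lemma residue_ring_finsum:
  assumes "1 < m" "finite A"
  shows "finsum (residue_ring m) (\<lambda>i. f i mod m) A = sum f A mod m"
  using assms(2)
proof (induction A)
  case empty
  interpret residues m "residue_ring m" by unfold_locales (use assms in auto)
  show ?case by (simp add: res_zero_eq)
next
  case (insert x A)
  interpret residues m "residue_ring m" by unfold_locales (use assms in auto)
  have "(\<lambda>i. f i mod m) \<in> B \<rightarrow> carrier (residue_ring m)" for B using assms(1) by (auto simp: res_carrier_eq)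
  thus ?case using insert by (simp add: finsum_insert res_add_eq mod_add_eq)
qed

lemma Fp_fraction_rep:
  assumes p: "prime p"
  shows "fraction_rep p (coeff_ideal p) (Fp_power_series p) (Fp_series_of_fps p)"
proof
  let ?R = "Fp_power_series p"
  note R_defs = Fp_power_series_def power_series_ring_def residue_ring_def
  have p1: "1 < int p" using prime_gt_1_nat[OF p] by simp
  show "prime p" by (rule p)
  show "0 \<in> coeff_ideal p" by (simp add: coeff_ideal_def)
  show "f + g \<in> coeff_ideal p" if "f \<in> coeff_ideal p" "g \<in> coeff_ideal p" for f g
    using that by (simp add: coeff_ideal_def)
  show "g * f \<in> coeff_ideal p" if "f \<in> coeff_ideal p" for f g
    using that by (simp add: coeff_ideal_def fps_mult_nth dvd_sum)
  show "int p dvd f $ 0" if "f \<in> coeff_ideal p" for f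
    using that by (simp add: coeff_ideal_def)
  show "\<exists>g. fps_const (int p) - fps_X * g \<in> coeff_ideal p"
    \<comment> \<open>Here p itself lies in the ideal.\<close>
    by (rule exI[of _ 0]) (simp add: coeff_ideal_def fps_const_def)
  show "f \<in> coeff_ideal p" if "fps_X * f \<in> coeff_ideal p" for f
    unfolding coeff_ideal_def
  proof clarify
    fix n
    have "int p dvd (fps_X * f) $ Suc n" using that unfolding coeff_ideal_def by blast
    thus "int p dvd f $ n" by simp
  qed
  show "f \<in> coeff_ideal p" if sep: "\<And>n. \<exists>g. f - fps_X ^ n * g \<in> coeff_ideal p" for f
    unfolding coeff_ideal_def
  proof clarify
    fix n
    obtain g where "f - fps_X ^ Suc n * g \<in> coeff_ideal p" using sep by blast
    hence "int p dvd (f - fps_X ^ Suc n * g) $ n" unfolding coeff_ideal_def by blast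
    thus "int p dvd f $ n" by (simp add: fps_X_power_mult_nth del: power_Suc)
  qed
  show "range (Fp_series_of_fps p) = carrier ?R"
  proof (intro equalityI subsetI)
    fix x assume "x \<in> range (Fp_series_of_fps p)"
    thus "x \<in> carrier ?R" using p1 by (auto simp: R_defs Fp_series_of_fps_def)
  next
    fix x assume "x \<in> carrier ?R"
    hence "x n mod int p = x n" for n by (auto simp: R_defs)
    hence "x = Fp_series_of_fps p (Abs_fps x)" by (simp add: Fp_series_of_fps_def)
    thus "x \<in> range (Fp_series_of_fps p)" by blast
  qed
  show "Fp_series_of_fps p 0 = \<zero>\<^bsub>?R\<^esub>" by (simp add: R_defs Fp_series_of_fps_def)
  show "Fp_series_of_fps p 1 = \<one>\<^bsub>?R\<^esub>" using p1 by (auto simp: R_defs Fp_series_of_fps_def)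
  show "Fp_series_of_fps p (f + g) = Fp_series_of_fps p f \<oplus>\<^bsub>?R\<^esub> Fp_series_of_fps p g" for f g
    by (simp add: R_defs Fp_series_of_fps_def mod_add_eq)
  show "Fp_series_of_fps p (f * g) = Fp_series_of_fps p f \<otimes>\<^bsub>?R\<^esub> Fp_series_of_fps p g" for f g
  proof
    fix n
    have "(Fp_series_of_fps p f \<otimes>\<^bsub>?R\<^esub> Fp_series_of_fps p g) n =
        finsum (residue_ring (int p)) (\<lambda>i. (f $ i * g $ (n - i)) mod int p) {..n}"
      by (simp add: Fp_power_series_def power_series_ring_def Fp_series_of_fps_def)
         (simp add: residue_ring_def mod_mult_eq)
    also have "\<dots> = (f * g) $ n mod int p"
      by (simp add: residue_ring_finsum[OF p1] fps_mult_nth atMost_atLeast0)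
    finally show "Fp_series_of_fps p (f * g) n = (Fp_series_of_fps p f \<otimes>\<^bsub>?R\<^esub> Fp_series_of_fps p g) n"
      by (simp add: Fp_series_of_fps_def)
  qed
  show "Fp_series_of_fps p f = Fp_series_of_fps p g \<longleftrightarrow> f - g \<in> coeff_ideal p" for f g
    by (auto simp: Fp_series_of_fps_def coeff_ideal_def mod_eq_dvd_iff fun_eq_iff)
qed

lemma Fp_uniformizer:
  assumes "prime p"
  shows "power_series_var (residue_ring (int p)) = Fp_series_of_fps p fps_X"
  using prime_gt_1_nat[OF assms]
  by (auto simp: power_series_var_def Fp_series_of_fps_def residue_ring_def fps_X_def)

section \<open>Sentences\<close>

lemma ring_eval_cong: "(\<And>n. n \<in> ring_term_vars t \<Longrightarrow> e n = e' n) \<Longrightarrow> ring_eval R e t = ring_eval R e' t"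
  by (induction t) auto

lemma ring_sat_cong: "(\<And>n. n \<in> ring_free_vars \<phi> \<Longrightarrow> e n = e' n) \<Longrightarrow> ring_sat R e \<phi> = ring_sat R e' \<phi>"
proof (induction \<phi> arbitrary: e e')
  case (REq s t)
  have "ring_eval R e u = ring_eval R e' u" if "u \<in> {s, t}" for u
    using REq that by (intro ring_eval_cong) auto
  thus ?case by simp
next
  case (RAnd \<phi> \<psi>)
  have "ring_sat R e \<phi> = ring_sat R e' \<phi>" "ring_sat R e \<psi> = ring_sat R e' \<psi>"
    using RAnd.prems by (auto intro!: RAnd.IH)
  thus ?case by simp
next
  case (REx n \<phi>)
  have "ring_sat R (e(n := a)) \<phi> = ring_sat R (e'(n := a)) \<phi>" for a
    using REx.prems by (intro REx.IH) auto
  thus ?case by simp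
next
  case (RNot \<phi>)
  have "ring_sat R e \<phi> = ring_sat R e' \<phi>" using RNot.prems by (intro RNot.IH) auto
  thus ?case by simp
qed

lemma ring_models_iff_sat:
  assumes "ring_sentence \<theta>" "range e \<subseteq> carrier R"
  shows "R \<Turnstile>\<^sub>r \<theta> \<longleftrightarrow> ring_sat R e \<theta>"
  using assms ring_sat_cong[of \<theta>] unfolding ring_models_def ring_sentence_def by blast

lemma res_eval_cong:
  "(\<And>n. (Field_Sort, n) \<in> res_term_vars t \<Longrightarrow> e n = e' n) \<Longrightarrow>
   (\<And>n. (Residue_Sort, n) \<in> res_term_vars t \<Longrightarrow> f n = f' n) \<Longrightarrow> res_eval M e f t = res_eval M e' f' t"
  by (induction t) (auto intro!: arg_cong[of _ _ "res_map M"] ring_eval_cong)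

lemma grp_eval_cong:
  "(\<And>n. (Field_Sort, n) \<in> grp_term_vars t \<Longrightarrow> e n = e' n) \<Longrightarrow>
   (\<And>n. (Group_Sort, n) \<in> grp_term_vars t \<Longrightarrow> g n = g' n) \<Longrightarrow> grp_eval M e g t = grp_eval M e' g' t"
  by (induction t) (auto intro!: arg_cong[of _ _ "val_map M"] ring_eval_cong)

definition envs_agree where
  "envs_agree V e f g e' f' g' \<longleftrightarrow> (\<forall>n. ((Field_Sort, n) \<in> V \<longrightarrow> e n = e' n) \<and>
     ((Residue_Sort, n) \<in> V \<longrightarrow> f n = f' n) \<and> ((Group_Sort, n) \<in> V \<longrightarrow> g n = g' n))"

lemma vf_sat_cong:
  "envs_agree (vf_free_vars \<phi>) e f g e' f' g' \<Longrightarrow> vf_sat M e f g \<phi> = vf_sat M e' f' g' \<phi>"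
proof (induction \<phi> arbitrary: e f g e' f' g')
  case (EqF s t)
  have "ring_eval (field_sort M) e u = ring_eval (field_sort M) e' u" if "u \<in> {s, t}" for u
    using EqF that by (intro ring_eval_cong) (auto simp: envs_agree_def)
  thus ?case by simp
next
  case (EqK s t)
  have "res_eval M e f u = res_eval M e' f' u" if "u \<in> {s, t}" for u
    using EqK that by (intro res_eval_cong) (auto simp: envs_agree_def)
  thus ?case by simp
next
  case (EqG s t)
  have "grp_eval M e g u = grp_eval M e' g' u" if "u \<in> {s, t}" for u
    using EqG that by (intro grp_eval_cong) (auto simp: envs_agree_def)
  thus ?case by simp
next
  case (LessG s t)
  have "grp_eval M e g u = grp_eval M e' g' u" if "u \<in> {s, t}" for u
    using LessG that by (intro grp_eval_cong) (auto simp: envs_agree_def)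
  thus ?case by simp
next
  case (NotV \<phi>)
  have "vf_sat M e f g \<phi> = vf_sat M e' f' g' \<phi>" using NotV.prems by (intro NotV.IH) simp
  thus ?case by simp
next
  case (AndV \<phi> \<psi>)
  have "vf_sat M e f g \<phi> = vf_sat M e' f' g' \<phi>" "vf_sat M e f g \<psi> = vf_sat M e' f' g' \<psi>"
    using AndV.prems by (auto simp: envs_agree_def intro!: AndV.IH)
  thus ?case by simp
next
  case (ExF n \<phi>)
  have "vf_sat M (e(n := a)) f g \<phi> = vf_sat M (e'(n := a)) f' g' \<phi>" for a
    using ExF.prems by (intro ExF.IH) (auto simp: envs_agree_def)
  thus ?case by simp
next
  case (ExK n \<phi>)
  have "vf_sat M e (f(n := a)) g \<phi> = vf_sat M e' (f'(n := a)) g' \<phi>" for a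
    using ExK.prems by (intro ExK.IH) (auto simp: envs_agree_def)
  thus ?case by simp
next
  case (ExG n \<phi>)
  have "vf_sat M e f (g(n := a)) \<phi> = vf_sat M e' f' (g'(n := a)) \<phi>" for a
    using ExG.prems by (intro ExG.IH) (auto simp: envs_agree_def)
  thus ?case by simp
qed

lemma vf_models_iff_sat:
  assumes "vf_sentence \<theta>" "range e \<subseteq> carrier (field_sort M)" "range f \<subseteq> carrier (residue_sort M)"
    "range g \<subseteq> group_sort M"
  shows "M \<Turnstile>\<^sub>v \<theta> \<longleftrightarrow> vf_sat M e f g \<theta>"
proof -
  have "vf_sat M e f g \<theta> = vf_sat M e' f' g' \<theta>" for e' f' g'
    using assms(1) by (intro vf_sat_cong) (simp add: vf_sentence_def envs_agree_def)
  thus ?thesis using assms(2-4) unfolding vf_models_def by blast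
qed

text \<open>A sentence may be evaluated with all variables 0, where terms denote integers; this
  leads to the agreement of leading terms from which \<open>vf_sat_uniform\<close> starts.\<close>

lemma term_eval_0_of_int: "\<exists>m :: int. \<forall>e :: nat \<Rightarrow> 'k::comm_ring_1. e = (\<lambda>_. 0) \<longrightarrow> term_eval e t = of_int m"
proof (induction t)
  case (RAdd s t)
  then obtain m n where "term_eval (\<lambda>_. 0 :: 'k) s = of_int m" "term_eval (\<lambda>_. 0 :: 'k) t = of_int n" by blast
  thus ?case by (intro exI[of _ "m + n"]) simp
next
  case (RMult s t)
  then obtain m n where "term_eval (\<lambda>_. 0 :: 'k) s = of_int m" "term_eval (\<lambda>_. 0 :: 'k) t = of_int n" by blast
  thus ?case by (intro exI[of _ "m * n"]) simp
next
  case (RNeg t)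
  then obtain n where "term_eval (\<lambda>_. 0 :: 'k) t = of_int n" by blast
  thus ?case by (intro exI[of _ "- n"]) simp
next
  case (RVar n)
  show ?case by (intro exI[of _ 0]) simp
next
  case RZero
  show ?case by (intro exI[of _ 0]) simp
next
  case ROne
  show ?case by (intro exI[of _ 1]) simp
qed

text \<open>Nonzero integers below p in absolute value are units with the same residue in every such
  field. The bound is essential: p itself has leading term \<open>Some (1, 1)\<close> in the p-adic
  case and \<open>None\<close> for power series.\<close>

lemma (in lead_ring) rv_of_int:
  assumes "\<bar>m\<bar> < int p"
  shows "rv (of_int m) = (if m = 0 then None else Some (0, m mod int p))"
proof -
  have "V 0 (of_int m) \<and> dg 0 (of_int m) = m mod int p"
  proof (cases m)
    case (nonneg n)
    thus ?thesis by (simp add: val_ge_of_nat digit_of_nat)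
  next
    case (neg n)
    have "V 0 (- of_nat (Suc n))" by (intro val_ge_minus val_ge_of_nat)
    moreover have "dg 0 (- of_nat (Suc n)) = (- int (Suc n)) mod int p"
      by (simp only: digit_minus[OF val_ge_of_nat] digit_of_nat mod_minus_eq)
    moreover have "of_int m = (- of_nat (Suc n) :: 'k)" by (simp add: neg)
    ultimately show ?thesis by (simp only: neg)
  qed
  moreover have "m mod int p \<noteq> 0" if "m \<noteq> 0"
    using that assms zdvd_imp_le[of "int p" "\<bar>m\<bar>"] by (auto simp: dvd_eq_mod_eq_0[symmetric])
  ultimately show ?thesis by (auto simp: rv_eq_Some_iff)
qed

theorem vf_models_transfer:
  fixes M1 M2 :: "nat \<Rightarrow> ('x, 'y, int with_infty) vf_structure"
  assumes M1: "\<And>p. prime p \<Longrightarrow> \<exists>(rv :: 'k::comm_ring_1 \<Rightarrow> lead) H \<iota>. represents p rv (M1 p) H \<iota>"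
    and M2: "\<And>p. prime p \<Longrightarrow> \<exists>(rv :: 'k \<Rightarrow> lead) H \<iota>. represents p rv (M2 p) H \<iota>"
    and \<theta>: "vf_sentence \<theta>"
  shows "finite {p. prime p \<and> \<not> (M1 p \<Turnstile>\<^sub>v \<theta> \<longleftrightarrow> M2 p \<Turnstile>\<^sub>v \<theta>)}"
proof -
  from vf_sat_uniform[of \<theta>, where 'k = 'k and 'x = 'x and 'y = 'y]
  obtain N S where S: "finite S" "\<forall>p>N. \<forall>(r1 :: 'k \<Rightarrow> lead) r2
      (M1 :: ('x, 'y, int with_infty) vf_structure) (M2 :: ('x, 'y, int with_infty) vf_structure)
      H1 H2 \<iota>1 \<iota>2 e1 e2 f g.
    represents p r1 M1 H1 \<iota>1 \<longrightarrow> represents p r2 M2 H2 \<iota>2 \<longrightarrow> same_lead S r1 r2 e1 e2 \<longrightarrow>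
    vf_sat M1 (H1 \<circ> e1) (\<iota>1 \<circ> f) g \<theta> = vf_sat M2 (H2 \<circ> e2) (\<iota>2 \<circ> f) g \<theta>"
    by (elim exE conjE) (rule that)
  have "\<forall>t. \<exists>m :: int. \<forall>e :: nat \<Rightarrow> 'k. e = (\<lambda>_. 0) \<longrightarrow> term_eval e t = of_int m"
    by (intro allI term_eval_0_of_int)
  from choice[OF this] obtain m where m: "\<And>t. term_eval (\<lambda>_. 0 :: 'k) t = of_int (m t)" by blast
  define B where "B = Max (insert N ((\<lambda>t. nat \<bar>m t\<bar>) ` S))"
  have "M1 p \<Turnstile>\<^sub>v \<theta> \<longleftrightarrow> M2 p \<Turnstile>\<^sub>v \<theta>" if p: "prime p" "B < p" for p
  proof -
    obtain r1 :: "'k \<Rightarrow> lead" and H1 \<iota>1 where 1: "represents p r1 (M1 p) H1 \<iota>1" using M1[OF p(1)] by blast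
    obtain r2 :: "'k \<Rightarrow> lead" and H2 \<iota>2 where 2: "represents p r2 (M2 p) H2 \<iota>2" using M2[OF p(1)] by blast
    interpret A: represents p r1 "M1 p" H1 \<iota>1 by (rule 1)
    interpret B: represents p r2 "M2 p" H2 \<iota>2 by (rule 2)
    have "N \<le> B" unfolding B_def using S(1) by (intro Max_ge) auto
    hence N: "N < p" using p by simp
    have "r1 (term_eval (\<lambda>_. 0) t) = r2 (term_eval (\<lambda>_. 0) t)" if "t \<in> S" for t
    proof -
      have "nat \<bar>m t\<bar> \<le> B" unfolding B_def using S(1) that by (intro Max_ge) auto
      hence "\<bar>m t\<bar> < int p" using p(2) by linarith
      thus ?thesis by (simp add: m A.rv_of_int B.rv_of_int)
    qed
    hence same: "same_lead S r1 r2 (\<lambda>_. 0) (\<lambda>_. 0)" by (simp add: same_lead_def)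
    have "M1 p \<Turnstile>\<^sub>v \<theta> \<longleftrightarrow> vf_sat (M1 p) (H1 \<circ> (\<lambda>_. 0)) (\<iota>1 \<circ> (\<lambda>_. 0)) (\<lambda>_. 0) \<theta>"
      by (intro vf_models_iff_sat \<theta>) (auto simp: A.H_range[symmetric] A.\<iota>_range[symmetric] A.group_part)
    also have "\<dots> \<longleftrightarrow> vf_sat (M2 p) (H2 \<circ> (\<lambda>_. 0)) (\<iota>2 \<circ> (\<lambda>_. 0)) (\<lambda>_. 0) \<theta>"
      by (rule S(2)[rule_format, OF N 1 2 same])
    also have "\<dots> \<longleftrightarrow> M2 p \<Turnstile>\<^sub>v \<theta>"
      by (intro vf_models_iff_sat[symmetric] \<theta>) (auto simp: B.H_range[symmetric] B.\<iota>_range[symmetric] B.group_part)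
    finally show ?thesis .
  qed
  hence "{p. prime p \<and> \<not> (M1 p \<Turnstile>\<^sub>v \<theta> \<longleftrightarrow> M2 p \<Turnstile>\<^sub>v \<theta>)} \<subseteq> {..B}" using not_le by blast
  thus ?thesis by (rule finite_subset) simp
qed

text \<open>Restricting the quantifiers to the valuation ring reduces the statement on rings to the
  one on valued fields.\<close>

primrec relativize :: "ring_formula \<Rightarrow> vf_formula" where
  "relativize (REq s t) = EqF s t"
| "relativize (RNot \<phi>) = NotV (relativize \<phi>)"
| "relativize (RAnd \<phi> \<psi>) = AndV (relativize \<phi>) (relativize \<psi>)"
| "relativize (REx n \<phi>) = ExF n (AndV (NotV (LessG (Valuation (RVar n)) GZero)) (relativize \<phi>))"

lemma vf_free_vars_relativize: "vf_free_vars (relativize \<phi>) = Pair Field_Sort ` ring_free_vars \<phi>"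
  by (induction \<phi>) auto

lemma term_eval_emb: "term_eval (\<lambda>n. emb (e n)) t = emb (term_eval e t)"
  by (induction t) (simp_all add: fls_times_fps_to_fls)

context fraction_rep
begin

lemma ring_eval_h: "ring_eval R (\<lambda>n. h (e n)) t = h (term_eval e t)"
  by (induction t) (simp_all add: h_0 h_1 h_add h_mult h_minus)

lemma H_emb_eq_iff: "H (emb f) = H (emb g) \<longleftrightarrow> h f = h g"
  by (simp add: H_eq_iff h_eq_iff I_iff)

text \<open>R embeds in its fraction field by sending \<open>h x\<close> to
  \<open>H (emb x)\<close>, and by \<open>O_carrier\<close> the image is the valuation ring, over
  which the relativized quantifiers range.\<close>

lemma ring_sat_iff_relativize:
  "ring_sat R (\<lambda>n. h (e n)) \<phi> \<longleftrightarrow>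
   vf_sat (vf_structure_of K val) (\<lambda>n. H (emb (e n))) f g (relativize \<phi>)"
proof (induction \<phi> arbitrary: e)
  case (REq s t)
  interpret represents p rv "vf_structure_of K val" H \<iota> by (rule represents_K)
  show ?case
    using ring_eval_H[of "\<lambda>n. emb (e n)"] by (simp add: ring_eval_h comp_def term_eval_emb H_emb_eq_iff)
next
  case (REx n \<phi>)
  have upd: "(\<lambda>m. h (e m))(n := h x) = (\<lambda>m. h ((e(n := x)) m))"
    "(\<lambda>m. H (emb (e m)))(n := H (emb x)) = (\<lambda>m. H (emb ((e(n := x)) m)))" for x by (auto simp: fun_eq_iff)
  have "ring_sat R (\<lambda>n. h (e n)) (REx n \<phi>) \<longleftrightarrow>
      (\<exists>x. vf_sat (vf_structure_of K val) ((\<lambda>m. H (emb (e m)))(n := H (emb x))) f g (relativize \<phi>))"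
    by (simp only: ring_sat.simps h_range[symmetric] bex_simps upd REx.IH)
  also have "\<dots> \<longleftrightarrow> (\<exists>a\<in>carrier VR.
      vf_sat (vf_structure_of K val) ((\<lambda>m. H (emb (e m)))(n := a)) f g (relativize \<phi>))"
    unfolding O_carrier by blast
  also have "\<dots> \<longleftrightarrow> vf_sat (vf_structure_of K val) (\<lambda>n. H (emb (e n))) f g (relativize (REx n \<phi>))"
    by (auto simp: vf_structure_of_def valuation_ring_def not_less)
  finally show ?case .
qed simp_all

lemma ring_models_iff_relativize:
  assumes "ring_sentence \<theta>"
  shows "R \<Turnstile>\<^sub>r \<theta> \<longleftrightarrow> vf_structure_of K val \<Turnstile>\<^sub>v relativize \<theta>"
proof -
  interpret represents p rv "vf_structure_of K val" H \<iota> by (rule represents_K)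
  have "vf_sentence (relativize \<theta>)"
    using assms by (simp add: vf_sentence_def ring_sentence_def vf_free_vars_relativize)
  hence "vf_structure_of K val \<Turnstile>\<^sub>v relativize \<theta> \<longleftrightarrow>
      vf_sat (vf_structure_of K val) (\<lambda>n. H (emb 0)) (\<lambda>n. \<iota> 0) (\<lambda>n. 0) (relativize \<theta>)"
    by (rule vf_models_iff_sat) (auto simp: H_range[symmetric] \<iota>_range[symmetric] group_part)
  also have "\<dots> \<longleftrightarrow> ring_sat R (\<lambda>n. h 0) \<theta>" by (rule ring_sat_iff_relativize[symmetric])
  also have "\<dots> \<longleftrightarrow> R \<Turnstile>\<^sub>r \<theta>"
    by (intro ring_models_iff_sat[symmetric] assms) auto
  finally show ?thesis ..
qed

end

section \<open>The transfer theorem\<close>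

lemma Qp_structure_eq: "prime p \<Longrightarrow> Qp_structure p =
    vf_structure_of (fraction_field (padic_integers p)) (adic_valuation (padic_integers p) (padic_of_fps p fps_X))"
  by (simp add: Qp_structure_def padic_uniformizer)

lemma Fp_Laurent_structure_eq: "prime p \<Longrightarrow> Fp_Laurent_structure p =
    vf_structure_of (fraction_field (Fp_power_series p))
      (adic_valuation (Fp_power_series p) (Fp_series_of_fps p fps_X))"
  by (simp add: Fp_Laurent_structure_def Fp_uniformizer)

theorem mainTheorem1:
  shows "(\<forall>\<theta>. ring_sentence \<theta> \<longrightarrow>
            finite {p::nat. prime p \<and>
              \<not> (padic_integers p \<Turnstile>\<^sub>r \<theta> \<longleftrightarrow> Fp_power_series p \<Turnstile>\<^sub>r \<theta>)})
       \<and> (\<forall>\<theta>. vf_sentence \<theta> \<longrightarrow>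
            finite {p::nat. prime p \<and>
              \<not> (Qp_structure p \<Turnstile>\<^sub>v \<theta> \<longleftrightarrow> Fp_Laurent_structure p \<Turnstile>\<^sub>v \<theta>)})"
proof -
  have Q: "\<exists>(rv :: int fls \<Rightarrow> lead) H \<iota>. represents p rv (Qp_structure p) H \<iota>" if "prime p" for p
    using fraction_rep.represents_K[OF padic_fraction_rep[OF that]] Qp_structure_eq[OF that] by metis
  have F: "\<exists>(rv :: int fls \<Rightarrow> lead) H \<iota>. represents p rv (Fp_Laurent_structure p) H \<iota>" if "prime p" for p
    using fraction_rep.represents_K[OF Fp_fraction_rep[OF that]] Fp_Laurent_structure_eq[OF that] by metis
  have vf: "finite {p::nat. prime p \<and> \<not> (Qp_structure p \<Turnstile>\<^sub>v \<theta> \<longleftrightarrow> Fp_Laurent_structure p \<Turnstile>\<^sub>v \<theta>)}"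
    if "vf_sentence \<theta>" for \<theta>
    using Q F that by (rule vf_models_transfer)
  have ring: "finite {p::nat. prime p \<and> \<not> (padic_integers p \<Turnstile>\<^sub>r \<theta> \<longleftrightarrow> Fp_power_series p \<Turnstile>\<^sub>r \<theta>)}"
    if \<theta>: "ring_sentence \<theta>" for \<theta>
  proof -
    have "padic_integers p \<Turnstile>\<^sub>r \<theta> \<longleftrightarrow> Qp_structure p \<Turnstile>\<^sub>v relativize \<theta>"
      "Fp_power_series p \<Turnstile>\<^sub>r \<theta> \<longleftrightarrow> Fp_Laurent_structure p \<Turnstile>\<^sub>v relativize \<theta>" if "prime p" for p
      using fraction_rep.ring_models_iff_relativize[OF padic_fraction_rep[OF that] \<theta>]
        fraction_rep.ring_models_iff_relativize[OF Fp_fraction_rep[OF that] \<theta>]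
      by (simp_all add: Qp_structure_eq Fp_Laurent_structure_eq that)
    moreover have "vf_sentence (relativize \<theta>)"
      using \<theta> by (simp add: vf_sentence_def ring_sentence_def vf_free_vars_relativize)
    ultimately show ?thesis using vf[of "relativize \<theta>"] by (simp cong: conj_cong)
  qed
  show ?thesis using vf ring by blast
qed

end
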